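(* Let $v(z)=(1+|z|)^s$, $z\in\mathbb R^{2d}$, for some $s\ge0$. Let $L\in GL(2d)$ and $g\in L^1(\mathbb R^d)\setminus\{0\}$ with $\hat g\in L^1(\mathbb R^d)$ satisfy $$\sum_{\kappa\in\mathbb Z^{2d}\setminus\{0\}}v(\mathcal J L^{-T}\kappa)\,|V_gg(\mathcal J L^{-T}\kappa)|<\|g\|_{L^2}^2 .$$ Then the Gabor system $\{\pi_{L\kappa}g\}_{\kappa\in\mathbb Z^{2d}}$ is a frame in $L^2(\mathbb R^d)$, with possible frame bounds $$A=\frac{2\|g\|_{L^2}^2-\sigma_{L,g}}{|\det L|},\qquad B=\frac{\sigma_{L,g}}{|\det L|}<\frac{2}{|\det L|}\|g\|_{L^2}^2,$$ where $\sigma_{L,g}:=\sum_{\kappa\in\mathbb Z^{2d}}v(\mathcal J L^{-T}\kappa)|V_gg(\mathcal J L^{-T}\kappa)|$.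
   Context: $GL(2d)$ is the set of real invertible $2d\times 2d$ matrices, $L^{-T}=(L^{-1})^T$, and $\mathcal J=\begin{pmatrix}0&-I\\ I&0\end{pmatrix}$ with $d\times d$ blocks. $\hat g(\omega)=\int g(x)e^{-2\pi ix\cdot\omega}dx$. For $z=(x,\omega)\in\mathbb R^{2d}$, $\pi_zg(t)=e^{2\pi i\omega\cdot t}g(t-x)$ and $V_gf(z)=(f,\pi_zg)=\int_{\mathbb R^d}f(t)e^{-2\pi i\omega\cdot t}\overline{g(t-x)}\,dt$. A countable family $\{x_n\}$ in a Hilbert space $\mathcal H$ is a frame with frame bounds $A,B>0$ if $A\|x\|^2\le\sum_n|(x,x_n)|^2\le B\|x\|^2$ for all $x\in\mathcal H$. *)

theory Defs
  imports "HOL-Analysis.Analysis"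
begin

text \<open>
  Phase space \<open>\<real>\<^sup>2\<^sup>d\<close> is \<open>real ^ ('d + 'd)\<close>: the coordinates \<open>Inl i\<close> of a point \<open>z\<close> form the
  position part \<open>x\<close>, the coordinates \<open>Inr i\<close> the frequency part \<open>\<omega>\<close>.
\<close>

definition pos :: "real ^ ('d + 'd) \<Rightarrow> real ^ 'd::finite" where
  "pos z = (\<chi> i. z $ Inl i)"

definition freq :: "real ^ ('d + 'd) \<Rightarrow> real ^ 'd::finite" where
  "freq z = (\<chi> i. z $ Inr i)"

definition symp_J :: "real ^ ('d::finite + 'd) ^ ('d + 'd)" where
  "symp_J = (\<chi> i j. case (i, j) of
      (Inl a, Inl b) \<Rightarrow> 0
    | (Inl a, Inr b) \<Rightarrow> if a = b then - 1 else 0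
    | (Inr a, Inl b) \<Rightarrow> if a = b then 1 else 0
    | (Inr a, Inr b) \<Rightarrow> 0)"

definition int_vecs :: "(real ^ 'n::finite) set" where
  "int_vecs = {k. \<forall>i. k $ i \<in> \<int>}"

definition weight :: "real \<Rightarrow> real ^ 'n::finite \<Rightarrow> real" where
  "weight s z = (1 + norm z) powr s"

text \<open>
  Elements of \<open>L\<^sup>1\<close> and \<open>L\<^sup>2\<close> are represented by Lebesgue measurable functions rather than by
  classes modulo equality almost everywhere; accordingly, \<open>g \<noteq> 0\<close> in \<open>L\<^sup>1\<close> means that \<open>g\<close>
  does not vanish almost everywhere.
\<close>

definition L2 :: "(real ^ 'd::finite \<Rightarrow> complex) set" where
  "L2 = {f. f \<in> borel_measurable lebesgue \<and> integrable lebesgue (\<lambda>t. (cmod (f t))\<^sup>2)}"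

definition inner_L2 :: "(real ^ 'd::finite \<Rightarrow> complex) \<Rightarrow> (real ^ 'd \<Rightarrow> complex) \<Rightarrow> complex" where
  "inner_L2 f h = (LINT t|lebesgue. f t * cnj (h t))"

definition norm_L2 :: "(real ^ 'd::finite \<Rightarrow> complex) \<Rightarrow> real" where
  "norm_L2 f = sqrt (LINT t|lebesgue. (cmod (f t))\<^sup>2)"

definition fourier :: "(real ^ 'd::finite \<Rightarrow> complex) \<Rightarrow> real ^ 'd \<Rightarrow> complex" where
  "fourier g \<omega> = (LINT x|lebesgue. g x * exp (- (2 * of_real pi * \<i> * of_real (x \<bullet> \<omega>))))"

definition tf_shift ::
  "real ^ ('d + 'd) \<Rightarrow> (real ^ 'd::finite \<Rightarrow> complex) \<Rightarrow> real ^ 'd \<Rightarrow> complex" where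
  "tf_shift z g t = exp (2 * of_real pi * \<i> * of_real (freq z \<bullet> t)) * g (t - pos z)"

definition stft ::
  "(real ^ 'd::finite \<Rightarrow> complex) \<Rightarrow> (real ^ 'd \<Rightarrow> complex) \<Rightarrow> real ^ ('d + 'd) \<Rightarrow> complex" where
  "stft g f z = inner_L2 f (tf_shift z g)"

text \<open>
  Frames in a Hilbert space with carrier \<open>H\<close> and complex inner product \<open>ip\<close>, where
  \<open>Re (ip x x)\<close> is the squared norm.  Summability is required explicitly because \<open>infsum\<close> is \<open>0\<close>
  on families that are not summable.
\<close>

definition frame_with_bounds ::
  "'h set \<Rightarrow> ('h \<Rightarrow> 'h \<Rightarrow> complex) \<Rightarrow> 'i set \<Rightarrow> ('i \<Rightarrow> 'h) \<Rightarrow> real \<Rightarrow> real \<Rightarrow> bool" where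
  "frame_with_bounds H ip I e A B \<longleftrightarrow>
     countable I \<and> e ` I \<subseteq> H \<and> 0 < A \<and> 0 < B \<and>
     (\<forall>x\<in>H. (\<lambda>n. (cmod (ip x (e n)))\<^sup>2) summable_on I \<and>
        A * Re (ip x x) \<le> (\<Sum>\<^sub>\<infinity>n\<in>I. (cmod (ip x (e n)))\<^sup>2) \<and>
        (\<Sum>\<^sub>\<infinity>n\<in>I. (cmod (ip x (e n)))\<^sup>2) \<le> B * Re (ip x x))"

definition adj_term ::
  "real \<Rightarrow> real ^ ('d::finite + 'd) ^ ('d + 'd) \<Rightarrow> (real ^ 'd \<Rightarrow> complex) \<Rightarrow> real ^ ('d + 'd) \<Rightarrow> real" where
  "adj_term s L g \<kappa> =
     (let z = (symp_J ** transpose (matrix_inv L)) *v \<kappa> in weight s z * cmod (stft g g z))"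

definition sigma_Lg ::
  "real \<Rightarrow> real ^ ('d::finite + 'd) ^ ('d + 'd) \<Rightarrow> (real ^ 'd \<Rightarrow> complex) \<Rightarrow> real" where
  "sigma_Lg s L g = (\<Sum>\<^sub>\<infinity>\<kappa>\<in>int_vecs. adj_term s L g \<kappa>)"

end

theory Submission
  imports Defs "HOL-Probability.Characteristic_Functions"
begin

text \<open>
  For \<open>f \<in> L\<^sup>2\<close> put \<open>\<Phi>(w) = \<Sum>\<^sub>\<kappa> |V\<^sub>g f(L\<kappa> + Lw)|\<^sup>2\<close>, so that the frame sum of \<open>f\<close> is \<open>\<Phi>(0)\<close>.  The
  function \<open>\<Phi>\<close> is periodic under integer vectors, and its Fourier coefficient at \<open>\<kappa>\<close> is, up to
  phases and the factor \<open>1 / |det L|\<close>, the product of the values of \<open>V\<^sub>f f\<close> and of \<open>V\<^sub>g g\<close> at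
  \<open>J L\<^sup>-\<^sup>T \<kappa>\<close>.  Since \<open>|V\<^sub>f f| \<le> \<parallel>f\<parallel>\<^sup>2\<close>, the coefficients with \<open>\<kappa> \<noteq> 0\<close> sum up to at most
  \<open>\<parallel>f\<parallel>\<^sup>2 \<rho> / |det L|\<close> with \<open>\<rho> = \<Sum>\<^sub>\<kappa>\<^sub>\<noteq>\<^sub>0 |V\<^sub>g g(J L\<^sup>-\<^sup>T \<kappa>)|\<close>, while the coefficient at \<open>0\<close> is
  \<open>\<parallel>f\<parallel>\<^sup>2 \<parallel>g\<parallel>\<^sup>2 / |det L|\<close>.  Hence \<open>\<Phi>\<close> stays between \<open>\<parallel>f\<parallel>\<^sup>2 (\<parallel>g\<parallel>\<^sup>2 - \<rho>) / |det L|\<close> and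
  \<open>\<parallel>f\<parallel>\<^sup>2 (\<parallel>g\<parallel>\<^sup>2 + \<rho>) / |det L|\<close>.  As the weight is at least \<open>1\<close>, and equal to \<open>1\<close> at the origin, these bounds imply the claimed ones.

  The work lies in making this precise at the single point \<open>w = 0\<close>.  Instead of summing the Fourier
  series, \<open>\<Phi>\<close> is integrated over the unit cube against \<open>|T|\<^sup>2\<close> for trigonometric polynomials \<open>T\<close>.
  Unfolding the cube gives \<open>\<integral>|T V\<^sub>g f|\<^sup>2\<close> over phase space (\<open>stft_periodization\<close>).  Multiplying
  \<open>V\<^sub>g f\<close> by a character translates \<open>f\<close> and \<open>g\<close>, so this integral is, by the Plancherel identity in
  the frequency variable, a Hermitian form in the coefficients of \<open>T\<close>, with the constant diagonal
  \<open>\<parallel>f\<parallel>\<^sup>2 \<parallel>g\<parallel>\<^sup>2\<close> and with row sums off the diagonal at most \<open>\<parallel>f\<parallel>\<^sup>2 \<rho>\<close> (\<open>stft_quadratic_bound\<close>).  The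
  bounds thus hold for all averages of \<open>\<Phi>\<close> with weights \<open>|T|\<^sup>2\<close>, in particular for \<open>T\<close> that are
  concentrated near the origin (\<open>concentrated_trig_polynomial\<close>).

  Finite partial sums of \<open>\<Phi>\<close> are continuous, which yields the upper bound at \<open>0\<close>
  (\<open>lattice_energy_finite_sum_le\<close>).  It holds for every \<open>f\<close>, and \<open>\<Phi>(w)\<close> is the frame sum of the
  signal \<open>f\<close> shifted by \<open>-Lw\<close>; since time-frequency shifts are strongly continuous
  (\<open>isCont_energy_tf_shift_diff\<close>), \<open>\<Phi>\<close> itself is continuous, and the lower bound follows in the
  same way (\<open>lattice_energy_ge\<close>).
\<close>

section \<open>Lebesgue measure under linear maps, splittings and tilings\<close>

lemma Basis_real_vec: "(Basis :: (real ^ 'n::finite) set) = range (\<lambda>i. axis i 1)"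
  by (auto simp: Basis_vec_def)

lemma prod_Basis_vec:
  "(\<Prod>b\<in>(Basis :: (real ^ 'n::finite) set). h b) = (\<Prod>i\<in>UNIV. h (axis i 1))"
proof -
  have inj: "inj (\<lambda>i::'n. axis i (1::real))"
    by (auto simp: inj_on_def axis_eq_axis)
  show ?thesis
    unfolding Basis_real_vec prod.reindex[OF inj] by (simp add: o_def)
qed

lemma integral_lborel_translate:
  fixes F :: "'a::euclidean_space \<Rightarrow> complex"
  assumes [measurable]: "F \<in> borel_measurable borel"
  shows "(LINT x|lborel. F (x + c)) = (LINT x|lborel. F x)"
proof -
  have "(LINT x|distr lborel borel ((+) c). F x) = (LINT x|lborel. F (c + x))"
    by (rule integral_distr) auto
  then show ?thesis
    by (simp add: lborel_distr_plus add.commute)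
qed

lemma nn_integral_lborel_translate:
  fixes F :: "'a::euclidean_space \<Rightarrow> ennreal"
  assumes [measurable]: "F \<in> borel_measurable borel"
  shows "(\<integral>\<^sup>+x. F (x + c) \<partial>lborel) = (\<integral>\<^sup>+x. F x \<partial>lborel)"
proof -
  have "(\<integral>\<^sup>+x. F x \<partial>distr lborel borel ((+) c)) = (\<integral>\<^sup>+x. F (c + x) \<partial>lborel)"
    by (rule nn_integral_distr) auto
  then show ?thesis
    by (simp add: lborel_distr_plus add.commute)
qed

lemma nn_integral_lborel_reflect:
  fixes F :: "'a::euclidean_space \<Rightarrow> ennreal"
  assumes [measurable]: "F \<in> borel_measurable borel"
  shows "(\<integral>\<^sup>+x. F (c - x) \<partial>lborel) = (\<integral>\<^sup>+x. F x \<partial>lborel)"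
proof -
  have "lborel = density (distr lborel borel (\<lambda>x. c + (-1) *\<^sub>R x)) (\<lambda>_. \<bar>-1::real\<bar>^DIM('a))"
    by (rule lborel_affine) simp
  then have "(lborel :: 'a measure) = distr lborel borel (\<lambda>x. c - x)"
    by (simp add: density_1)
  then have "(\<integral>\<^sup>+x. F x \<partial>lborel) = (\<integral>\<^sup>+x. F x \<partial>distr lborel borel (\<lambda>x. c - x))"
    by simp
  also have "\<dots> = (\<integral>\<^sup>+x. F (c - x) \<partial>lborel)"
    by (rule nn_integral_distr) auto
  finally show ?thesis by simp
qed

lemma integral_lborel_scale:
  fixes F :: "'a::euclidean_space \<Rightarrow> complex"
  assumes [measurable]: "F \<in> borel_measurable borel" and c: "c > 0"
  shows "(LINT x|lborel. F x) = c ^ DIM('a) * (LINT x|lborel. F (c *\<^sub>R x))"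
proof -
  have "(lborel :: 'a measure) = density (distr lborel borel (\<lambda>x. 0 + c *\<^sub>R x)) (\<lambda>_. \<bar>c\<bar>^DIM('a))"
    by (rule lborel_affine) (use c in simp)
  then have "(LINT x|lborel. F x) = (LINT x|density (distr lborel borel (\<lambda>x. c *\<^sub>R x)) (\<lambda>_. c^DIM('a)). F x)"
    using c by simp
  also have "\<dots> = (LINT x|distr lborel borel (\<lambda>x. c *\<^sub>R x). c^DIM('a) *\<^sub>R F x)"
    by (rule integral_density) (use c in auto)
  also have "\<dots> = (LINT x|lborel. c^DIM('a) *\<^sub>R F (c *\<^sub>R x))"
    by (rule integral_distr) auto
  finally show ?thesis by (simp add: scaleR_conv_of_real)
qed

lemma matrix_vector_mult_measurable [measurable]:
  fixes A :: "real ^ 'n::finite ^ 'm::finite"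
  shows "(*v) A \<in> borel_measurable borel"
  by (intro borel_measurable_continuous_onI linear_continuous_on)
     (simp add: linear_linear matrix_vector_mul_linear)

text \<open>
  Along the coordinate \<open>m\<close>, the shear is a translation by an amount that depends only on the other
  coordinates, so Fubini reduces the claim to translation invariance in that coordinate.
\<close>

lemma nn_integral_lborel_shear:
  fixes F :: "real ^ 'n::finite \<Rightarrow> ennreal"
  assumes [measurable]: "F \<in> borel_measurable borel" and mn: "m \<noteq> n"
  shows "(\<integral>\<^sup>+x. F (x + (c * x $ n) *\<^sub>R axis m 1) \<partial>lborel) = (\<integral>\<^sup>+x. F x \<partial>lborel)"
proof -
  interpret product_sigma_finite "\<lambda>_::real ^ 'n. lborel :: real measure"
    by unfold_locales
  define e where "e = (axis m 1 :: real ^ 'n)"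
  define I where "I = Basis - {e}"
  have e: "e \<in> Basis" and en: "e $ n = 0"
    using mn by (auto simp: e_def axis_def Basis_real_vec)
  have I: "Basis = insert e I" "finite I" "e \<notin> I"
    using e by (auto simp: I_def)
  have fubini: "(\<integral>\<^sup>+x. H x \<partial>lborel) =
      (\<integral>\<^sup>+p. \<integral>\<^sup>+y. H (y *\<^sub>R e + (\<Sum>b\<in>I. p b *\<^sub>R b)) \<partial>lborel \<partial>Pi\<^sub>M I (\<lambda>_. lborel))"
    if [measurable]: "H \<in> borel_measurable borel" for H :: "real ^ 'n \<Rightarrow> ennreal"
  proof -
    have "(\<integral>\<^sup>+x. H x \<partial>lborel) = (\<integral>\<^sup>+p. H (\<Sum>b\<in>insert e I. p b *\<^sub>R b) \<partial>Pi\<^sub>M (insert e I) (\<lambda>_. lborel))"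
      by (subst lborel_eq, subst nn_integral_distr) (simp_all add: I(1)[symmetric])
    also have "\<dots> = (\<integral>\<^sup>+p. \<integral>\<^sup>+y. H (\<Sum>b\<in>insert e I. (p(e := y)) b *\<^sub>R b) \<partial>lborel \<partial>Pi\<^sub>M I (\<lambda>_. lborel))"
      using I by (intro product_nn_integral_insert) auto
    also have "\<dots> = (\<integral>\<^sup>+p. \<integral>\<^sup>+y. H (y *\<^sub>R e + (\<Sum>b\<in>I. p b *\<^sub>R b)) \<partial>lborel \<partial>Pi\<^sub>M I (\<lambda>_. lborel))"
    proof -
      have "(\<Sum>b\<in>insert e I. (p(e := y)) b *\<^sub>R b) = y *\<^sub>R e + (\<Sum>b\<in>I. p b *\<^sub>R b)" for p y
      proof -
        have "(\<Sum>b\<in>I. (p(e := y)) b *\<^sub>R b) = (\<Sum>b\<in>I. p b *\<^sub>R b)"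
          using I by (intro sum.cong) auto
        then show ?thesis using I(2,3) by (simp del: fun_upd_apply add: fun_upd_same)
      qed
      then show ?thesis by simp
    qed
    finally show ?thesis .
  qed
  have "(\<integral>\<^sup>+x. F (x + (c * x $ n) *\<^sub>R e) \<partial>lborel) =
      (\<integral>\<^sup>+p. \<integral>\<^sup>+y. F ((y + c * (\<Sum>b\<in>I. p b *\<^sub>R b) $ n) *\<^sub>R e + (\<Sum>b\<in>I. p b *\<^sub>R b)) \<partial>lborel \<partial>Pi\<^sub>M I (\<lambda>_. lborel))"
    by (subst fubini) (simp_all add: en algebra_simps)
  also have "\<dots> = (\<integral>\<^sup>+p. \<integral>\<^sup>+y. F (y *\<^sub>R e + (\<Sum>b\<in>I. p b *\<^sub>R b)) \<partial>lborel \<partial>Pi\<^sub>M I (\<lambda>_. lborel))"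
  proof (rule nn_integral_cong)
    fix p
    let ?R = "\<Sum>b\<in>I. p b *\<^sub>R b"
    show "(\<integral>\<^sup>+y. F ((y + c * ?R $ n) *\<^sub>R e + ?R) \<partial>lborel) = (\<integral>\<^sup>+y. F (y *\<^sub>R e + ?R) \<partial>lborel)"
      by (rule nn_integral_lborel_translate[of "\<lambda>y. F (y *\<^sub>R e + ?R)"]) simp
  qed
  also have "\<dots> = (\<integral>\<^sup>+x. F x \<partial>lborel)"
    by (subst fubini) simp_all
  finally show ?thesis by (simp add: e_def)
qed

lemma nn_integral_lborel_permute:
  fixes F :: "real ^ 'n::finite \<Rightarrow> ennreal"
  assumes [measurable]: "F \<in> borel_measurable borel" and p: "bij (p :: 'n \<Rightarrow> 'n)"
  shows "(\<integral>\<^sup>+x. F (\<chi> i. x $ p i) \<partial>lborel) = (\<integral>\<^sup>+x. F x \<partial>lborel)"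
proof -
  let ?T = "\<lambda>x :: real ^ 'n. (\<chi> i. x $ p i) :: real ^ 'n"
  have [measurable]: "?T \<in> borel_measurable borel"
    by (intro borel_measurable_continuous_onI continuous_on_vec_lambda continuous_intros)
  have bij: "surj p" "inj p" using p by (auto simp: bij_def)
  have "(lborel :: (real ^ 'n) measure) = distr lborel borel ?T"
  proof (rule lborel_eqI)
    fix l u :: "real ^ 'n" assume le: "\<And>b. b \<in> Basis \<Longrightarrow> l \<bullet> b \<le> u \<bullet> b"
    have le': "l $ i \<le> u $ i" for i
      using le[of "axis i 1"] by (simp add: inner_axis)
    let ?l = "(\<chi> i. l $ inv p i) :: real ^ 'n" and ?u = "(\<chi> i. u $ inv p i) :: real ^ 'n"
    have "?T -` box l u = box ?l ?u"
    proof -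
      have "(\<forall>i. l $ i < x $ p i \<and> x $ p i < u $ i) \<longleftrightarrow> (\<forall>i. l $ inv p i < x $ i \<and> x $ i < u $ inv p i)" for x :: "real ^ 'n"
        by (metis bij inv_f_f surj_f_inv_f)
      then show ?thesis by (auto simp: mem_box_cart)
    qed
    then have "emeasure (distr lborel borel ?T) (box l u) = emeasure lborel (box ?l ?u)"
      by (simp add: emeasure_distr)
    also have "\<dots> = (\<Prod>b\<in>Basis. (?u - ?l) \<bullet> b)"
      using le' by (intro emeasure_lborel_box) (auto simp: Basis_real_vec inner_axis)
    also have "(\<Prod>b\<in>Basis. (?u - ?l) \<bullet> b) = (\<Prod>i\<in>UNIV. u $ inv p i - l $ inv p i)"
      by (simp add: prod_Basis_vec inner_axis)
    also have "\<dots> = (\<Prod>i\<in>UNIV. u $ i - l $ i)"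
      using bij_imp_bij_inv[OF p] by (rule prod.reindex_bij_betw)
    also have "\<dots> = (\<Prod>b\<in>Basis. (u - l) \<bullet> b)"
      by (simp add: prod_Basis_vec inner_axis)
    finally show "emeasure (distr lborel borel ?T) (box l u) = ennreal (\<Prod>b\<in>Basis. (u - l) \<bullet> b)" .
  qed simp
  then have "(\<integral>\<^sup>+x. F x \<partial>lborel) = (\<integral>\<^sup>+x. F x \<partial>distr lborel borel ?T)"
    by simp
  also have "\<dots> = (\<integral>\<^sup>+x. F (?T x) \<partial>lborel)"
    by (rule nn_integral_distr) auto
  finally show ?thesis by simp
qed

lemma nn_integral_lborel_diagonal:
  fixes A :: "real ^ 'n::finite ^ 'n"
  assumes [measurable]: "F \<in> borel_measurable borel"
    and diag: "\<And>i j. i \<noteq> j \<Longrightarrow> A $ i $ j = 0" and nz: "\<And>i. A $ i $ i \<noteq> 0"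
  shows "(\<integral>\<^sup>+x. F x \<partial>lborel) = ennreal (\<Prod>i\<in>UNIV. \<bar>A $ i $ i\<bar>) * (\<integral>\<^sup>+x. F (A *v x) \<partial>lborel)"
proof -
  define c where "c b = (A *v b) \<bullet> b" for b
  have c: "c (axis i 1) = A $ i $ i" for i
    by (simp add: c_def inner_axis matrix_vector_mult_basis column_def)
  have Ax: "A *v x = 0 + (\<Sum>j\<in>Basis. (c j * (x \<bullet> j)) *\<^sub>R j)" for x
  proof -
    have "(A *v x) \<bullet> b = c b * (x \<bullet> b)" if b0: "b \<in> Basis" for b
    proof -
      obtain i where b: "b = axis i 1" using b0 by (auto simp: Basis_real_vec)
      have "(A *v x) $ i = (\<Sum>j\<in>UNIV. A $ i $ j * x $ j)"
        by (simp add: matrix_vector_mult_def)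
      also have "\<dots> = (\<Sum>j\<in>UNIV. if j = i then A $ i $ i * x $ i else 0)"
      proof (rule sum.cong)
        show "A $ i $ j * x $ j = (if j = i then A $ i $ i * x $ i else 0)" for j
          using diag[of i j] by (cases "i = j") auto
      qed simp
      finally have "(A *v x) $ i = A $ i $ i * x $ i"
        by simp
      then show ?thesis by (simp add: b c inner_axis)
    qed
    note comp = this
    show ?thesis
      by (rule euclidean_eqI) (simp only: add_0 inner_sum_left_Basis comp)
  qed
  have "(lborel :: (real ^ 'n) measure) = density (distr lborel borel ((*v) A)) (\<lambda>_. (\<Prod>j\<in>Basis. \<bar>c j\<bar>))"
  proof -
    have nzc: "c j \<noteq> 0" if j: "j \<in> Basis" for j
    proof -
      obtain i where "j = axis i 1" using j by (auto simp: Basis_real_vec)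
      then show ?thesis using nz[of i] by (simp only: c not_False_eq_True)
    qed
    show ?thesis
      using lborel_affine_euclidean[of c, OF nzc, where t = 0] by (simp only: Ax[symmetric])
  qed
  moreover have "(\<Prod>j\<in>Basis. \<bar>c j\<bar>) = (\<Prod>i\<in>UNIV. \<bar>A $ i $ i\<bar>)"
    by (simp add: prod_Basis_vec c)
  ultimately have "(\<integral>\<^sup>+x. F x \<partial>lborel) =
     (\<integral>\<^sup>+x. F x \<partial>density (distr lborel borel ((*v) A)) (\<lambda>_. ennreal (\<Prod>i\<in>UNIV. \<bar>A $ i $ i\<bar>)))"
    by simp
  also have "\<dots> = ennreal (\<Prod>i\<in>UNIV. \<bar>A $ i $ i\<bar>) * (\<integral>\<^sup>+x. F (A *v x) \<partial>lborel)"
    by (simp add: nn_integral_density nn_integral_cmult nn_integral_distr)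
  finally show ?thesis .
qed

text \<open>
  The formula is multiplicative in the matrix, and every matrix is a product of elementary ones.  The
  index type is an arbitrary finite type, as phase space is indexed by the unordered sum \<open>'d + 'd\<close>.
\<close>

lemma nn_integral_lborel_linear:
  fixes A :: "real ^ 'n::finite ^ 'n"
  assumes "det A \<noteq> 0" "F \<in> borel_measurable borel"
  shows "(\<integral>\<^sup>+x. F x \<partial>lborel) = ennreal \<bar>det A\<bar> * (\<integral>\<^sup>+x. F (A *v x) \<partial>lborel)"
  using assms
proof (induction A arbitrary: F rule: induct_matrix_elementary[case_names mult zero_row diagonal swap1 idplus])
  case (mult A B)
  have [measurable]: "F \<in> borel_measurable borel" by fact
  have d: "det A \<noteq> 0" "det B \<noteq> 0" using mult.prems by (auto simp: det_mul)
  have "(\<integral>\<^sup>+x. F x \<partial>lborel) = ennreal \<bar>det A\<bar> * (\<integral>\<^sup>+x. F (A *v x) \<partial>lborel)"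
    using d by (intro mult.IH) auto
  also have "(\<integral>\<^sup>+x. F (A *v x) \<partial>lborel) = ennreal \<bar>det B\<bar> * (\<integral>\<^sup>+x. F (A *v (B *v x)) \<partial>lborel)"
    using d by (intro mult.IH) auto
  finally show ?case
    by (simp add: det_mul abs_mult ennreal_mult mult.assoc matrix_vector_mul_assoc)
next
  case (zero_row A i)
  then show ?case by (simp add: det_zero_row)
next
  case (diagonal A)
  have d: "det A = (\<Prod>i\<in>UNIV. A $ i $ i)"
    using diagonal.hyps by (rule det_diagonal)
  then have "A $ i $ i \<noteq> 0" for i using diagonal.prems by simp
  then show ?case
    using nn_integral_lborel_diagonal[of F A] diagonal by (simp add: d abs_prod)
next
  case (swap1 m n)
  let ?p = "Transposition.transpose m n"
  let ?A = "(\<chi> i j. mat 1 $ i $ ?p j) :: real ^ 'n ^ 'n"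
  have Ax: "?A *v x = (\<chi> i. x $ ?p i)" for x
  proof -
    have "(\<Sum>j\<in>UNIV. mat 1 $ i $ ?p j * x $ j) = (\<Sum>j\<in>UNIV. if j = ?p i then x $ j else 0)" for i
      by (intro sum.cong) (auto simp: mat_def)
    then show ?thesis by (simp add: matrix_vector_mult_def vec_eq_iff)
  qed
  have "?A ** ?A = mat 1"
    by (rule matrix_eq[THEN iffD2]) (simp add: matrix_vector_mul_assoc[symmetric] Ax)
  then have "det ?A * det ?A = 1" by (metis det_I det_mul)
  then have "(det ?A)\<^sup>2 = 1" by (simp only: power2_eq_square)
  then have "\<bar>det ?A\<bar> = 1" by (simp only: abs_square_eq_1)
  then show ?case
    using nn_integral_lborel_permute[of F ?p] swap1.prems by (simp add: Ax)
next
  case (idplus m n c)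
  let ?A = "(\<chi> i j. if i = m \<and> j = n then c else of_bool (i = j)) :: real ^ 'n ^ 'n"
  have Ax: "?A *v x = x + (c * x $ n) *\<^sub>R axis m 1" for x
  proof -
    have "(\<Sum>j\<in>UNIV. (if i = m \<and> j = n then c else of_bool (i = j)) * x $ j) =
       (\<Sum>j\<in>UNIV. (if j = i then x $ j else 0) + (if j = n then (if i = m then c * x $ n else 0) else 0))" for i
      using idplus.hyps by (intro sum.cong) auto
    then show ?thesis by (simp add: matrix_vector_mult_def vec_eq_iff sum.distrib axis_def)
  qed
  have "?A = (\<chi> k. if k = m then row m (mat 1) + c *s row n (mat 1) else row k (mat 1))"
    using idplus.hyps by (auto simp: vec_eq_iff row_def mat_def)
  then have "det ?A = 1" using idplus.hyps by (simp add: det_row_operation)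
  then show ?case
    using nn_integral_lborel_shear[of F m n c] idplus by (simp add: Ax)
qed

lemma prod_UNIV_sum:
  "(\<Prod>i\<in>(UNIV :: ('a::finite + 'b::finite) set). h i) = (\<Prod>i\<in>UNIV. h (Inl i)) * (\<Prod>i\<in>UNIV. h (Inr i))"
proof -
  have "(\<Prod>i\<in>range Inl \<union> range Inr. h i) = (\<Prod>i\<in>range Inl. h i) * (\<Prod>i\<in>range Inr. h i)"
    by (rule prod.union_disjoint) auto
  then show ?thesis
    by (simp add: prod.reindex o_def flip: UNIV_sum)
qed

definition tf_point :: "real ^ 'd \<Rightarrow> real ^ 'd \<Rightarrow> real ^ ('d::finite + 'd)" where
  "tf_point x y = (\<chi> i. case i of Inl a \<Rightarrow> x $ a | Inr a \<Rightarrow> y $ a)"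

lemma pos_tf_point [simp]: "pos (tf_point x y) = x" and freq_tf_point [simp]: "freq (tf_point x y) = y"
  by (simp_all add: pos_def freq_def tf_point_def)

lemma tf_point_measurable [measurable]: "(\<lambda>(x, y). tf_point x y) \<in> borel_measurable (borel \<Otimes>\<^sub>M borel)"
proof -
  have "continuous_on UNIV (\<lambda>p::(real^'d) \<times> (real^'d). tf_point (fst p) (snd p))"
    unfolding tf_point_def
    apply (rule continuous_on_vec_lambda)
    subgoal for i by (cases i) (auto intro!: continuous_intros)
    done
  then show ?thesis
    unfolding borel_prod split_beta by (rule borel_measurable_continuous_onI)
qed

lemma lborel_tf_point:
  "(lborel :: (real ^ ('d::finite + 'd)) measure) = distr (lborel \<Otimes>\<^sub>M lborel) borel (\<lambda>(x, y). tf_point x y)"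
proof (rule lborel_eqI)
  fix l u :: "real ^ ('d + 'd)" assume le: "\<And>b. b \<in> Basis \<Longrightarrow> l \<bullet> b \<le> u \<bullet> b"
  have le': "l $ i \<le> u $ i" for i
    using le[of "axis i 1"] by (simp add: inner_axis)
  have sp: "(\<lambda>(x, y). tf_point x y) -` box l u = box (pos l) (pos u) \<times> box (freq l) (freq u)"
    by (auto simp: mem_box_cart tf_point_def pos_def freq_def split: sum.splits)
  have e: "emeasure lborel (box (a :: real ^ 'd) b) = (\<Prod>i\<in>UNIV. (b $ i - a $ i))" if "\<And>i. a $ i \<le> b $ i" for a b
    apply (subst emeasure_lborel_box)
    subgoal using that by (auto simp: Basis_real_vec inner_axis)
    by (simp add: prod_Basis_vec inner_axis)
  have "emeasure (distr (lborel \<Otimes>\<^sub>M lborel) borel (\<lambda>(x, y). tf_point x y)) (box l u)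
     = emeasure (lborel \<Otimes>\<^sub>M lborel) (box (pos l) (pos u) \<times> box (freq l) (freq u))"
    by (subst emeasure_distr) (auto simp: sp space_pair_measure)
  also have "\<dots> = emeasure lborel (box (pos l) (pos u)) * emeasure lborel (box (freq l) (freq u))"
    by (rule lborel.emeasure_pair_measure_Times) auto
  also have "\<dots> = ennreal ((\<Prod>i\<in>UNIV. (u $ Inl i - l $ Inl i)) * (\<Prod>i\<in>UNIV. (u $ Inr i - l $ Inr i)))"
    by (simp add: e pos_def freq_def le' ennreal_mult prod_nonneg)
  also have "\<dots> = ennreal (\<Prod>i\<in>UNIV. (u $ i - l $ i))"
    by (simp only: prod_UNIV_sum)
  also have "\<dots> = ennreal (\<Prod>b\<in>Basis. (u - l) \<bullet> b)"
    by (simp add: prod_Basis_vec inner_axis)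
  finally show "emeasure (distr (lborel \<Otimes>\<^sub>M lborel) borel (\<lambda>(x, y). tf_point x y)) (box l u) = ennreal (\<Prod>b\<in>Basis. (u - l) \<bullet> b)" .
qed simp

lemma nn_integral_lborel_tf_point:
  fixes F :: "real ^ ('d::finite + 'd) \<Rightarrow> ennreal"
  assumes [measurable]: "F \<in> borel_measurable borel"
  shows "(\<integral>\<^sup>+z. F z \<partial>lborel) = (\<integral>\<^sup>+x. \<integral>\<^sup>+y. F (tf_point x y) \<partial>lborel \<partial>lborel)"
  apply (subst lborel_tf_point)
  apply (subst nn_integral_distr)
    apply (simp_all add: split_beta lborel.nn_integral_fst[symmetric])
  done

lemma
  fixes f :: "'a::euclidean_space \<Rightarrow> real \<Rightarrow> complex"
  assumes int: "\<And>b. b \<in> Basis \<Longrightarrow> integrable lborel (f b)"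
  shows integrable_lborel_prod: "integrable lborel (\<lambda>x. \<Prod>b\<in>Basis. f b (x \<bullet> b))"
    and integral_lborel_prod: "(LINT x|lborel. (\<Prod>b\<in>Basis. f b (x \<bullet> b))) = (\<Prod>b\<in>Basis. (LINT x|lborel. f b x))"
proof -
  have [measurable]: "f b \<in> borel_measurable borel" if "b \<in> Basis" for b
    using borel_measurable_integrable[OF int[OF that]] by simp
  interpret product_sigma_finite "\<lambda>_::'a. lborel :: real measure"
    by unfold_locales
  have eq: "(\<Prod>b\<in>Basis. f b ((\<Sum>c\<in>Basis. p c *\<^sub>R c) \<bullet> b)) = (\<Prod>b\<in>Basis. f b (p b))" for p
    by (intro prod.cong) (auto simp: inner_sum_left inner_Basis if_distrib cong: if_cong)
  show "integrable lborel (\<lambda>x. \<Prod>b\<in>Basis. f b (x \<bullet> b))"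
    apply (subst lborel_eq)
    apply (subst integrable_distr_eq)
      apply (auto simp: eq intro!: product_integrable_prod int)
    done
  show "(LINT x|lborel. (\<Prod>b\<in>Basis. f b (x \<bullet> b))) = (\<Prod>b\<in>Basis. (LINT x|lborel. f b x))"
    apply (subst lborel_eq)
    apply (subst integral_distr)
      apply (auto simp: eq intro!: product_integral_prod int)
    done
qed

text \<open>
  Half-open, so that every point lies in exactly one integer translate of the cube.
\<close>

definition unit_cube :: "(real ^ 'n::finite) set" where
  "unit_cube = {w. \<forall>i. - 1 / 2 \<le> w $ i \<and> w $ i < 1 / 2}"

lemma countable_int_vecs [simp]: "countable (int_vecs :: (real ^ 'n::finite) set)"
proof -
  have "int_vecs \<subseteq> range (\<lambda>f :: 'n \<Rightarrow> int. (\<chi> i. of_int (f i)) :: real ^ 'n)"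
  proof
    fix k :: "real ^ 'n" assume "k \<in> int_vecs"
    then have "k = (\<chi> i. of_int \<lfloor>k $ i\<rfloor>)"
      by (auto simp: int_vecs_def vec_eq_iff Ints_def)
    then show "k \<in> range (\<lambda>f :: 'n \<Rightarrow> int. (\<chi> i. of_int (f i)) :: real ^ 'n)" by auto
  qed
  then show ?thesis by (rule countable_subset) simp
qed

lemma unit_cube_measurable [measurable]: "unit_cube \<in> sets borel"
  unfolding unit_cube_def by measurable

lemma unit_cube_tiles:
  fixes w :: "real ^ 'n::finite"
  shows "\<exists>!k. k \<in> int_vecs \<and> w - k \<in> unit_cube"
proof
  let ?k = "(\<chi> i. of_int \<lfloor>w $ i + 1/2\<rfloor>) :: real ^ 'n"
  have "w - ?k \<in> unit_cube"
    by (auto simp: unit_cube_def) linarith+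
  then show "?k \<in> int_vecs \<and> w - ?k \<in> unit_cube"
    by (simp add: int_vecs_def)
  fix m :: "real ^ 'n" assume m: "m \<in> int_vecs \<and> w - m \<in> unit_cube"
  have "m $ i = of_int \<lfloor>w $ i + 1/2\<rfloor>" for i
  proof -
    obtain j where j: "m $ i = of_int j" using m by (auto simp: int_vecs_def Ints_def)
    have "- 1 / 2 \<le> w $ i - m $ i" "w $ i - m $ i < 1 / 2" using m by (auto simp: unit_cube_def)
    then have "\<lfloor>w $ i + 1/2\<rfloor> = j" unfolding j by linarith
    then show ?thesis by (simp add: j)
  qed
  then show "m = ?k" by (simp add: vec_eq_iff)
qed

lemma nn_integral_lborel_periodize:
  fixes G :: "real ^ 'n::finite \<Rightarrow> ennreal"
  assumes [measurable]: "G \<in> borel_measurable borel"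
  shows "(\<integral>\<^sup>+w. G w \<partial>lborel) =
    (\<integral>\<^sup>+w. (\<integral>\<^sup>+k. G (w + k) \<partial>count_space int_vecs) * indicator unit_cube w \<partial>lborel)"
proof -
  have "G w = (\<integral>\<^sup>+k. G w * indicator unit_cube (w - k) \<partial>count_space int_vecs)" for w
  proof -
    obtain k where k: "k \<in> int_vecs" "w - k \<in> unit_cube"
      and uniq: "\<forall>m. m \<in> int_vecs \<and> w - m \<in> unit_cube \<longrightarrow> m = k"
      using unit_cube_tiles[of w] unfolding Ex1_def by (elim exE conjE)
    have "(\<integral>\<^sup>+m. G w * indicator unit_cube (w - m) \<partial>count_space int_vecs) =
          (\<integral>\<^sup>+m. G w * indicator {k} m \<partial>count_space int_vecs)"
    proof (rule nn_integral_cong)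
      fix m :: "real ^ 'n" assume "m \<in> space (count_space int_vecs)"
      then have "w - m \<in> unit_cube \<longleftrightarrow> m = k" using k uniq by (metis space_count_space)
      then show "G w * indicator unit_cube (w - m) = G w * indicator {k} m"
        by (simp add: indicator_def)
    qed
    also have "\<dots> = G w"
      using k(1) by (simp add: nn_integral_cmult_indicator)
    finally show ?thesis by simp
  qed
  then have "(\<integral>\<^sup>+w. G w \<partial>lborel) = (\<integral>\<^sup>+w. \<integral>\<^sup>+k. G w * indicator unit_cube (w - k) \<partial>count_space int_vecs \<partial>lborel)"
    by (rule nn_integral_cong)
  also have "\<dots> = (\<integral>\<^sup>+k. \<integral>\<^sup>+w. G w * indicator unit_cube (w - k) \<partial>lborel \<partial>count_space int_vecs)"
    by (intro nn_integral_count_space_nn_integral) auto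
  also have "\<dots> = (\<integral>\<^sup>+k. \<integral>\<^sup>+w. G (w + k) * indicator unit_cube w \<partial>lborel \<partial>count_space int_vecs)"
  proof (rule nn_integral_cong)
    fix k :: "real ^ 'n"
    show "(\<integral>\<^sup>+w. G w * indicator unit_cube (w - k) \<partial>lborel) = (\<integral>\<^sup>+w. G (w + k) * indicator unit_cube w \<partial>lborel)"
      using nn_integral_lborel_translate[of "\<lambda>w. G w * indicator unit_cube (w - k)" k] by simp
  qed
  also have "\<dots> = (\<integral>\<^sup>+w. \<integral>\<^sup>+k. G (w + k) * indicator unit_cube w \<partial>count_space int_vecs \<partial>lborel)"
    by (intro nn_integral_count_space_nn_integral[symmetric]) auto
  also have "\<dots> = (\<integral>\<^sup>+w. (\<integral>\<^sup>+k. G (w + k) \<partial>count_space int_vecs) * indicator unit_cube w \<partial>lborel)"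
    by (simp add: nn_integral_multc)
  finally show ?thesis .
qed

section \<open>Square-integrable functions\<close>

text \<open>
  Borel representatives are used: compositions with affine maps and joint functions of several
  variables then remain measurable, which is what Fubini needs.
\<close>

definition sq_integrable :: "('a::euclidean_space \<Rightarrow> complex) \<Rightarrow> bool" where
  "sq_integrable f \<longleftrightarrow> f \<in> borel_measurable borel \<and> integrable lborel (\<lambda>x. (cmod (f x))\<^sup>2)"

definition energy :: "('a::euclidean_space \<Rightarrow> complex) \<Rightarrow> real" where
  "energy f = (LINT x|lborel. (cmod (f x))\<^sup>2)"

abbreviation sq_mod :: "complex \<Rightarrow> ennreal" where
  "sq_mod z \<equiv> ennreal ((cmod z)\<^sup>2)"

lemma sq_integrable_measurable: "sq_integrable f \<Longrightarrow> f \<in> borel_measurable borel"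
  by (simp add: sq_integrable_def)

lemma energy_nonneg: "0 \<le> energy f"
  by (simp add: energy_def)

lemma nn_integral_energy:
  "sq_integrable f \<Longrightarrow> (\<integral>\<^sup>+x. sq_mod (f x) \<partial>lborel) = ennreal (energy f)"
  unfolding sq_integrable_def energy_def by (intro nn_integral_eq_integral) auto

lemma sq_integrableI:
  assumes [measurable]: "f \<in> borel_measurable borel"
    and fin: "(\<integral>\<^sup>+x. sq_mod (f x) \<partial>lborel) < \<infinity>"
  shows "sq_integrable f"
  unfolding sq_integrable_def using fin by (auto simp: integrable_iff_bounded)

lemma nn_integral_energyD:
  assumes "f \<in> borel_measurable borel"
    and "(\<integral>\<^sup>+x. sq_mod (f x) \<partial>lborel) = ennreal r" "r \<ge> 0"
  shows "sq_integrable f" "energy f = r"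
proof -
  show *: "sq_integrable f" using assms by (intro sq_integrableI) auto
  show "energy f = r" using nn_integral_energy[OF *] assms energy_nonneg[of f] by simp
qed

lemma sq_integrable_cmod_cong:
  assumes "sq_integrable f" "h \<in> borel_measurable borel" "\<And>x. cmod (h x) = cmod (f x)"
  shows "sq_integrable h" "energy h = energy f"
  using assms by (auto simp: sq_integrable_def energy_def)

lemma sq_integrable_translate:
  assumes f: "sq_integrable f"
  shows "sq_integrable (\<lambda>x. f (x + c))" "energy (\<lambda>x. f (x + c)) = energy f"
proof -
  note [measurable] = sq_integrable_measurable[OF f]
  have "(\<integral>\<^sup>+x. sq_mod (f (x + c)) \<partial>lborel) = ennreal (energy f)"
    using nn_integral_lborel_translate[of "\<lambda>x. sq_mod (f x)" c] nn_integral_energy[OF f] by simp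
  then show "sq_integrable (\<lambda>x. f (x + c))" "energy (\<lambda>x. f (x + c)) = energy f"
    by (auto intro!: nn_integral_energyD energy_nonneg)
qed

lemma sq_integrable_mult_integrable:
  assumes f: "sq_integrable f" and g: "sq_integrable g"
  shows "integrable lborel (\<lambda>x. f x * g x)"
proof (rule Bochner_Integration.integrable_bound)
  show "integrable lborel (\<lambda>x. (cmod (f x))\<^sup>2 + (cmod (g x))\<^sup>2)"
    using f g by (auto simp: sq_integrable_def)
  show "(\<lambda>x. f x * g x) \<in> borel_measurable lborel"
    using f g by (auto simp: sq_integrable_def)
  have "a * b \<le> a\<^sup>2 + b\<^sup>2" if "a \<ge> 0" "b \<ge> 0" for a b :: real
    using sum_squares_bound[of a b] mult_nonneg_nonneg[OF that] by linarith
  then show "AE x in lborel. norm (f x * g x) \<le> norm ((cmod (f x))\<^sup>2 + (cmod (g x))\<^sup>2)"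
    by (simp add: norm_mult)
qed

lemma sq_integrable_cnj: "sq_integrable f \<Longrightarrow> sq_integrable (\<lambda>x. cnj (f x))"
  using measurable_compose[of f borel borel cnj borel] borel_measurable_continuous_onI[of cnj]
  by (auto simp: sq_integrable_def intro: continuous_intros)

lemma nn_Cauchy_Schwarz:
  assumes f: "sq_integrable f" and g: "sq_integrable g"
  shows "(\<integral>\<^sup>+x. ennreal (cmod (f x) * cmod (g x)) \<partial>lborel)\<^sup>2 \<le> ennreal (energy f * energy g)"
proof -
  note [measurable] = sq_integrable_measurable[OF f] sq_integrable_measurable[OF g]
  have "(\<integral>\<^sup>+x. ennreal (cmod (f x)) * ennreal (cmod (g x)) \<partial>lborel)\<^sup>2 \<le>
    (\<integral>\<^sup>+x. (ennreal (cmod (f x)))\<^sup>2 \<partial>lborel) * (\<integral>\<^sup>+x. (ennreal (cmod (g x)))\<^sup>2 \<partial>lborel)"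
    by (rule Cauchy_Schwarz_nn_integral) auto
  then show ?thesis
    using nn_integral_energy[OF f] nn_integral_energy[OF g]
    by (simp add: ennreal_mult[symmetric] ennreal_power energy_nonneg)
qed

lemma Cauchy_Schwarz_integral:
  assumes f: "sq_integrable f" and g: "sq_integrable g"
  shows "(cmod (LINT x|lborel. f x * cnj (g x)))\<^sup>2 \<le> energy f * energy g"
proof -
  have i: "integrable lborel (\<lambda>x. f x * cnj (g x))"
    by (intro sq_integrable_mult_integrable sq_integrable_cnj f g)
  have "ennreal (cmod (LINT x|lborel. f x * cnj (g x))) \<le> (\<integral>\<^sup>+x. ennreal (cmod (f x * cnj (g x))) \<partial>lborel)"
    using i by (rule integral_norm_bound_ennreal)
  then have "(ennreal (cmod (LINT x|lborel. f x * cnj (g x))))\<^sup>2 \<le> (\<integral>\<^sup>+x. ennreal (cmod (f x) * cmod (g x)) \<partial>lborel)\<^sup>2"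
    by (intro power_mono) (simp_all add: norm_mult)
  also have "\<dots> \<le> ennreal (energy f * energy g)"
    by (rule nn_Cauchy_Schwarz[OF f g])
  finally show ?thesis
    by (simp add: ennreal_power energy_nonneg)
qed

lemma norm_add_sq_le: "(norm (a + b :: 'a::real_normed_vector))\<^sup>2 \<le> 2 * (norm a)\<^sup>2 + 2 * (norm b)\<^sup>2"
proof -
  have "(norm (a + b))\<^sup>2 \<le> (norm a + norm b)\<^sup>2"
    by (intro power_mono norm_triangle_ineq) auto
  also have "\<dots> \<le> 2 * (norm a)\<^sup>2 + 2 * (norm b)\<^sup>2"
    using sum_squares_bound[of "norm a" "norm b"] by (simp add: power2_sum)
  finally show ?thesis .
qed

lemma sq_integrable_cmult: "sq_integrable f \<Longrightarrow> sq_integrable (\<lambda>x. c * f x)"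
  by (auto simp: sq_integrable_def norm_mult power_mult_distrib)

lemma sq_integrable_add:
  assumes f: "sq_integrable f" and g: "sq_integrable g"
  shows "sq_integrable (\<lambda>x. f x + g x)" "energy (\<lambda>x. f x + g x) \<le> 2 * energy f + 2 * energy g"
proof -
  note [measurable] = sq_integrable_measurable[OF f] sq_integrable_measurable[OF g]
  have i: "integrable lborel (\<lambda>x. 2 * (cmod (f x))\<^sup>2 + 2 * (cmod (g x))\<^sup>2)"
    using f g by (auto simp: sq_integrable_def)
  then have j: "integrable lborel (\<lambda>x. (cmod (f x + g x))\<^sup>2)"
    by (rule Bochner_Integration.integrable_bound) (auto simp: norm_add_sq_le)
  then show "sq_integrable (\<lambda>x. f x + g x)" by (simp add: sq_integrable_def)
  have "energy (\<lambda>x. f x + g x) \<le> (LINT x|lborel. 2 * (cmod (f x))\<^sup>2 + 2 * (cmod (g x))\<^sup>2)"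
    unfolding energy_def by (intro integral_mono i j norm_add_sq_le)
  also have "\<dots> = 2 * energy f + 2 * energy g"
    unfolding energy_def using f g by (simp add: sq_integrable_def)
  finally show "energy (\<lambda>x. f x + g x) \<le> 2 * energy f + 2 * energy g" .
qed

lemma sq_integrable_diff:
  assumes f: "sq_integrable f" and g: "sq_integrable g"
  shows "sq_integrable (\<lambda>x. f x - g x)" "energy (\<lambda>x. f x - g x) \<le> 2 * energy f + 2 * energy g"
  using sq_integrable_add[OF f sq_integrable_cmult[OF g, of "-1"]]
  by (auto simp: energy_def)

lemma sq_integrable_sum:
  "(\<And>k. k \<in> S \<Longrightarrow> sq_integrable (f k)) \<Longrightarrow> sq_integrable (\<lambda>x. \<Sum>k\<in>S. f k x)"
proof (induction S rule: infinite_finite_induct)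
  case (insert k S) then show ?case by (simp add: sq_integrable_add)
qed (auto simp: sq_integrable_def)

lemma energy_sum:
  assumes f: "\<And>k. k \<in> S \<Longrightarrow> sq_integrable (f k)" and S: "finite S"
  shows "complex_of_real (energy (\<lambda>x. \<Sum>k\<in>S. c k * f k x)) =
    (\<Sum>k\<in>S. \<Sum>l\<in>S. c k * cnj (c l) * (LINT x|lborel. f k x * cnj (f l x)))"
proof -
  have i: "integrable lborel (\<lambda>x. f k x * cnj (f l x))" if "k \<in> S" "l \<in> S" for k l
    by (intro sq_integrable_mult_integrable sq_integrable_cnj f that)
  have "complex_of_real (energy (\<lambda>x. \<Sum>k\<in>S. c k * f k x)) =
     (LINT x|lborel. complex_of_real ((cmod (\<Sum>k\<in>S. c k * f k x))\<^sup>2))"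
    by (simp add: energy_def flip: of_real_power)
  also have "\<dots> = (LINT x|lborel. (\<Sum>k\<in>S. \<Sum>l\<in>S. c k * cnj (c l) * (f k x * cnj (f l x))))"
    by (intro Bochner_Integration.integral_cong refl)
       (simp only: complex_norm_square cnj_sum complex_cnj_mult sum_product mult_ac)
  also have "\<dots> = (\<Sum>k\<in>S. \<Sum>l\<in>S. c k * cnj (c l) * (LINT x|lborel. f k x * cnj (f l x)))"
    using i by simp
  finally show ?thesis .
qed

section \<open>Characters and time-frequency shifts\<close>

lemma cnj_measurable [measurable]: "cnj \<in> borel_measurable borel"
  by (intro borel_measurable_continuous_onI continuous_intros)

definition wave :: "real \<Rightarrow> complex" where
  "wave s = exp (2 * of_real pi * \<i> * of_real s)"

lemma wave_0 [simp]: "wave 0 = 1"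
  and norm_wave [simp]: "cmod (wave s) = 1"
  and wave_add: "wave (s + t) = wave s * wave t"
  and cnj_wave [simp]: "cnj (wave s) = wave (- s)"
  by (simp_all add: wave_def norm_exp_eq_Re exp_add[symmetric] algebra_simps exp_cnj)

lemma wave_minus_cancel: "wave s * wave (- s) = 1"
  by (simp flip: wave_add)

lemma continuous_on_wave [continuous_intros]:
  "continuous_on A f \<Longrightarrow> continuous_on A (\<lambda>x. wave (f x))"
  unfolding wave_def by (intro continuous_intros)

lemma wave_measurable [measurable]: "wave \<in> borel_measurable borel"
  by (intro borel_measurable_continuous_onI continuous_intros)

lemma tf_shift_wave: "tf_shift z g t = wave (freq z \<bullet> t) * g (t - pos z)"
  by (simp add: tf_shift_def wave_def)

section \<open>Strong continuity of time-frequency shifts\<close>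

text \<open>
  Up to small measure, \<open>A\<close> lies between a compact \<open>K\<close> and an open \<open>U\<close>.  A small translate of \<open>K\<close>
  remains in \<open>U\<close>, so \<open>x\<close> and \<open>x + u\<close> can disagree about \<open>A\<close> only if one of them lies in \<open>A - K\<close> or
  in \<open>U - A\<close>.
\<close>

lemma translation_L1_indicator:
  fixes A :: "'a::euclidean_space set"
  assumes A: "A \<in> sets borel" and fin: "emeasure lborel A < \<infinity>" and e: "e > 0"
  shows "\<exists>d>0. \<forall>u. norm u < d \<longrightarrow>
    (\<integral>\<^sup>+x. ennreal \<bar>indicator A (x + u) - indicator A x\<bar> \<partial>lborel) \<le> ennreal e"
proof -
  have e8: "0 < e / 8" and e16: "0 < e / 16" using e by simp_all
  obtain U where U: "open U" "A \<subseteq> U" "emeasure lborel (U - A) < ennreal (e / 8)"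
    by (rule outer_regular_lborel[OF A e8])
  have Al: "A \<in> sets lebesgue" using A by simp
  obtain T where T: "closed T" "T \<subseteq> A" "emeasure lebesgue (A - T) < ennreal (e/16)"
    by (rule sets_lebesgue_inner_closed[OF Al e16])
  have T': "emeasure lborel (A - T) < ennreal (e/16)" using T A by simp
  let ?K = "\<lambda>n::nat. T \<inter> cball 0 (real n)"
  have lim: "(\<lambda>n. emeasure lborel (T - ?K n)) \<longlonglongrightarrow> emeasure lborel (\<Inter>n. T - ?K n)"
  proof (rule Lim_emeasure_decseq)
    show "range (\<lambda>n. T - ?K n) \<subseteq> sets lborel" using T by auto
    show "decseq (\<lambda>n. T - ?K n)" by (auto simp: decseq_def)
    show "emeasure lborel (T - ?K i) \<noteq> \<infinity>" for i
    proof -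
      have "emeasure lborel (T - ?K i) \<le> emeasure lborel A"
        using T A by (intro emeasure_mono) auto
      then show ?thesis using fin by auto
    qed
  qed
  have empty: "(\<Inter>n. T - ?K n) = {}"
    by (auto, meson real_arch_simple)
  have "(\<lambda>n. emeasure lborel (T - ?K n)) \<longlonglongrightarrow> 0"
    using lim unfolding empty by (simp only: emeasure_empty)
  then have "eventually (\<lambda>n. emeasure lborel (T - ?K n) < ennreal (e/16)) sequentially"
    using e by (intro order_tendstoD) auto
  then obtain n where n: "emeasure lborel (T - ?K n) < ennreal (e/16)"
    by (auto simp: eventually_sequentially)
  define K where "K = ?K n"
  have K: "compact K" "K \<subseteq> A" using T by (auto simp: K_def closed_Int_compact)
  have Km[measurable]: "K \<in> sets borel" using K by (simp add: borel_compact)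
  have Um[measurable]: "U \<in> sets borel" using U by simp
  note [measurable] = A
  have "emeasure lborel (A - K) \<le> emeasure lborel ((A - T) \<union> (T - K))"
    using T A by (intro emeasure_mono) auto
  also have "\<dots> \<le> emeasure lborel (A - T) + emeasure lborel (T - K)"
    using T A by (intro emeasure_subadditive) auto
  also have "\<dots> \<le> ennreal (e/16) + ennreal (e/16)"
    using T' n unfolding K_def by (intro add_mono) auto
  also have "\<dots> = ennreal (e/8)" using e by (simp flip: ennreal_plus)
  finally have AK: "emeasure lborel (A - K) \<le> ennreal (e/8)" .
  obtain d where d: "d > 0" "(\<Union>x\<in>K. ball x d) \<subseteq> U"
    using compact_subset_open_imp_ball_epsilon_subset[OF K(1) U(1)] K U by blast
  show ?thesis
  proof (intro exI conjI allI impI)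
    fix u :: 'a assume u: "norm u < d"
    have near: "x + u \<in> U" "x - u \<in> U" if "x \<in> K" for x
      using d u that by (auto simp: dist_norm subset_eq)
    have pt: "ennreal \<bar>indicator A (x + u) - indicator A x\<bar> \<le>
       indicator (A - K) (x + u) + indicator (U - A) x + indicator (A - K) x + indicator (U - A) (x + u)" for x
    proof (cases "x + u \<in> A \<longleftrightarrow> x \<in> A")
      case True then show ?thesis by (auto simp: indicator_def)
    next
      case False
      then consider "x + u \<in> A" "x \<notin> A" | "x + u \<notin> A" "x \<in> A" by blast
      then show ?thesis
      proof cases
        case 1
        then have "x + u \<in> A - K \<or> x \<in> U - A" using near(2)[of "x + u"] by auto
        with 1 show ?thesis by (auto simp: indicator_def)
      next
        case 2
        then have "x \<in> A - K \<or> x + u \<in> U - A" using near(1)[of x] by auto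
        with 2 show ?thesis by (auto simp: indicator_def)
      qed
    qed
    have t: "(\<integral>\<^sup>+x. indicator B (x + u) \<partial>lborel) = emeasure lborel B" if [measurable]: "B \<in> sets borel" for B :: "'a set"
      by (subst nn_integral_lborel_translate) auto
    have "(\<integral>\<^sup>+x. ennreal \<bar>indicator A (x + u) - indicator A x\<bar> \<partial>lborel) \<le>
      (\<integral>\<^sup>+x. indicator (A - K) (x + u) + indicator (U - A) x + indicator (A - K) x + indicator (U - A) (x + u) \<partial>lborel)"
      by (intro nn_integral_mono pt)
    also have "\<dots> = emeasure lborel (A - K) + emeasure lborel (U - A) + emeasure lborel (A - K) + emeasure lborel (U - A)"
      by (simp add: nn_integral_add t)
    also have "\<dots> \<le> ennreal (e/8) + ennreal (e/8) + ennreal (e/8) + ennreal (e/8)"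
      using AK U by (intro add_mono) auto
    also have "\<dots> \<le> ennreal e" using e by (simp flip: ennreal_plus)
    finally show "(\<integral>\<^sup>+x. ennreal \<bar>indicator A (x + u) - indicator A x\<bar> \<partial>lborel) \<le> ennreal e" .
  qed (use d in auto)
qed

text \<open>
  Indicator functions span a dense subspace, and translations are isometries, so the property passes
  to limits.
\<close>

lemma translation_L1:
  fixes f :: "'a::euclidean_space \<Rightarrow> real"
  assumes "integrable lborel f"
  shows "\<forall>e>0. \<exists>d>0. \<forall>u. norm u < d \<longrightarrow> (\<integral>\<^sup>+x. ennreal \<bar>f (x + u) - f x\<bar> \<partial>lborel) \<le> ennreal e"
  using assms
proof (induction f rule: integrable_induct)
  case (base A c)
  have A[measurable]: "A \<in> sets borel" using base by simp
  show ?case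
  proof (intro allI impI)
    fix e :: real assume e: "e > 0"
    obtain d where d: "d > 0" "\<And>u. norm u < d \<Longrightarrow>
      (\<integral>\<^sup>+x. ennreal \<bar>indicator A (x + u) - indicator A x\<bar> \<partial>lborel) \<le> ennreal (e / (\<bar>c\<bar> + 1))"
      using translation_L1_indicator[of A "e / (\<bar>c\<bar> + 1)"] base e by (auto simp: divide_pos_pos add_nonneg_pos)
    show "\<exists>d>0. \<forall>u. norm u < d \<longrightarrow>
      (\<integral>\<^sup>+x. ennreal \<bar>indicator A (x + u) *\<^sub>R c - indicator A x *\<^sub>R c\<bar> \<partial>lborel) \<le> ennreal e"
    proof (intro exI[of _ d] conjI allI impI d(1))
      fix u :: 'a assume u: "norm u < d"
      have "(\<integral>\<^sup>+x. ennreal \<bar>indicator A (x + u) *\<^sub>R c - indicator A x *\<^sub>R c\<bar> \<partial>lborel) =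
        (\<integral>\<^sup>+x. ennreal \<bar>c\<bar> * ennreal \<bar>indicator A (x + u) - indicator A x\<bar> \<partial>lborel)"
        by (intro nn_integral_cong) (simp add: ennreal_mult[symmetric] abs_mult[symmetric] algebra_simps)
      also have "\<dots> = ennreal \<bar>c\<bar> * (\<integral>\<^sup>+x. ennreal \<bar>indicator A (x + u) - indicator A x\<bar> \<partial>lborel)"
        by (intro nn_integral_cmult) auto
      also have "\<dots> \<le> ennreal \<bar>c\<bar> * ennreal (e / (\<bar>c\<bar> + 1))"
        by (intro mult_left_mono d u) auto
      also have "\<dots> = ennreal (\<bar>c\<bar> * (e / (\<bar>c\<bar> + 1)))"
        using e by (simp only: ennreal_mult[symmetric] abs_ge_zero divide_nonneg_pos less_imp_le add_nonneg_pos zero_less_one)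
      also have "\<dots> \<le> ennreal e"
        using e by (intro ennreal_leI) (simp add: field_simps)
      finally show "(\<integral>\<^sup>+x. ennreal \<bar>indicator A (x + u) *\<^sub>R c - indicator A x *\<^sub>R c\<bar> \<partial>lborel) \<le> ennreal e" .
    qed
  qed
next
  case (add f g)
  have [measurable]: "f \<in> borel_measurable borel" "g \<in> borel_measurable borel"
    using add.hyps by auto
  show ?case
  proof (intro allI impI)
    fix e :: real assume e: "e > 0"
    then have e2: "e / 2 > 0" by simp
    obtain d1 where d1: "d1 > 0" "\<And>u. norm u < d1 \<Longrightarrow> (\<integral>\<^sup>+x. ennreal \<bar>f (x + u) - f x\<bar> \<partial>lborel) \<le> ennreal (e/2)"
      using add.IH(1) e2 by blast
    obtain d2 where d2: "d2 > 0" "\<And>u. norm u < d2 \<Longrightarrow> (\<integral>\<^sup>+x. ennreal \<bar>g (x + u) - g x\<bar> \<partial>lborel) \<le> ennreal (e/2)"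
      using add.IH(2) e2 by blast
    show "\<exists>d>0. \<forall>u. norm u < d \<longrightarrow> (\<integral>\<^sup>+x. ennreal \<bar>f (x + u) + g (x + u) - (f x + g x)\<bar> \<partial>lborel) \<le> ennreal e"
    proof (intro exI[of _ "min d1 d2"] conjI allI impI)
      fix u :: 'a assume u: "norm u < min d1 d2"
      have "(\<integral>\<^sup>+x. ennreal \<bar>f (x + u) + g (x + u) - (f x + g x)\<bar> \<partial>lborel) \<le>
        (\<integral>\<^sup>+x. ennreal \<bar>f (x + u) - f x\<bar> + ennreal \<bar>g (x + u) - g x\<bar> \<partial>lborel)"
        by (intro nn_integral_mono) (simp flip: ennreal_plus)
      also have "\<dots> = (\<integral>\<^sup>+x. ennreal \<bar>f (x + u) - f x\<bar> \<partial>lborel) + (\<integral>\<^sup>+x. ennreal \<bar>g (x + u) - g x\<bar> \<partial>lborel)"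
        by (intro nn_integral_add) auto
      also have "\<dots> \<le> ennreal (e/2) + ennreal (e/2)"
        using u by (intro add_mono d1 d2) auto
      also have "\<dots> = ennreal e" using e by (simp flip: ennreal_plus)
      finally show "(\<integral>\<^sup>+x. ennreal \<bar>f (x + u) + g (x + u) - (f x + g x)\<bar> \<partial>lborel) \<le> ennreal e" .
    qed (use d1 d2 in auto)
  qed
next
  case (lim f s)
  have [measurable]: "f \<in> borel_measurable borel" "\<And>i. s i \<in> borel_measurable borel"
    using lim.hyps borel_measurable_integrable by (auto simp: measurable_lborel1[symmetric] simp del: measurable_lborel1)
  have "(\<lambda>i. \<integral>\<^sup>+x. ennreal (norm (s i x - f x)) \<partial>lborel) \<longlonglongrightarrow> 0"
  proof -
    have "(\<lambda>i. \<integral>\<^sup>+x. ennreal (norm (f x - s i x)) \<partial>lborel) \<longlonglongrightarrow> 0"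
    proof (rule nn_integral_dominated_convergence_norm[where w = "\<lambda>x. 2 * norm (f x)"])
      have "integrable lborel (\<lambda>x. 2 * norm (f x))" using lim.hyps by auto
      then have "(\<integral>\<^sup>+x. ennreal (norm (2 * norm (f x))) \<partial>lborel) < \<infinity>"
        unfolding integrable_iff_bounded by (rule conjunct2)
      then show "(\<integral>\<^sup>+x. ennreal (2 * norm (f x)) \<partial>lborel) < \<infinity>"
        by simp
    qed (use lim.hyps in auto)
    then show ?thesis by (simp add: abs_minus_commute)
  qed
  show ?case
  proof (intro allI impI)
    fix e :: real assume e: "e > 0"
    then have e4: "e / 3 > 0" by simp
    obtain i where i: "(\<integral>\<^sup>+x. ennreal \<bar>s i x - f x\<bar> \<partial>lborel) \<le> ennreal (e/3)"
    proof -
      have "eventually (\<lambda>i. (\<integral>\<^sup>+x. ennreal (norm (s i x - f x)) \<partial>lborel) < ennreal (e/3)) sequentially"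
        using \<open>(\<lambda>i. \<integral>\<^sup>+x. ennreal (norm (s i x - f x)) \<partial>lborel) \<longlonglongrightarrow> 0\<close> e4
        by (intro order_tendstoD) auto
      then show ?thesis
        using that by (auto simp: eventually_sequentially intro: less_imp_le)
    qed
    obtain d where d: "d > 0" "\<And>u. norm u < d \<Longrightarrow> (\<integral>\<^sup>+x. ennreal \<bar>s i (x + u) - s i x\<bar> \<partial>lborel) \<le> ennreal (e/3)"
      using lim.IH[of i] e4 by blast
    show "\<exists>d>0. \<forall>u. norm u < d \<longrightarrow> (\<integral>\<^sup>+x. ennreal \<bar>f (x + u) - f x\<bar> \<partial>lborel) \<le> ennreal e"
    proof (intro exI[of _ d] conjI allI impI)
      fix u :: 'a assume u: "norm u < d"
      have "(\<integral>\<^sup>+x. ennreal \<bar>f (x + u) - f x\<bar> \<partial>lborel) \<le>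
        (\<integral>\<^sup>+x. ennreal \<bar>s i (x + u) - f (x + u)\<bar> + ennreal \<bar>s i (x + u) - s i x\<bar> + ennreal \<bar>s i x - f x\<bar> \<partial>lborel)"
        by (intro nn_integral_mono) (simp flip: ennreal_plus)
      also have "\<dots> = (\<integral>\<^sup>+x. ennreal \<bar>s i (x + u) - f (x + u)\<bar> \<partial>lborel)
          + (\<integral>\<^sup>+x. ennreal \<bar>s i (x + u) - s i x\<bar> \<partial>lborel) + (\<integral>\<^sup>+x. ennreal \<bar>s i x - f x\<bar> \<partial>lborel)"
        by (simp add: nn_integral_add)
      also have "(\<integral>\<^sup>+x. ennreal \<bar>s i (x + u) - f (x + u)\<bar> \<partial>lborel) = (\<integral>\<^sup>+x. ennreal \<bar>s i x - f x\<bar> \<partial>lborel)"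
        by (subst nn_integral_lborel_translate[of "\<lambda>x. ennreal \<bar>s i x - f x\<bar>"]) auto
      also have "(\<integral>\<^sup>+x. ennreal \<bar>s i x - f x\<bar> \<partial>lborel) + (\<integral>\<^sup>+x. ennreal \<bar>s i (x + u) - s i x\<bar> \<partial>lborel) + (\<integral>\<^sup>+x. ennreal \<bar>s i x - f x\<bar> \<partial>lborel)
         \<le> ennreal (e/3) + ennreal (e/3) + ennreal (e/3)"
        using u by (intro add_mono d i) auto
      also have "\<dots> = ennreal e" using e by (simp flip: ennreal_plus)
      finally show "(\<integral>\<^sup>+x. ennreal \<bar>f (x + u) - f x\<bar> \<partial>lborel) \<le> ennreal e" .
    qed (use d in auto)
  qed
qed

lemma energy_0 [simp]: "energy (\<lambda>x. 0) = 0"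
  by (simp add: energy_def)

lemma energy_cmult: "energy (\<lambda>x. c * f x) = (cmod c)\<^sup>2 * energy f"
  by (simp add: energy_def norm_mult power_mult_distrib)

definition L2_continuous_translation :: "('a::euclidean_space \<Rightarrow> complex) \<Rightarrow> bool" where
  "L2_continuous_translation f \<longleftrightarrow> ((\<lambda>u. energy (\<lambda>x. f (x + u) - f x)) \<longlongrightarrow> 0) (at 0)"

text \<open>
  The inequality \<open>(a - b)\<^sup>2 \<le> |a\<^sup>2 - b\<^sup>2|\<close> for \<open>a, b \<ge> 0\<close> bounds the \<open>L\<^sup>2\<close> modulus of continuity of
  \<open>r\<close> by the \<open>L\<^sup>1\<close> modulus of continuity of \<open>r\<^sup>2\<close>.
\<close>

lemma L2_continuous_translation_of_nonneg:
  fixes r :: "'a::euclidean_space \<Rightarrow> real"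
  assumes r: "sq_integrable (\<lambda>x. complex_of_real (r x))" and nn: "\<And>x. r x \<ge> 0"
  shows "L2_continuous_translation (\<lambda>x. complex_of_real (r x))"
  unfolding L2_continuous_translation_def
proof (rule tendstoI)
  fix e :: real assume e: "e > 0"
  have i: "integrable lborel (\<lambda>x. (r x)\<^sup>2)"
    using r by (simp add: sq_integrable_def)
  then have [measurable]: "(\<lambda>x. (r x)\<^sup>2) \<in> borel_measurable borel" by auto
  obtain d where d: "d > 0"
    "\<And>u. norm u < d \<Longrightarrow> (\<integral>\<^sup>+x. ennreal \<bar>(r (x + u))\<^sup>2 - (r x)\<^sup>2\<bar> \<partial>lborel) \<le> ennreal (e/2)"
    using translation_L1[OF i] e by (metis half_gt_zero)
  have "energy (\<lambda>x. complex_of_real (r (x + u)) - complex_of_real (r x)) \<le> e / 2" if u: "norm u < d" for u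
  proof -
    have "sq_integrable (\<lambda>x. complex_of_real (r (x + u)) - complex_of_real (r x))"
      using sq_integrable_translate(1)[OF r] r by (rule sq_integrable_diff)
    then have "ennreal (energy (\<lambda>x. complex_of_real (r (x + u)) - complex_of_real (r x))) =
      (\<integral>\<^sup>+x. sq_mod (complex_of_real (r (x + u)) - complex_of_real (r x)) \<partial>lborel)"
      by (rule nn_integral_energy[symmetric])
    also have "\<dots> \<le> (\<integral>\<^sup>+x. ennreal \<bar>(r (x + u))\<^sup>2 - (r x)\<^sup>2\<bar> \<partial>lborel)"
    proof (intro nn_integral_mono ennreal_leI)
      fix x
      have "(a - b)\<^sup>2 \<le> \<bar>a\<^sup>2 - b\<^sup>2\<bar>" if "a \<ge> 0" "b \<ge> 0" for a b :: real
      proof -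
        have "(a - b)\<^sup>2 = \<bar>a - b\<bar> * \<bar>a - b\<bar>" by (simp add: power2_eq_square)
        also have "\<dots> \<le> \<bar>a - b\<bar> * (a + b)" using that by (intro mult_left_mono) auto
        also have "\<dots> = \<bar>a\<^sup>2 - b\<^sup>2\<bar>"
          using that by (simp add: power2_eq_square square_diff_square_factored abs_mult mult.commute)
        finally show ?thesis .
      qed
      then show "(cmod (complex_of_real (r (x + u)) - complex_of_real (r x)))\<^sup>2 \<le> \<bar>(r (x + u))\<^sup>2 - (r x)\<^sup>2\<bar>"
        using nn by (simp flip: of_real_diff)
    qed
    also have "\<dots> \<le> ennreal (e/2)" by (rule d(2)[OF u])
    finally show ?thesis using e by simp
  qed
  then have "dist (energy (\<lambda>x. complex_of_real (r (x + u)) - complex_of_real (r x))) 0 < e" if "norm u < d" for u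
    using that e by (fastforce simp: energy_nonneg)
  then show "\<forall>\<^sub>F u in at 0. dist (energy (\<lambda>x. complex_of_real (r (x + u)) - complex_of_real (r x))) 0 < e"
    unfolding eventually_at using d(1) by (intro exI[of _ d]) simp
qed

lemma L2_continuous_translation_add:
  assumes "sq_integrable f" "L2_continuous_translation f" "sq_integrable g" "L2_continuous_translation g"
  shows "L2_continuous_translation (\<lambda>x. f x + g x)"
  unfolding L2_continuous_translation_def
proof (rule tendsto_sandwich[where f = "\<lambda>_. 0"])
  show "((\<lambda>u. 2 * energy (\<lambda>x. f (x + u) - f x) + 2 * energy (\<lambda>x. g (x + u) - g x)) \<longlongrightarrow> 0) (at 0)"
    using assms unfolding L2_continuous_translation_def by (auto intro!: tendsto_eq_intros)
  have "energy (\<lambda>x. f (x + u) + g (x + u) - (f x + g x)) \<le>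
      2 * energy (\<lambda>x. f (x + u) - f x) + 2 * energy (\<lambda>x. g (x + u) - g x)" for u
    using sq_integrable_add(2)[OF sq_integrable_diff(1)[OF sq_integrable_translate(1)[OF assms(1), of u] assms(1)]
         sq_integrable_diff(1)[OF sq_integrable_translate(1)[OF assms(3), of u] assms(3)]]
    by (simp add: algebra_simps)
  then show "\<forall>\<^sub>F u in at 0. energy (\<lambda>x. f (x + u) + g (x + u) - (f x + g x)) \<le>
      2 * energy (\<lambda>x. f (x + u) - f x) + 2 * energy (\<lambda>x. g (x + u) - g x)" by simp
qed (auto simp: energy_nonneg)

lemma L2_continuous_translation_cmult:
  assumes "L2_continuous_translation f"
  shows "L2_continuous_translation (\<lambda>x. c * f x)"
proof -
  have "energy (\<lambda>x. c * f (x + u) - c * f x) = (cmod c)\<^sup>2 * energy (\<lambda>x. f (x + u) - f x)" for u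
    using energy_cmult[of c "\<lambda>x. f (x + u) - f x"] by (simp add: algebra_simps)
  then show ?thesis
    using assms unfolding L2_continuous_translation_def by (auto intro!: tendsto_eq_intros)
qed

text \<open>
  A complex function is a linear combination of the positive and negative parts of its real and
  imaginary parts.
\<close>

lemma sq_integrable_L2_continuous_translation:
  assumes f: "sq_integrable f"
  shows "L2_continuous_translation f"
proof -
  note [measurable] = sq_integrable_measurable[OF f]
  let ?c = "complex_of_real"
  have part: "sq_integrable (\<lambda>x. ?c (h (f x)))" "L2_continuous_translation (\<lambda>x. ?c (h (f x)))"
    if [measurable]: "h \<in> borel_measurable borel" and h: "\<And>z. 0 \<le> h z" "\<And>z. h z \<le> cmod z" for h :: "complex \<Rightarrow> real"
  proof -
    show s: "sq_integrable (\<lambda>x. ?c (h (f x)))"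
      unfolding sq_integrable_def
    proof
      show "integrable lborel (\<lambda>x. (cmod (?c (h (f x))))\<^sup>2)"
      proof (rule Bochner_Integration.integrable_bound)
        show "integrable lborel (\<lambda>x. (cmod (f x))\<^sup>2)"
          using f by (simp add: sq_integrable_def)
        have "norm ((cmod (?c (h z)))\<^sup>2) \<le> norm ((cmod z)\<^sup>2)" for z
          using power_mono[OF h(2)[of z] h(1)[of z], of 2] by simp
        then show "AE x in lborel. norm ((cmod (?c (h (f x))))\<^sup>2) \<le> norm ((cmod (f x))\<^sup>2)"
          by blast
      qed measurable
    qed measurable
    show "L2_continuous_translation (\<lambda>x. ?c (h (f x)))"
      using s h(1) by (rule L2_continuous_translation_of_nonneg)
  qed
  have h: "(\<lambda>z. max 0 (Re z)) \<in> borel_measurable borel" "(\<lambda>z. max 0 (- Re z)) \<in> borel_measurable borel"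
    "(\<lambda>z. max 0 (Im z)) \<in> borel_measurable borel" "(\<lambda>z. max 0 (- Im z)) \<in> borel_measurable borel"
    by measurable
  have b: "max 0 (Re z) \<le> cmod z" "max 0 (- Re z) \<le> cmod z" "max 0 (Im z) \<le> cmod z" "max 0 (- Im z) \<le> cmod z" for z
    using abs_Re_le_cmod[of z] abs_Im_le_cmod[of z] by auto
  have dec: "f = (\<lambda>x. (?c (max 0 (Re (f x))) + (-1) * ?c (max 0 (- Re (f x)))) +
      \<i> * (?c (max 0 (Im (f x))) + (-1) * ?c (max 0 (- Im (f x)))))"
    by (rule ext) (auto simp: complex_eq_iff)
  have "L2_continuous_translation (\<lambda>x. (?c (max 0 (Re (f x))) + (-1) * ?c (max 0 (- Re (f x)))) +
      \<i> * (?c (max 0 (Im (f x))) + (-1) * ?c (max 0 (- Im (f x)))))"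
    using part[OF h(1)] part[OF h(2)] part[OF h(3)] part[OF h(4)] b
    by (intro L2_continuous_translation_add L2_continuous_translation_cmult sq_integrable_add sq_integrable_cmult) auto
  then show ?thesis by (subst dec)
qed

lemma energy_modulation_tendsto_0:
  fixes f :: "'a::euclidean_space \<Rightarrow> complex"
  assumes f: "sq_integrable f"
  shows "((\<lambda>w. energy (\<lambda>x. (wave (w \<bullet> x) - 1) * f x)) \<longlongrightarrow> 0) (at 0)"
  unfolding tendsto_at_iff_sequentially wave_def
proof (intro allI impI)
  note [measurable] = sq_integrable_measurable[OF f]
  fix X :: "nat \<Rightarrow> 'a" assume X: "X \<longlonglongrightarrow> 0"
  have "(\<lambda>n. LINT x|lborel. (cmod ((exp (2 * of_real pi * \<i> * of_real (X n \<bullet> x)) - 1) * f x))\<^sup>2) \<longlonglongrightarrow> (LINT x|(lborel::'a measure). 0)"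
  proof (rule integral_dominated_convergence[where w = "\<lambda>x. 4 * (cmod (f x))\<^sup>2"])
    show "integrable lborel (\<lambda>x. 4 * (cmod (f x))\<^sup>2)"
      using f by (simp add: sq_integrable_def)
    have "(\<lambda>n. (cmod ((exp (2 * of_real pi * \<i> * of_real (X n \<bullet> x)) - 1) * f x))\<^sup>2) \<longlonglongrightarrow>
        (cmod ((exp (2 * of_real pi * \<i> * of_real (0 \<bullet> x)) - 1) * f x))\<^sup>2" for x
      by (intro tendsto_intros X)
    then show "AE x in lborel. (\<lambda>n. (cmod ((exp (2 * of_real pi * \<i> * of_real (X n \<bullet> x)) - 1) * f x))\<^sup>2) \<longlonglongrightarrow> 0"
      by simp
    have "(cmod ((exp (2 * of_real pi * \<i> * of_real t) - 1) * z))\<^sup>2 \<le> 4 * (cmod z)\<^sup>2" for t z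
    proof -
      have "cmod (exp (2 * of_real pi * \<i> * of_real t) - 1) \<le> cmod (exp (2 * of_real pi * \<i> * of_real t)) + cmod 1"
        by (rule norm_triangle_ineq4)
      also have "cmod (exp (2 * of_real pi * \<i> * of_real t)) = 1"
        by (simp add: norm_exp_eq_Re)
      finally have "(cmod (exp (2 * of_real pi * \<i> * of_real t) - 1))\<^sup>2 \<le> 2\<^sup>2"
        by (intro power_mono) auto
      then show ?thesis
        by (simp add: norm_mult power_mult_distrib mult_right_mono)
    qed
    then show "AE x in lborel. norm ((cmod ((exp (2 * of_real pi * \<i> * of_real (X n \<bullet> x)) - 1) * f x))\<^sup>2) \<le> 4 * (cmod (f x))\<^sup>2" for n
      by simp
  qed measurable
  then show "((\<lambda>w. energy (\<lambda>x. (exp (2 * of_real pi * \<i> * of_real (w \<bullet> x)) - 1) * f x)) \<circ> X) \<longlonglongrightarrow> 0"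
    by (simp add: energy_def o_def)
qed

lemma sq_integrable_tf_shift:
  assumes f: "sq_integrable f"
  shows "sq_integrable (tf_shift z f)" "energy (tf_shift z f) = energy f"
proof -
  note [measurable] = sq_integrable_measurable[OF f]
  have t: "sq_integrable (\<lambda>t. f (t - pos z))" "energy (\<lambda>t. f (t - pos z)) = energy f"
    using sq_integrable_translate[OF f, of "- pos z"] by auto
  have "tf_shift z f \<in> borel_measurable borel"
    unfolding tf_shift_wave[abs_def] by measurable
  moreover have "cmod (tf_shift z f t) = cmod (f (t - pos z))" for t
    by (simp add: tf_shift_wave norm_mult)
  ultimately show "sq_integrable (tf_shift z f)" "energy (tf_shift z f) = energy f"
    using sq_integrable_cmod_cong[OF t(1)] t(2) by auto
qed

lemma pos_0 [simp]: "pos 0 = 0" and freq_0 [simp]: "freq 0 = 0"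
  by (simp_all add: pos_def freq_def vec_eq_iff)

lemma isCont_pos: "isCont pos (z :: real ^ ('d::finite + 'd))"
  unfolding pos_def[abs_def] continuous_at by (intro tendsto_intros)

lemma isCont_freq: "isCont freq (z :: real ^ ('d::finite + 'd))"
  unfolding freq_def[abs_def] continuous_at by (intro tendsto_intros)

lemma pos_freq_measurable [measurable]:
  "pos \<in> borel_measurable (borel :: (real ^ ('d::finite + 'd)) measure)"
  "freq \<in> borel_measurable (borel :: (real ^ ('d::finite + 'd)) measure)"
  using isCont_pos isCont_freq
  by (auto intro!: borel_measurable_continuous_onI continuous_at_imp_continuous_on)

text \<open>
  Write the difference as \<open>M (T f - f) + (M f - f)\<close> with a translation \<open>T\<close> and a modulation \<open>M\<close>, which
  is an isometry.
\<close>

lemma isCont_energy_tf_shift_diff: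
  fixes f :: "real ^ 'd::finite \<Rightarrow> complex"
  assumes f: "sq_integrable f"
  shows "isCont (\<lambda>z. energy (\<lambda>t. tf_shift z f t - f t)) 0"
proof -
  let ?e = "\<lambda>w t. wave (w \<bullet> t)"
  let ?A = "\<lambda>u. energy (\<lambda>x. f (x + u) - f x)"
  let ?B = "\<lambda>w. energy (\<lambda>x. (?e w x - 1) * f x)"
  have A: "isCont ?A 0"
    using sq_integrable_L2_continuous_translation[OF f]
    by (simp add: L2_continuous_translation_def continuous_at)
  have B: "isCont ?B 0"
    using energy_modulation_tendsto_0[OF f] by (simp add: continuous_at)
  note [measurable] = sq_integrable_measurable[OF f]
  have "(\<lambda>z :: real ^ ('d + 'd). - pos z) \<midarrow>0\<rightarrow> 0" "(freq :: real ^ ('d + 'd) \<Rightarrow> _) \<midarrow>0\<rightarrow> 0"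
    using isCont_pos[of "0 :: real ^ ('d + 'd)"] isCont_freq[of "0 :: real ^ ('d + 'd)"]
    by (auto simp: continuous_at intro: tendsto_eq_intros)
  from isCont_tendsto_compose[OF A this(1)] isCont_tendsto_compose[OF B this(2)]
  have lim: "((\<lambda>z :: real ^ ('d + 'd). 2 * ?A (- pos z) + 2 * ?B (freq z)) \<longlongrightarrow> 0) (at 0)"
    by (auto intro!: tendsto_eq_intros)
  have le: "energy (\<lambda>t. tf_shift z f t - f t) \<le> 2 * ?A (- pos z) + 2 * ?B (freq z)" for z :: "real ^ ('d + 'd)"
  proof -
    have t: "sq_integrable (\<lambda>x. f (x + - pos z) - f x)"
      by (intro sq_integrable_diff sq_integrable_translate f)
    have 1: "sq_integrable (\<lambda>x. ?e (freq z) x * (f (x + - pos z) - f x))"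
       "energy (\<lambda>x. ?e (freq z) x * (f (x + - pos z) - f x)) = ?A (- pos z)"
      by (rule sq_integrable_cmod_cong[OF t], measurable, simp add: norm_mult)+
    have 2: "sq_integrable (\<lambda>x. (?e (freq z) x - 1) * f x)"
    proof -
      have "sq_integrable (\<lambda>x. ?e (freq z) x * f x)"
        by (rule sq_integrable_cmod_cong[OF f], measurable, simp add: norm_mult)
      from sq_integrable_diff(1)[OF this f] show ?thesis by (simp add: algebra_simps)
    qed
    show ?thesis
      using sq_integrable_add(2)[OF 1(1) 2] unfolding 1(2)
      by (simp add: tf_shift_wave algebra_simps)
  qed
  have "((\<lambda>z :: real ^ ('d + 'd). energy (\<lambda>t. tf_shift z f t - f t)) \<longlongrightarrow> 0) (at 0)"
    using always_eventually[OF allI[OF energy_nonneg]] always_eventually[OF allI[OF le]] tendsto_const lim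
    by (rule tendsto_sandwich)
  then show ?thesis
    by (simp add: continuous_at tf_shift_wave)
qed

section \<open>The Plancherel identity\<close>

definition fourier_tr :: "('a::euclidean_space \<Rightarrow> complex) \<Rightarrow> 'a \<Rightarrow> complex" where
  "fourier_tr h w = (LINT t|lborel. h t * wave (- (t \<bullet> w)))"

lemma integrable_mult_wave:
  assumes "integrable lborel h" "p \<in> borel_measurable borel"
  shows "integrable lborel (\<lambda>t. h t * wave (p t))"
proof -
  note [measurable] = assms(2) borel_measurable_integrable[OF assms(1)]
  have "integrable lborel (\<lambda>t. norm (h t))" using assms by simp
  then show ?thesis
    by (rule Bochner_Integration.integrable_bound) (auto simp: norm_mult)
qed

text \<open>
  This is the characteristic function of the standard normal distribution at \<open>-2 \<pi> v\<close>.  The transform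
  is a normal density again and so has integral \<open>1\<close>; this normalization makes the constant in the
  Plancherel identity equal to \<open>1\<close>.
\<close>

lemma gaussian_ft_1d:
  "(LINT s|lborel. complex_of_real (exp (- s\<^sup>2 / 2)) * wave (- (s * v))) =
    complex_of_real (normal_density 0 (1 / (2 * pi)) v)" (is ?A)
  "integrable lborel (\<lambda>s. complex_of_real (exp (- s\<^sup>2 / 2)) * wave (- (s * v)))" (is ?B)
proof -
  have e: "complex_of_real (exp (- s\<^sup>2 / 2)) * wave (- (s * v)) =
    complex_of_real (sqrt (2 * pi)) * (std_normal_density s *\<^sub>R iexp ((- 2 * pi * v) * s))" for s
    by (simp add: std_normal_density_def wave_def scaleR_conv_of_real field_simps)
  have "(LINT s|lborel. std_normal_density s *\<^sub>R iexp ((- 2 * pi * v) * s)) = char std_normal_distribution (- 2 * pi * v)"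
    unfolding char_def by (subst integral_density) (auto simp: normal_density_nonneg)
  also have "\<dots> = complex_of_real (exp (- ((- 2 * pi * v)\<^sup>2) / 2))"
    by (simp add: char_std_normal_distribution)
  finally have F: "(LINT s|lborel. std_normal_density s *\<^sub>R iexp ((- 2 * pi * v) * s)) =
      complex_of_real (exp (- ((- 2 * pi * v)\<^sup>2) / 2))" .
  have i: "(LINT s|lborel. complex_of_real (exp (- s\<^sup>2 / 2)) * wave (- (s * v))) =
      complex_of_real (sqrt (2 * pi) * exp (- ((- 2 * pi * v)\<^sup>2) / 2))"
    unfolding e integral_mult_right_zero F by (rule of_real_mult[symmetric])
  have s: "sqrt (2 * pi * (1 / (2 * pi))\<^sup>2) = 1 / sqrt (2 * pi)"
    by (simp add: real_sqrt_mult power_divide real_sqrt_divide field_simps power2_eq_square)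
  have "normal_density 0 (1 / (2 * pi)) v = sqrt (2 * pi) * exp (- ((- 2 * pi * v)\<^sup>2) / 2)"
    unfolding normal_density_def s by (simp add: field_simps power2_eq_square)
  then show ?A using i by simp
  show ?B unfolding e
  proof (intro integrable_mult_right)
    have "integrable lborel (\<lambda>s. norm (std_normal_density s))" by simp
    then show "integrable lborel (\<lambda>s. std_normal_density s *\<^sub>R iexp ((- 2 * pi * v) * s))"
      by (rule Bochner_Integration.integrable_bound) (auto simp: norm_exp_eq_Re)
  qed
qed

definition gauss :: "'a::euclidean_space \<Rightarrow> real" where
  "gauss x = exp (- (norm x)\<^sup>2 / 2)"

definition gauss_ft :: "'a::euclidean_space \<Rightarrow> real" where
  "gauss_ft v = (\<Prod>b\<in>Basis. normal_density 0 (1 / (2 * pi)) (v \<bullet> b))"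

lemma gauss_prod: "gauss x = (\<Prod>b\<in>Basis. exp (- (x \<bullet> b)\<^sup>2 / 2))"
proof -
  have "(norm x)\<^sup>2 = (\<Sum>b\<in>Basis. (x \<bullet> b)\<^sup>2)"
    unfolding power2_norm_eq_inner by (subst euclidean_inner) (simp only: power2_eq_square)
  then have "- (norm x)\<^sup>2 / 2 = (\<Sum>b\<in>Basis. - (x \<bullet> b)\<^sup>2 / 2)"
    by (simp add: sum_negf sum_divide_distrib)
  then show ?thesis
    by (simp only: gauss_def exp_sum finite_Basis)
qed

lemma wave_sum: "wave (sum f A) = (\<Prod>x\<in>A. wave (f x))"
  by (induction A rule: infinite_finite_induct) (auto simp: wave_add)

lemma fourier_tr_gauss:
  fixes v :: "'a::euclidean_space"
  shows "fourier_tr (\<lambda>x. complex_of_real (gauss x)) v = complex_of_real (gauss_ft v)"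
    and integrable_gauss: "integrable lborel (\<lambda>x::'a. complex_of_real (gauss x))"
proof -
  have "complex_of_real (gauss x) * wave (- (x \<bullet> v)) =
    (\<Prod>b\<in>Basis. complex_of_real (exp (- (x \<bullet> b)\<^sup>2 / 2)) * wave (- ((x \<bullet> b) * (v \<bullet> b))))" for x v :: 'a
  proof -
    have "- (x \<bullet> v) = (\<Sum>b\<in>Basis. - ((x \<bullet> b) * (v \<bullet> b)))"
      by (simp add: euclidean_inner[of x v] sum_negf)
    then show ?thesis by (simp add: gauss_prod prod.distrib wave_sum)
  qed
  note e = this
  show "fourier_tr (\<lambda>x. complex_of_real (gauss x)) v = complex_of_real (gauss_ft v)"
    unfolding fourier_tr_def e gauss_ft_def of_real_prod
    by (subst integral_lborel_prod) (simp_all only: gaussian_ft_1d)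
  have "integrable lborel (\<lambda>x::'a. complex_of_real (gauss x) * wave (- (x \<bullet> 0)))"
    unfolding e by (rule integrable_lborel_prod) (rule gaussian_ft_1d)
  then show "integrable lborel (\<lambda>x::'a. complex_of_real (gauss x))" by simp
qed

lemma integrable_gauss_ft: "integrable lborel (\<lambda>v::'a::euclidean_space. complex_of_real (gauss_ft v))"
  and integral_gauss_ft: "(LINT v|lborel. complex_of_real (gauss_ft (v::'a))) = 1"
proof -
  have i: "integrable lborel (\<lambda>s. complex_of_real (normal_density 0 (1 / (2 * pi)) s))"
    by (simp add: integrable_normal_density)
  then show "integrable lborel (\<lambda>v::'a. complex_of_real (gauss_ft v))"
    unfolding gauss_ft_def of_real_prod by (rule integrable_lborel_prod)
  show "(LINT v|lborel. complex_of_real (gauss_ft (v::'a))) = 1"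
    unfolding gauss_ft_def of_real_prod using i by (subst integral_lborel_prod) auto
qed

lemma gauss_ft_measurable [measurable]: "gauss_ft \<in> borel_measurable borel"
  unfolding gauss_ft_def by measurable

lemma gauss_measurable [measurable]: "gauss \<in> borel_measurable borel"
  unfolding gauss_def by measurable

lemma gauss_ft_nonneg: "gauss_ft v \<ge> 0"
  unfolding gauss_ft_def by (intro prod_nonneg) (simp add: normal_density_nonneg)

text \<open>
  The convolution of \<open>h\<close> with its reflected conjugate.  Its value at \<open>0\<close> is the squared norm of \<open>h\<close> and
  its Fourier transform is the squared modulus of that of \<open>h\<close>, so the Plancherel identity for \<open>h\<close> is
  Fourier inversion for the autocorrelation at the single point \<open>0\<close>.
\<close>

definition autocorr :: "('a::euclidean_space \<Rightarrow> complex) \<Rightarrow> 'a \<Rightarrow> complex" where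
  "autocorr h u = (LINT s|lborel. h (s + u) * cnj (h s))"

lemma autocorr_0:
  "autocorr h 0 = complex_of_real (energy h)"
  by (simp add: autocorr_def energy_def complex_norm_square[symmetric] del: of_real_power)

lemma norm_autocorr_le:
  assumes h: "sq_integrable h"
  shows "cmod (autocorr h u) \<le> energy h"
proof -
  have "(cmod (autocorr h u))\<^sup>2 \<le> (energy h)\<^sup>2"
    using Cauchy_Schwarz_integral[OF sq_integrable_translate(1)[OF h, of u] h]
    by (simp add: autocorr_def sq_integrable_translate(2)[OF h] power2_eq_square)
  then show ?thesis using energy_nonneg by (rule power2_le_imp_le)
qed

lemma autocorr_tendsto:
  assumes h: "sq_integrable h"
  shows "(autocorr h \<longlongrightarrow> autocorr h 0) (at 0)"
proof -
  let ?E = "\<lambda>u. energy (\<lambda>x. h (x + u) - h x)"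
  have "(?E \<longlongrightarrow> 0) (at 0)"
    using sq_integrable_L2_continuous_translation[OF h] by (simp add: L2_continuous_translation_def)
  then have lim: "((\<lambda>u. sqrt (?E u * energy h)) \<longlongrightarrow> 0) (at 0)"
    by (auto intro!: tendsto_eq_intros)
  have "norm (autocorr h u - autocorr h 0) \<le> sqrt (?E u * energy h)" for u
  proof -
    note t = sq_integrable_translate(1)[OF h, of u]
    have "autocorr h u - autocorr h 0 = (LINT s|lborel. (h (s + u) - h s) * cnj (h s))"
      using sq_integrable_mult_integrable[OF t sq_integrable_cnj[OF h]]
        sq_integrable_mult_integrable[OF h sq_integrable_cnj[OF h]]
      by (simp add: autocorr_def left_diff_distrib)
    then have "(cmod (autocorr h u - autocorr h 0))\<^sup>2 \<le> ?E u * energy h"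
      using Cauchy_Schwarz_integral[OF sq_integrable_diff(1)[OF t h] h] by simp
    then show ?thesis by (rule real_le_rsqrt)
  qed
  then have "((\<lambda>u. autocorr h u - autocorr h 0) \<longlongrightarrow> 0) (at 0)"
    by (intro Lim_null_comparison[OF _ lim] always_eventually) auto
  then show ?thesis by (simp add: LIM_zero_iff)
qed

lemma integrable_lborel_pair:
  fixes F :: "'a::euclidean_space \<Rightarrow> 'b::euclidean_space \<Rightarrow> complex"
  assumes [measurable]: "(\<lambda>(x, y). F x y) \<in> borel_measurable (borel \<Otimes>\<^sub>M borel)"
    and "(\<integral>\<^sup>+x. \<integral>\<^sup>+y. ennreal (cmod (F x y)) \<partial>lborel \<partial>lborel) < \<infinity>"
  shows "integrable (lborel \<Otimes>\<^sub>M lborel) (\<lambda>(x, y). F x y)"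
proof (rule integrableI_bounded)
  show "(\<integral>\<^sup>+p. ennreal (cmod (case p of (x, y) \<Rightarrow> F x y)) \<partial>(lborel \<Otimes>\<^sub>M lborel)) < \<infinity>"
    using assms(2) by (subst lborel.nn_integral_fst[symmetric]) (auto simp: split_beta')
qed simp

lemma
  assumes h: "integrable lborel h"
  shows integrable_autocorr: "integrable lborel (autocorr h)"
    and fourier_tr_autocorr: "fourier_tr (autocorr h) w = complex_of_real ((cmod (fourier_tr h w))\<^sup>2)"
proof -
  have [measurable]: "h \<in> borel_measurable borel" using borel_measurable_integrable[OF h] by simp
  have hn: "(\<integral>\<^sup>+x. ennreal (cmod (h x)) \<partial>lborel) < \<infinity>"
    using h by (simp add: integrable_iff_bounded)
  have pair: "integrable (lborel \<Otimes>\<^sub>M lborel) (\<lambda>(s, u). h (s + u) * cnj (h s) * wave (- (u \<bullet> w)))" for w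
  proof (rule integrable_lborel_pair)
    have "(\<integral>\<^sup>+s. \<integral>\<^sup>+u. ennreal (cmod (h (s + u) * cnj (h s) * wave (- (u \<bullet> w)))) \<partial>lborel \<partial>lborel) =
       (\<integral>\<^sup>+s. ennreal (cmod (h s)) * (\<integral>\<^sup>+u. ennreal (cmod (h (u + s))) \<partial>lborel) \<partial>lborel)"
      by (subst nn_integral_cmult[symmetric]) (auto simp: norm_mult ennreal_mult mult_ac add_ac)
    also have "\<dots> = (\<integral>\<^sup>+s. ennreal (cmod (h s)) * (\<integral>\<^sup>+u. ennreal (cmod (h u)) \<partial>lborel) \<partial>lborel)"
      by (subst nn_integral_lborel_translate[of "\<lambda>u. ennreal (cmod (h u))"]) auto
    also have "\<dots> = (\<integral>\<^sup>+s. ennreal (cmod (h s)) \<partial>lborel) * (\<integral>\<^sup>+u. ennreal (cmod (h u)) \<partial>lborel)"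
      by (rule nn_integral_multc) auto
    also have "\<dots> < \<infinity>" using hn by (simp add: ennreal_mult_less_top)
    finally show "(\<integral>\<^sup>+s. \<integral>\<^sup>+u. ennreal (cmod (h (s + u) * cnj (h s) * wave (- (u \<bullet> w)))) \<partial>lborel \<partial>lborel) < \<infinity>" .
  qed measurable
  show "integrable lborel (autocorr h)"
    using lborel_pair.integrable_snd[OF pair[of 0]] by (simp add: autocorr_def[abs_def])
  have "fourier_tr (autocorr h) w = (LINT u|lborel. LINT s|lborel. h (s + u) * cnj (h s) * wave (- (u \<bullet> w)))"
    by (simp add: fourier_tr_def autocorr_def)
  also have "\<dots> = (LINT s|lborel. LINT u|lborel. h (s + u) * cnj (h s) * wave (- (u \<bullet> w)))"
    using pair by (rule lborel_pair.Fubini_integral)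
  also have "\<dots> = (LINT s|lborel. cnj (h s * wave (- (s \<bullet> w))) * fourier_tr h w)"
  proof (intro Bochner_Integration.integral_cong refl)
    fix s
    have "(LINT u|lborel. h (s + u) * cnj (h s) * wave (- (u \<bullet> w))) =
      (LINT u|lborel. cnj (h s * wave (- (s \<bullet> w))) * (h (u + s) * wave (- ((u + s) \<bullet> w))))"
    proof (intro Bochner_Integration.integral_cong refl)
      fix u
      have w: "wave (- ((u + s) \<bullet> w)) = wave (- (u \<bullet> w)) * wave (- (s \<bullet> w))"
        unfolding wave_add[symmetric] by (simp add: inner_add_left)
      have "cnj (h s * wave (- (s \<bullet> w))) * (h (u + s) * wave (- ((u + s) \<bullet> w))) =
        h (s + u) * cnj (h s) * wave (- (u \<bullet> w)) * (wave (s \<bullet> w) * wave (- (s \<bullet> w)))"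
        unfolding w by (simp add: mult_ac add.commute)
      then show "h (s + u) * cnj (h s) * wave (- (u \<bullet> w)) =
          cnj (h s * wave (- (s \<bullet> w))) * (h (u + s) * wave (- ((u + s) \<bullet> w)))"
        by (simp only: wave_minus_cancel mult_1_right)
    qed
    also have "\<dots> = cnj (h s * wave (- (s \<bullet> w))) * (LINT u|lborel. h (u + s) * wave (- ((u + s) \<bullet> w)))"
      by simp
    also have "(LINT u|lborel. h (u + s) * wave (- ((u + s) \<bullet> w))) = fourier_tr h w"
      unfolding fourier_tr_def by (rule integral_lborel_translate) measurable
    finally show "(LINT u|lborel. h (s + u) * cnj (h s) * wave (- (u \<bullet> w))) = cnj (h s * wave (- (s \<bullet> w))) * fourier_tr h w" .
  qed
  also have "\<dots> = cnj (fourier_tr h w) * fourier_tr h w"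
    unfolding integral_mult_left_zero fourier_tr_def
    using Bochner_Integration.integral_cnj[of lborel "\<lambda>s. h s * wave (- (s \<bullet> w))"] by (simp only:)
  also have "\<dots> = complex_of_real ((cmod (fourier_tr h w))\<^sup>2)"
    by (simp only: complex_norm_square mult.commute)
  finally show "fourier_tr (autocorr h) w = complex_of_real ((cmod (fourier_tr h w))\<^sup>2)" .
qed

lemma fourier_tr_multiplication:
  assumes f: "integrable lborel f" and g: "integrable lborel g"
  shows "(LINT w|lborel. f w * fourier_tr g w) = (LINT u|lborel. fourier_tr f u * g u)"
proof -
  have [measurable]: "f \<in> borel_measurable borel" "g \<in> borel_measurable borel"
    using borel_measurable_integrable[OF f] borel_measurable_integrable[OF g] by simp_all
  have pair: "integrable (lborel \<Otimes>\<^sub>M lborel) (\<lambda>(w, u). f w * (g u * wave (- (u \<bullet> w))))"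
  proof (rule integrable_lborel_pair)
    have "(\<integral>\<^sup>+w. \<integral>\<^sup>+u. ennreal (cmod (f w * (g u * wave (- (u \<bullet> w))))) \<partial>lborel \<partial>lborel) =
       (\<integral>\<^sup>+w. ennreal (cmod (f w)) * (\<integral>\<^sup>+u. ennreal (cmod (g u)) \<partial>lborel) \<partial>lborel)"
      by (subst nn_integral_cmult[symmetric]) (auto simp: norm_mult ennreal_mult)
    also have "\<dots> = (\<integral>\<^sup>+w. ennreal (cmod (f w)) \<partial>lborel) * (\<integral>\<^sup>+u. ennreal (cmod (g u)) \<partial>lborel)"
      by (rule nn_integral_multc) auto
    also have "\<dots> < \<infinity>" using f g by (simp add: ennreal_mult_less_top integrable_iff_bounded)
    finally show "(\<integral>\<^sup>+w. \<integral>\<^sup>+u. ennreal (cmod (f w * (g u * wave (- (u \<bullet> w))))) \<partial>lborel \<partial>lborel) < \<infinity>" .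
  qed measurable
  have "(LINT w|lborel. f w * fourier_tr g w) = (LINT w|lborel. LINT u|lborel. f w * (g u * wave (- (u \<bullet> w))))"
    by (simp add: fourier_tr_def)
  also have "\<dots> = (LINT u|lborel. LINT w|lborel. f w * (g u * wave (- (u \<bullet> w))))"
    using pair by (rule lborel_pair.Fubini_integral[symmetric])
  also have "\<dots> = (LINT u|lborel. LINT w|lborel. g u * (f w * wave (- (w \<bullet> u))))"
    by (simp add: mult_ac inner_commute)
  also have "\<dots> = (LINT u|lborel. fourier_tr f u * g u)"
    by (simp add: fourier_tr_def mult.commute)
  finally show ?thesis .
qed

lemma fourier_tr_scale:
  fixes f :: "'a::euclidean_space \<Rightarrow> complex"
  assumes [measurable]: "f \<in> borel_measurable borel" and c: "c > 0"
  shows "fourier_tr (\<lambda>x. f (x /\<^sub>R c)) u = complex_of_real c ^ DIM('a) * fourier_tr f (c *\<^sub>R u)"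
proof -
  have "fourier_tr (\<lambda>x. f (x /\<^sub>R c)) u = complex_of_real c ^ DIM('a) * (LINT x|lborel. f ((c *\<^sub>R x) /\<^sub>R c) * wave (- ((c *\<^sub>R x) \<bullet> u)))"
    unfolding fourier_tr_def by (rule integral_lborel_scale) (use c in measurable)
  also have "\<dots> = complex_of_real c ^ DIM('a) * fourier_tr f (c *\<^sub>R u)"
    unfolding fourier_tr_def using c by simp
  finally show ?thesis .
qed

lemma fourier_tr_measurable [measurable]:
  assumes [measurable]: "h \<in> borel_measurable borel"
  shows "fourier_tr h \<in> borel_measurable borel"
  unfolding fourier_tr_def by measurable

lemma integrable_lborel_scale:
  fixes F :: "'a::euclidean_space \<Rightarrow> complex"
  assumes F: "integrable lborel F" and c: "c > 0"
  shows "integrable lborel (\<lambda>x. F (c *\<^sub>R x))"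
proof -
  have [measurable]: "F \<in> borel_measurable borel" using borel_measurable_integrable[OF F] by simp
  have "(lborel :: 'a measure) = density (distr lborel borel (\<lambda>x. 0 + c *\<^sub>R x)) (\<lambda>_. \<bar>c\<bar>^DIM('a))"
    by (rule lborel_affine) (use c in simp)
  then have "integrable (density (distr lborel borel (\<lambda>x::'a. c *\<^sub>R x)) (\<lambda>_. c^DIM('a))) F"
    using F c by simp
  then have "integrable (distr lborel borel (\<lambda>x::'a. c *\<^sub>R x)) (\<lambda>x. c^DIM('a) *\<^sub>R F x)"
    by (subst (asm) integrable_density) (use c in auto)
  then have "integrable lborel (\<lambda>x. c^DIM('a) *\<^sub>R F (c *\<^sub>R x))"
    by (subst (asm) integrable_distr_eq) auto
  then have "integrable lborel (\<lambda>x. inverse (c^DIM('a)) *\<^sub>R (c^DIM('a) *\<^sub>R F (c *\<^sub>R x)))"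
    by (rule integrable_scaleR_right)
  then show ?thesis using c by simp
qed

text \<open>
  Fourier inversion for the autocorrelation at \<open>0\<close> by Gaussian summation.  The weights
  \<open>gauss (w / n)\<close> increase to \<open>1\<close>, so the weighted integrals of the squared transform increase to the
  left-hand side.  The multiplication formula turns them into means of the autocorrelation against
  an approximate identity, and these converge because the autocorrelation is continuous at \<open>0\<close>.
\<close>

lemma Plancherel:
  fixes h :: "'a::euclidean_space \<Rightarrow> complex"
  assumes h1: "integrable lborel h" and h2: "sq_integrable h"
  shows "(\<integral>\<^sup>+w. sq_mod (fourier_tr h w) \<partial>lborel) = ennreal (energy h)"
proof -
  note [measurable] = sq_integrable_measurable[OF h2]
  let ?G = "\<lambda>x::'a. complex_of_real (gauss x)"
  define c where "c n = real (Suc n)" for n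
  have c: "c n > 0" for n by (simp add: c_def)
  have c0: "(\<lambda>n. v /\<^sub>R c n) \<longlonglongrightarrow> 0" for v :: 'a
    using tendsto_scaleR[OF LIMSEQ_inverse_real_of_nat tendsto_const[of v]]
    by (simp only: c_def scaleR_zero_left)
  let ?I = "\<lambda>n. LINT v|lborel. complex_of_real (gauss_ft v) * autocorr h (v /\<^sub>R c n)"
  have int: "integrable lborel (\<lambda>w. ?G (w /\<^sub>R c n))" for n
    using integrable_lborel_scale[OF integrable_gauss, of "inverse (c n)"] c[of n] by simp
  have am[measurable]: "autocorr h \<in> borel_measurable borel"
    using borel_measurable_integrable[OF integrable_autocorr[OF h1]] by simp
  have I: "(LINT w|lborel. ?G (w /\<^sub>R c n) * complex_of_real ((cmod (fourier_tr h w))\<^sup>2)) = ?I n" for n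
  proof -
    have "(LINT w|lborel. ?G (w /\<^sub>R c n) * complex_of_real ((cmod (fourier_tr h w))\<^sup>2)) =
      (LINT w|lborel. ?G (w /\<^sub>R c n) * fourier_tr (autocorr h) w)"
      by (simp only: fourier_tr_autocorr[OF h1])
    also have "\<dots> = (LINT u|lborel. fourier_tr (\<lambda>w. ?G (w /\<^sub>R c n)) u * autocorr h u)"
      by (intro fourier_tr_multiplication int integrable_autocorr h1)
    also have "\<dots> = (LINT u|lborel. complex_of_real (c n) ^ DIM('a) * (complex_of_real (gauss_ft (c n *\<^sub>R u)) * autocorr h u))"
      by (subst fourier_tr_scale) (use c in \<open>auto simp: fourier_tr_gauss mult_ac\<close>)
    also have "\<dots> = complex_of_real (c n) ^ DIM('a) * (LINT u|lborel. complex_of_real (gauss_ft (c n *\<^sub>R u)) * autocorr h u)"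
      by simp
    also have "\<dots> = ?I n"
      by (subst integral_lborel_scale[of "\<lambda>v. complex_of_real (gauss_ft v) * autocorr h (v /\<^sub>R c n)" "c n"])
         (use c[of n] in auto)
    finally show ?thesis .
  qed
  have "?I \<longlonglongrightarrow> (LINT v|(lborel::'a measure). complex_of_real (gauss_ft v) * autocorr h 0)"
  proof (rule integral_dominated_convergence[where w = "\<lambda>v. gauss_ft v * energy h"])
    show "integrable lborel (\<lambda>v::'a. gauss_ft v * energy h)"
      using integrable_gauss_ft[where 'a = 'a] by (simp add: complex_of_real_integrable_eq)
    have "isCont (autocorr h) 0"
      using autocorr_tendsto[OF h2] by (simp add: continuous_at)
    then have "(\<lambda>n. autocorr h (v /\<^sub>R c n)) \<longlonglongrightarrow> autocorr h 0" for v
      using c0 by (rule isCont_tendsto_compose)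
    then show "AE v in lborel. (\<lambda>n. complex_of_real (gauss_ft v) * autocorr h (v /\<^sub>R c n)) \<longlonglongrightarrow>
       complex_of_real (gauss_ft v) * autocorr h 0"
      by (intro AE_I2 tendsto_intros)
    show "AE v in lborel. norm (complex_of_real (gauss_ft v) * autocorr h (v /\<^sub>R c n)) \<le> gauss_ft v * energy h" for n
      by (intro AE_I2) (simp add: norm_mult abs_of_nonneg[OF gauss_ft_nonneg] mult_left_mono
          gauss_ft_nonneg norm_autocorr_le[OF h2])
  qed measurable
  also have "(LINT v|(lborel::'a measure). complex_of_real (gauss_ft v) * autocorr h 0) = complex_of_real (energy h)"
    by (simp only: integral_mult_left_zero integral_gauss_ft autocorr_0 mult_1)
  finally have "?I \<longlonglongrightarrow> complex_of_real (energy h)" .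
  from tendsto_Re[OF this] have limI: "(\<lambda>n. Re (?I n)) \<longlonglongrightarrow> energy h"
    by (simp only: Re_complex_of_real)
  have nn: "(\<integral>\<^sup>+w. ennreal (gauss (w /\<^sub>R c n) * (cmod (fourier_tr h w))\<^sup>2) \<partial>lborel) = ennreal (Re (?I n))" for n
  proof -
    have b: "cmod (fourier_tr h w) \<le> (LINT t|lborel. cmod (h t))" for w
      unfolding fourier_tr_def using integral_norm_bound[of lborel "\<lambda>t. h t * wave (- (t \<bullet> w))"] by (simp add: norm_mult)
    have i: "integrable lborel (\<lambda>w. gauss (w /\<^sub>R c n) * (cmod (fourier_tr h w))\<^sup>2)"
    proof (rule Bochner_Integration.integrable_bound)
      show "integrable lborel (\<lambda>w::'a. gauss (w /\<^sub>R c n) * (LINT t|lborel. cmod (h t))\<^sup>2)"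
        using int[of n] by (simp add: complex_of_real_integrable_eq)
      show "AE w in lborel. norm (gauss (w /\<^sub>R c n) * (cmod (fourier_tr h w))\<^sup>2) \<le>
         norm (gauss (w /\<^sub>R c n) * (LINT t|lborel. cmod (h t))\<^sup>2)"
        using b by (intro AE_I2) (auto simp: abs_mult intro!: mult_left_mono power_mono)
    qed measurable
    have "complex_of_real (LINT w|lborel. gauss (w /\<^sub>R c n) * (cmod (fourier_tr h w))\<^sup>2) = ?I n"
      unfolding I[symmetric] integral_complex_of_real[symmetric] by simp
    then have "(LINT w|lborel. gauss (w /\<^sub>R c n) * (cmod (fourier_tr h w))\<^sup>2) = Re (?I n)"
      by (metis Re_complex_of_real)
    then show ?thesis
      using i by (subst nn_integral_eq_integral) (auto simp: gauss_def)
  qed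
  have "(\<lambda>n. \<integral>\<^sup>+w. ennreal (gauss (w /\<^sub>R c n) * (cmod (fourier_tr h w))\<^sup>2) \<partial>lborel) \<longlonglongrightarrow> (\<integral>\<^sup>+w. sq_mod (fourier_tr h w) \<partial>lborel)"
  proof (rule nn_integral_LIMSEQ)
    have mono: "gauss (w /\<^sub>R c m) \<le> gauss (w /\<^sub>R c n)" if "m \<le> n" for m n and w :: 'a
    proof -
      have "inverse (c n) \<le> inverse (c m)"
        using that c by (intro le_imp_inverse_le) (auto simp: c_def)
      then have "norm (w /\<^sub>R c n) \<le> norm (w /\<^sub>R c m)"
        using c[of n] c[of m] by (simp add: mult_right_mono)
      then have "(norm (w /\<^sub>R c n))\<^sup>2 \<le> (norm (w /\<^sub>R c m))\<^sup>2"
        by (intro power_mono norm_ge_zero)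
      then show ?thesis by (simp only: gauss_def exp_le_cancel_iff)
    qed
    show "incseq (\<lambda>n w. ennreal (gauss (w /\<^sub>R c n) * (cmod (fourier_tr h w))\<^sup>2))"
      unfolding incseq_def le_fun_def
      by (intro allI impI ennreal_leI, rule mult_right_mono, erule mono, rule zero_le_power2)
    have "isCont gauss (0 :: 'a)"
      unfolding gauss_def[abs_def] by (intro continuous_intros) auto
    then have "(\<lambda>n. gauss (w /\<^sub>R c n)) \<longlonglongrightarrow> gauss (0 :: 'a)" for w :: 'a
      using c0 by (rule isCont_tendsto_compose)
    then have "(\<lambda>n. gauss (w /\<^sub>R c n) * (cmod (fourier_tr h w))\<^sup>2) \<longlonglongrightarrow> gauss (0 :: 'a) * (cmod (fourier_tr h w))\<^sup>2" for w :: 'a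
      by (intro tendsto_intros)
    then show "(\<lambda>n. ennreal (gauss (w /\<^sub>R c n) * (cmod (fourier_tr h w))\<^sup>2)) \<longlonglongrightarrow> sq_mod (fourier_tr h w)" for w
      by (intro tendsto_ennrealI) (simp add: gauss_def)
  qed measurable
  then have "(\<lambda>n. ennreal (Re (?I n))) \<longlonglongrightarrow> (\<integral>\<^sup>+w. sq_mod (fourier_tr h w) \<partial>lborel)"
    by (simp only: nn)
  moreover have "(\<lambda>n. ennreal (Re (?I n))) \<longlonglongrightarrow> ennreal (energy h)"
    by (intro tendsto_ennrealI limI)
  ultimately show ?thesis by (rule LIMSEQ_unique)
qed

section \<open>Modulated short-time Fourier transforms\<close>

lemma inner_L2_lborel:
  assumes [measurable]: "f \<in> borel_measurable borel" "h \<in> borel_measurable borel"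
  shows "inner_L2 f h = (LINT t|lborel. f t * cnj (h t))"
  unfolding inner_L2_def by (rule integral_completion) measurable

lemma tf_shift_measurable [measurable]:
  assumes [measurable]: "g \<in> borel_measurable borel"
  shows "tf_shift z g \<in> borel_measurable borel"
  unfolding tf_shift_wave[abs_def] by measurable

lemma sum_UNIV_sum:
  fixes h :: "'a::finite + 'b::finite \<Rightarrow> real"
  shows "(\<Sum>i\<in>UNIV. h i) = (\<Sum>i\<in>UNIV. h (Inl i)) + (\<Sum>i\<in>UNIV. h (Inr i))"
proof -
  have "(\<Sum>i\<in>range Inl \<union> range Inr. h i) = (\<Sum>i\<in>range Inl. h i) + (\<Sum>i\<in>range Inr. h i)"
    by (rule sum.union_disjoint) auto
  then show ?thesis by (simp add: sum.reindex o_def flip: UNIV_sum)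
qed

lemma inner_pos_freq:
  fixes z w :: "real ^ ('d::finite + 'd)"
  shows "z \<bullet> w = pos z \<bullet> pos w + freq z \<bullet> freq w"
  by (simp add: inner_vec_def pos_def freq_def sum_UNIV_sum)

lemma pos_diff: "pos (a - b) = pos a - pos b" and freq_diff: "freq (a - b) = freq a - freq b"
  by (simp_all add: pos_def freq_def vec_eq_iff)

lemma symp_J_mult:
  fixes z :: "real ^ ('d::finite + 'd)"
  shows "pos (symp_J *v z) = - freq z" "freq (symp_J *v z) = pos z"
proof -
  have d: "(\<Sum>j\<in>UNIV. (if i = j then c else 0) * v j) = c * v i" for i :: 'd and c :: real and v
  proof -
    have "(\<Sum>j\<in>UNIV. (if i = j then c else 0) * v j) = (\<Sum>j\<in>UNIV. if j = i then c * v j else 0)"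
      by (intro sum.cong) auto
    then show ?thesis by simp
  qed
  show "pos (symp_J *v z) = - freq z"
    by (simp add: vec_eq_iff pos_def freq_def matrix_vector_mult_def sum_UNIV_sum symp_J_def d)
  show "freq (symp_J *v z) = pos z"
    by (simp add: vec_eq_iff pos_def freq_def matrix_vector_mult_def sum_UNIV_sum symp_J_def d)
qed

lemma stft_lborel:
  assumes [measurable]: "f \<in> borel_measurable borel" "g \<in> borel_measurable borel"
  shows "stft g f z = (LINT t|lborel. f t * (wave (- (freq z \<bullet> t)) * cnj (g (t - pos z))))"
  unfolding stft_def by (subst inner_L2_lborel) (auto simp: tf_shift_wave)

lemma sq_integrable_wave:
  assumes f: "sq_integrable f" and [measurable]: "p \<in> borel_measurable borel"
  shows "sq_integrable (\<lambda>t. wave (p t) * f t)" "energy (\<lambda>t. wave (p t) * f t) = energy f"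
proof -
  note [measurable] = sq_integrable_measurable[OF f]
  have m: "(\<lambda>t. wave (p t) * f t) \<in> borel_measurable borel" by measurable
  have n: "cmod (wave (p t) * f t) = cmod (f t)" for t by (simp add: norm_mult)
  show "sq_integrable (\<lambda>t. wave (p t) * f t)" "energy (\<lambda>t. wave (p t) * f t) = energy f"
    by (rule sq_integrable_cmod_cong[OF f m n])+
qed

text \<open>
  A character in phase space amounts to a common translation of signal and window and a phase.  The
  result is still a Fourier transform in the frequency variable, with the position as a parameter;
  therefore the Plancherel identity applies to linear combinations over different characters.
\<close>

lemma wave_mult_stft:
  fixes f g :: "real ^ 'd::finite \<Rightarrow> complex"
  assumes [measurable]: "f \<in> borel_measurable borel" "g \<in> borel_measurable borel"
  shows "wave (\<xi> \<bullet> z) * stft g f z =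
    fourier_tr (\<lambda>t. wave (pos \<xi> \<bullet> pos z) * (f (t + freq \<xi>) * cnj (g (t + freq \<xi> - pos z)))) (freq z)"
proof -
  have "stft g f z = (LINT t|lborel. f (t + freq \<xi>) * (wave (- (freq z \<bullet> (t + freq \<xi>))) * cnj (g (t + freq \<xi> - pos z))))"
    unfolding stft_lborel[OF assms] by (rule integral_lborel_translate[symmetric]) measurable
  then have "wave (\<xi> \<bullet> z) * stft g f z =
     (LINT t|lborel. wave (\<xi> \<bullet> z) * (f (t + freq \<xi>) * (wave (- (freq z \<bullet> (t + freq \<xi>))) * cnj (g (t + freq \<xi> - pos z)))))"
    by simp
  also have "\<dots> = fourier_tr (\<lambda>t. wave (pos \<xi> \<bullet> pos z) * (f (t + freq \<xi>) * cnj (g (t + freq \<xi> - pos z)))) (freq z)"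
    unfolding fourier_tr_def
  proof (intro Bochner_Integration.integral_cong refl)
    fix t
    have "wave (\<xi> \<bullet> z) * wave (- (freq z \<bullet> (t + freq \<xi>))) = wave (pos \<xi> \<bullet> pos z) * wave (- (t \<bullet> freq z))"
      unfolding wave_add[symmetric] by (simp add: inner_pos_freq inner_add_right inner_commute)
    then have "(wave (\<xi> \<bullet> z) * wave (- (freq z \<bullet> (t + freq \<xi>)))) * (f (t + freq \<xi>) * cnj (g (t + freq \<xi> - pos z))) =
      (wave (pos \<xi> \<bullet> pos z) * wave (- (t \<bullet> freq z))) * (f (t + freq \<xi>) * cnj (g (t + freq \<xi> - pos z)))"
      by (simp only:)
    then show "wave (\<xi> \<bullet> z) * (f (t + freq \<xi>) * (wave (- (freq z \<bullet> (t + freq \<xi>))) * cnj (g (t + freq \<xi> - pos z)))) =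
      wave (pos \<xi> \<bullet> pos z) * (f (t + freq \<xi>) * cnj (g (t + freq \<xi> - pos z))) * wave (- (t \<bullet> freq z))"
      by (simp only: mult_ac)
  qed
  finally show ?thesis .
qed

text \<open>
  The functions are elementary tensors \<open>F k \<otimes> G k\<close>, so their Gram matrix is the entrywise product of
  the Gram matrices of the factors.
\<close>

lemma energy_tensor_sum:
  fixes F G :: "'i \<Rightarrow> 'a::euclidean_space \<Rightarrow> complex"
  assumes S: "finite S" and F: "\<And>k. k \<in> S \<Longrightarrow> sq_integrable (F k)" and G: "\<And>k. k \<in> S \<Longrightarrow> sq_integrable (G k)"
  shows "(\<integral>\<^sup>+t. \<integral>\<^sup>+y. sq_mod (\<Sum>k\<in>S. (c k * F k t) * G k y) \<partial>lborel \<partial>lborel) =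
    ennreal (Re (\<Sum>k\<in>S. \<Sum>l\<in>S. c k * cnj (c l) * (LINT t|lborel. F k t * cnj (F l t)) * (LINT y|lborel. G k y * cnj (G l y))))"
    (is "_ = ennreal (Re ?D)") and
    "0 \<le> Re (\<Sum>k\<in>S. \<Sum>l\<in>S. c k * cnj (c l) * (LINT t|lborel. F k t * cnj (F l t)) * (LINT y|lborel. G k y * cnj (G l y)))"
proof -
  define Q where "Q k l = (LINT y|lborel. G k y * cnj (G l y))" for k l
  let ?E = "\<lambda>t. energy (\<lambda>y. \<Sum>k\<in>S. (c k * F k t) * G k y)"
  have E: "complex_of_real (?E t) = (\<Sum>k\<in>S. \<Sum>l\<in>S. (c k * cnj (c l) * Q k l) * (F k t * cnj (F l t)))" for t
    unfolding Q_def by (subst energy_sum[OF G S]) (auto simp: mult_ac intro!: sum.cong)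
  have i: "integrable lborel (\<lambda>t. F k t * cnj (F l t))" if "k \<in> S" "l \<in> S" for k l
    by (intro sq_integrable_mult_integrable sq_integrable_cnj F that)
  have Ei: "integrable lborel (\<lambda>t. complex_of_real (?E t))"
    unfolding E using i by (intro Bochner_Integration.integrable_sum integrable_mult_right) auto
  have "complex_of_real (LINT t|lborel. ?E t) = (LINT t|lborel. complex_of_real (?E t))"
    by simp
  also have "\<dots> = (\<Sum>k\<in>S. \<Sum>l\<in>S. (c k * cnj (c l) * Q k l) * (LINT t|lborel. F k t * cnj (F l t)))"
    unfolding E using i by simp
  also have "\<dots> = ?D"
    unfolding Q_def by (intro sum.cong refl) (simp add: mult_ac)
  finally have D: "(LINT t|lborel. ?E t) = Re ?D"
    by (metis Re_complex_of_real)
  have "(\<integral>\<^sup>+t. \<integral>\<^sup>+y. sq_mod (\<Sum>k\<in>S. (c k * F k t) * G k y) \<partial>lborel \<partial>lborel) = (\<integral>\<^sup>+t. ennreal (?E t) \<partial>lborel)"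
    by (intro nn_integral_cong nn_integral_energy sq_integrable_sum sq_integrable_cmult G)
  also have "\<dots> = ennreal (LINT t|lborel. ?E t)"
    using Ei by (intro nn_integral_eq_integral) (auto simp: complex_of_real_integrable_eq energy_nonneg)
  finally show "(\<integral>\<^sup>+t. \<integral>\<^sup>+y. sq_mod (\<Sum>k\<in>S. (c k * F k t) * G k y) \<partial>lborel \<partial>lborel) = ennreal (Re ?D)"
    unfolding D .
  show "0 \<le> Re ?D"
    unfolding D[symmetric] by (intro Bochner_Integration.integral_nonneg energy_nonneg)
qed

abbreviation coeff_energy :: "'i set \<Rightarrow> ('i \<Rightarrow> complex) \<Rightarrow> real" where
  "coeff_energy S a \<equiv> \<Sum>k\<in>S. (cmod (a k))\<^sup>2"

text \<open>
  Schur's test: \<open>2 |c k| |c l| \<le> |c k|\<^sup>2 + |c l|\<^sup>2\<close>, and by symmetry the two halves contribute the same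
  row sums of the off-diagonal part of \<open>Q\<close>.
\<close>

lemma hermitian_form_near_diagonal:
  fixes P Q :: "'i \<Rightarrow> 'i \<Rightarrow> complex" and c :: "'i \<Rightarrow> complex"
  assumes S: "finite S"
    and P: "\<And>k. k \<in> S \<Longrightarrow> P k k = of_real A" "\<And>k l. k \<in> S \<Longrightarrow> l \<in> S \<Longrightarrow> cmod (P k l) \<le> A"
    and Q: "\<And>k. k \<in> S \<Longrightarrow> Q k k = of_real B" "\<And>k l. cmod (Q k l) = cmod (Q l k)"
    and \<rho>: "\<And>k. k \<in> S \<Longrightarrow> (\<Sum>l\<in>S - {k}. cmod (Q k l)) \<le> \<rho>" and A: "A \<ge> 0"
  shows "\<bar>Re (\<Sum>k\<in>S. \<Sum>l\<in>S. c k * cnj (c l) * P k l * Q k l) - A * B * (\<Sum>k\<in>S. (cmod (c k))\<^sup>2)\<bar>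
    \<le> A * \<rho> * (\<Sum>k\<in>S. (cmod (c k))\<^sup>2)"
proof -
  define r where "r k l = (if k = l then 0 else cmod (Q k l))" for k l
  define T where "T k l = c k * cnj (c l) * P k l * Q k l" for k l
  have rs: "r k l = r l k" for k l using Q(2) by (simp add: r_def)
  have r0: "r k l \<ge> 0" for k l by (simp add: r_def)
  have r\<rho>: "(\<Sum>l\<in>S. r k l) \<le> \<rho>" if "k \<in> S" for k
  proof -
    have "(\<Sum>l\<in>S. r k l) = (\<Sum>l\<in>S - {k}. r k l)"
      using S by (intro sum.mono_neutral_right) (auto simp: r_def)
    also have "\<dots> = (\<Sum>l\<in>S - {k}. cmod (Q k l))"
      by (intro sum.cong) (auto simp: r_def)
    finally show ?thesis using \<rho>[OF that] by simp
  qed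
  have diag: "T k k = of_real (A * B * (cmod (c k))\<^sup>2)" if "k \<in> S" for k
    using that by (simp add: T_def P Q complex_norm_square del: of_real_power) 
  have split: "(\<Sum>l\<in>S. T k l) = T k k + (\<Sum>l\<in>S - {k}. T k l)" if "k \<in> S" for k
    using S that by (simp add: sum.remove)
  have "(\<Sum>k\<in>S. \<Sum>l\<in>S. T k l) - of_real (A * B * (\<Sum>k\<in>S. (cmod (c k))\<^sup>2)) = (\<Sum>k\<in>S. \<Sum>l\<in>S - {k}. T k l)"
    by (simp add: split diag sum.distrib sum_distrib_left cong: sum.cong)
  then have "\<bar>Re (\<Sum>k\<in>S. \<Sum>l\<in>S. T k l) - A * B * (\<Sum>k\<in>S. (cmod (c k))\<^sup>2)\<bar> = \<bar>Re (\<Sum>k\<in>S. \<Sum>l\<in>S - {k}. T k l)\<bar>"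
    by (metis Re_complex_of_real minus_complex.simps(1))
  also have "\<dots> \<le> cmod (\<Sum>k\<in>S. \<Sum>l\<in>S - {k}. T k l)"
    by (rule abs_Re_le_cmod)
  also have "\<dots> \<le> (\<Sum>k\<in>S. \<Sum>l\<in>S - {k}. cmod (T k l))"
    by (intro order_trans[OF norm_sum] sum_mono norm_sum)
  also have "\<dots> \<le> (\<Sum>k\<in>S. \<Sum>l\<in>S - {k}. A * (((cmod (c k))\<^sup>2 + (cmod (c l))\<^sup>2) / 2 * r k l))"
  proof (intro sum_mono)
    fix k l assume kl: "k \<in> S" "l \<in> S - {k}"
    have "cmod (T k l) = cmod (c k) * cmod (c l) * r k l * cmod (P k l)"
      using kl by (auto simp: T_def norm_mult r_def)
    also have "\<dots> \<le> ((cmod (c k))\<^sup>2 + (cmod (c l))\<^sup>2) / 2 * r k l * A"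
      using kl P(2)[of k l] sum_squares_bound[of "cmod (c k)" "cmod (c l)"] r0 A
      by (intro mult_mono) auto
    finally show "cmod (T k l) \<le> A * (((cmod (c k))\<^sup>2 + (cmod (c l))\<^sup>2) / 2 * r k l)"
      by (simp add: mult.commute)
  qed
  also have "\<dots> = (\<Sum>k\<in>S. \<Sum>l\<in>S. A * (((cmod (c k))\<^sup>2 + (cmod (c l))\<^sup>2) / 2 * r k l))"
    by (intro sum.cong refl sum.mono_neutral_left) (use S in \<open>auto simp: r_def\<close>)
  also have "\<dots> = A / 2 * (\<Sum>k\<in>S. \<Sum>l\<in>S. (cmod (c k))\<^sup>2 * r k l) + A / 2 * (\<Sum>k\<in>S. \<Sum>l\<in>S. (cmod (c l))\<^sup>2 * r k l)"
    by (simp add: sum_distrib_left sum.distrib[symmetric] field_simps)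
  also have "(\<Sum>k\<in>S. \<Sum>l\<in>S. (cmod (c l))\<^sup>2 * r k l) = (\<Sum>k\<in>S. \<Sum>l\<in>S. (cmod (c k))\<^sup>2 * r k l)"
    by (subst sum.swap) (simp add: rs)
  also have "A / 2 * (\<Sum>k\<in>S. \<Sum>l\<in>S. (cmod (c k))\<^sup>2 * r k l) + A / 2 * (\<Sum>k\<in>S. \<Sum>l\<in>S. (cmod (c k))\<^sup>2 * r k l)
     = A * (\<Sum>k\<in>S. (cmod (c k))\<^sup>2 * (\<Sum>l\<in>S. r k l))"
    by (simp add: sum_distrib_left)
  also have "\<dots> \<le> A * (\<Sum>k\<in>S. (cmod (c k))\<^sup>2 * \<rho>)"
    using r\<rho> A by (intro mult_left_mono sum_mono) auto
  also have "\<dots> = A * \<rho> * (\<Sum>k\<in>S. (cmod (c k))\<^sup>2)"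
    by (simp add: sum_distrib_left mult_ac)
  finally show ?thesis by (simp add: T_def)
qed

lemma energy_inner_self: "(LINT t|lborel. f t * cnj (f t)) = complex_of_real (energy f)"
  by (simp add: energy_def complex_norm_square[symmetric] del: of_real_power)

text \<open>
  The Plancherel identity in the frequency variable and the substitution \<open>y = t - x\<close> turn the integral
  into the squared norm of \<open>\<Sum>\<^sub>k a k F k(t) G k(y)\<close>, where \<open>F k\<close> and \<open>G k\<close> are shifts of \<open>f\<close> and of the
  conjugate of \<open>g\<close>.  The Gram matrix of the \<open>F k\<close> is bounded by \<open>energy f\<close>, and that of the \<open>G k\<close>
  consists, up to phases, of the values of \<open>stft g g\<close> at the points \<open>J(\<xi> k - \<xi> l)\<close>.
\<close>

lemma stft_quadratic_bound:
  fixes f g :: "real ^ 'd::finite \<Rightarrow> complex" and \<xi> :: "'i \<Rightarrow> real ^ ('d + 'd)"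
  assumes f: "sq_integrable f" and g: "sq_integrable g" and S: "finite S"
    and \<rho>: "\<And>k. k \<in> S \<Longrightarrow> (\<Sum>l\<in>S - {k}. cmod (stft g g (symp_J *v (\<xi> k - \<xi> l)))) \<le> \<rho>"
  obtains r where
    "(\<integral>\<^sup>+z. sq_mod ((\<Sum>k\<in>S. a k * wave (\<xi> k \<bullet> z)) * stft g f z) \<partial>lborel) = ennreal r"
    "0 \<le> r" "\<bar>r - energy f * energy g * coeff_energy S a\<bar> \<le> energy f * \<rho> * coeff_energy S a"
proof -
  note [measurable] = sq_integrable_measurable[OF f] sq_integrable_measurable[OF g]
  define p where "p k = pos (\<xi> k)" for k
  define q where "q k = freq (\<xi> k)" for k
  define F where "F k t = wave (p k \<bullet> t) * f (t + q k)" for k t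
  define G where "G k y = wave (- (p k \<bullet> y)) * cnj (g (y + q k))" for k y
  define H where "H x t = (\<Sum>k\<in>S. a k * (wave (p k \<bullet> x) * (f (t + q k) * cnj (g (t + q k - x)))))" for x t
  have F: "sq_integrable (F k)" "energy (F k) = energy f" for k
    unfolding F_def using sq_integrable_wave[OF sq_integrable_translate(1)[OF f]] sq_integrable_translate(2)[OF f]
    by (auto simp: measurable_compose)
  have G: "sq_integrable (G k)" "energy (G k) = energy g" for k
  proof -
    have c: "sq_integrable (\<lambda>y. cnj (g (y + q k)))" "energy (\<lambda>y. cnj (g (y + q k))) = energy g"
      using sq_integrable_translate[OF g, of "q k"] sq_integrable_cnj[of "\<lambda>y. g (y + q k)"]
      by (auto simp: energy_def)
    show "sq_integrable (G k)" "energy (G k) = energy g"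
      unfolding G_def using sq_integrable_wave[OF c(1)] c(2) by auto
  qed
  define P where "P k l = (LINT t|lborel. F k t * cnj (F l t))" for k l
  define Q where "Q k l = (LINT y|lborel. G k y * cnj (G l y))" for k l
  define r where "r = Re (\<Sum>k\<in>S. \<Sum>l\<in>S. a k * cnj (a l) * P k l * Q k l)"
  have [measurable]: "(\<lambda>(x, t). H x t) \<in> borel_measurable (borel \<Otimes>\<^sub>M borel)"
    unfolding H_def by measurable
  have HFG: "H (t - y) t = (\<Sum>k\<in>S. (a k * F k t) * G k y)" for t y
  proof -
    have "wave (p k \<bullet> (t - y)) = wave (p k \<bullet> t) * wave (- (p k \<bullet> y))" for k
      unfolding wave_add[symmetric] by (simp add: inner_diff_right)
    then show ?thesis
      unfolding H_def F_def G_def by (intro sum.cong refl) (simp add: mult_ac add_ac)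
  qed
  have "(\<integral>\<^sup>+x. \<integral>\<^sup>+t. sq_mod (H x t) \<partial>lborel \<partial>lborel) = (\<integral>\<^sup>+t. \<integral>\<^sup>+x. sq_mod (H x t) \<partial>lborel \<partial>lborel)"
    by (rule lborel_pair.Fubini') measurable
  also have "\<dots> = (\<integral>\<^sup>+t. \<integral>\<^sup>+y. sq_mod (H (t - y) t) \<partial>lborel \<partial>lborel)"
    by (intro nn_integral_cong nn_integral_lborel_reflect[symmetric]) measurable
  also have "\<dots> = ennreal r"
    unfolding HFG r_def P_def Q_def by (rule energy_tensor_sum(1)[OF S F(1) G(1)])
  finally have Hr: "(\<integral>\<^sup>+x. \<integral>\<^sup>+t. sq_mod (H x t) \<partial>lborel \<partial>lborel) = ennreal r" .
  have r0: "0 \<le> r"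
    unfolding r_def P_def Q_def by (rule energy_tensor_sum(2)[OF S F(1) G(1)])
  have Hint: "integrable lborel (\<lambda>t. f (t + q k) * cnj (g (t + q k - x)))" for k x
  proof -
    have "sq_integrable (\<lambda>t. g (t + q k - x))"
      using sq_integrable_translate(1)[OF g, of "q k - x"] by (simp only: add_diff_eq)
    then show ?thesis
      by (rule sq_integrable_mult_integrable[OF sq_integrable_translate(1)[OF f] sq_integrable_cnj])
  qed
  then have Hi: "integrable lborel (H x)" for x
    unfolding H_def[abs_def] by (intro Bochner_Integration.integrable_sum integrable_mult_right)
  have ftH: "(\<Sum>k\<in>S. a k * wave (\<xi> k \<bullet> z)) * stft g f z = fourier_tr (H (pos z)) (freq z)" for z
  proof -
    have "(\<Sum>k\<in>S. a k * wave (\<xi> k \<bullet> z)) * stft g f z = (\<Sum>k\<in>S. a k * (wave (\<xi> k \<bullet> z) * stft g f z))"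
      by (simp add: sum_distrib_right mult.assoc)
    also have "\<dots> = (\<Sum>k\<in>S. a k * fourier_tr (\<lambda>t. wave (p k \<bullet> pos z) * (f (t + q k) * cnj (g (t + q k - pos z)))) (freq z))"
      by (subst wave_mult_stft) (auto simp: p_def q_def)
    also have "\<dots> = (\<Sum>k\<in>S. LINT t|lborel. a k * (wave (p k \<bullet> pos z) * (f (t + q k) * cnj (g (t + q k - pos z)))) * wave (- (t \<bullet> freq z)))"
      by (simp add: fourier_tr_def mult.assoc)
    also have "\<dots> = (LINT t|lborel. (\<Sum>k\<in>S. a k * (wave (p k \<bullet> pos z) * (f (t + q k) * cnj (g (t + q k - pos z)))) * wave (- (t \<bullet> freq z))))"
      using Hint by (intro Bochner_Integration.integral_sum[symmetric] integrable_mult_wave integrable_mult_right) auto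
    also have "\<dots> = fourier_tr (H (pos z)) (freq z)"
      by (simp add: fourier_tr_def H_def sum_distrib_right)
    finally show ?thesis .
  qed
  have [measurable]: "(\<lambda>z. (\<Sum>k\<in>S. a k * wave (\<xi> k \<bullet> z)) * stft g f z) \<in> borel_measurable borel"
  proof -
    have "(\<lambda>(x, w). fourier_tr (H x) w) \<in> borel_measurable (borel \<Otimes>\<^sub>M borel)"
      unfolding fourier_tr_def by measurable
    then show ?thesis
      unfolding ftH by measurable
  qed
  have "(\<integral>\<^sup>+z. sq_mod ((\<Sum>k\<in>S. a k * wave (\<xi> k \<bullet> z)) * stft g f z) \<partial>lborel) =
    (\<integral>\<^sup>+x. \<integral>\<^sup>+w. sq_mod ((\<Sum>k\<in>S. a k * wave (\<xi> k \<bullet> tf_point x w)) * stft g f (tf_point x w)) \<partial>lborel \<partial>lborel)"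
    by (rule nn_integral_lborel_tf_point) measurable
  also have "\<dots> = (\<integral>\<^sup>+x. \<integral>\<^sup>+w. sq_mod (fourier_tr (H x) w) \<partial>lborel \<partial>lborel)"
    unfolding ftH by simp
  also have "\<dots> = (\<integral>\<^sup>+x. \<integral>\<^sup>+t. sq_mod (H x t) \<partial>lborel \<partial>lborel)"
  proof (rule nn_integral_cong_AE)
    \<comment> \<open>Each \<open>H x\<close> is integrable, but it is square-integrable only for almost all \<open>x\<close>.\<close>
    have "AE x in lborel. (\<integral>\<^sup>+t. sq_mod (H x t) \<partial>lborel) \<noteq> \<infinity>"
      using Hr by (intro nn_integral_PInf_AE) auto
    then show "AE x in lborel. (\<integral>\<^sup>+w. sq_mod (fourier_tr (H x) w) \<partial>lborel) = (\<integral>\<^sup>+t. sq_mod (H x t) \<partial>lborel)"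
    proof eventually_elim
      case (elim x)
      have [measurable]: "H x \<in> borel_measurable borel"
        using borel_measurable_integrable[OF Hi[of x]] by simp
      have s: "sq_integrable (H x)" 
        using elim by (intro sq_integrableI) (auto simp: less_top)
      show ?case using Plancherel[OF Hi s] nn_integral_energy[OF s] by simp
    qed
  qed
  also have "\<dots> = ennreal r" by (rule Hr)
  finally have 1: "(\<integral>\<^sup>+z. sq_mod ((\<Sum>k\<in>S. a k * wave (\<xi> k \<bullet> z)) * stft g f z) \<partial>lborel) = ennreal r" .
  have Qs: "cmod (Q k l) = cmod (stft g g (symp_J *v (\<xi> k - \<xi> l)))" for k l
  proof -
    let ?z = "symp_J *v (\<xi> k - \<xi> l)"
    have z: "pos ?z = q l - q k" "freq ?z = p k - p l"
      by (simp_all add: symp_J_mult pos_diff freq_diff p_def q_def)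
    have "stft g g ?z = (LINT t|lborel. g t * (wave (- ((p k - p l) \<bullet> t)) * cnj (g (t - (q l - q k)))))"
      by (subst stft_lborel) (auto simp: z)
    also have "\<dots> = (LINT t|lborel. g (t + q l) * (wave (- ((p k - p l) \<bullet> (t + q l))) * cnj (g (t + q l - (q l - q k)))))"
      by (rule integral_lborel_translate[symmetric]) measurable
    also have "\<dots> = (LINT t|lborel. wave (- ((p k - p l) \<bullet> q l)) * (G k t * cnj (G l t)))"
    proof (intro Bochner_Integration.integral_cong refl)
      fix t
      have "wave (- ((p k - p l) \<bullet> (t + q l))) = wave (- ((p k - p l) \<bullet> q l)) * (wave (- (p k \<bullet> t)) * wave (p l \<bullet> t))"
        unfolding wave_add[symmetric] by (simp add: inner_add_right inner_diff_left algebra_simps)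
      then show "g (t + q l) * (wave (- ((p k - p l) \<bullet> (t + q l))) * cnj (g (t + q l - (q l - q k)))) =
         wave (- ((p k - p l) \<bullet> q l)) * (G k t * cnj (G l t))"
        by (simp add: G_def mult_ac)
    qed
    also have "\<dots> = wave (- ((p k - p l) \<bullet> q l)) * Q k l"
      by (simp add: Q_def)
    finally show ?thesis by (simp add: norm_mult)
  qed
  have 2: "\<bar>r - energy f * energy g * coeff_energy S a\<bar> \<le> energy f * \<rho> * coeff_energy S a"
    unfolding r_def
  proof (rule hermitian_form_near_diagonal[OF S])
    show "P k k = of_real (energy f)" for k
      unfolding P_def energy_inner_self F ..
    show "Q k k = of_real (energy g)" for k
      unfolding Q_def energy_inner_self G ..
    show "cmod (P k l) \<le> energy f" for k l
    proof -
      have "(cmod (P k l))\<^sup>2 \<le> (energy f)\<^sup>2"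
        using Cauchy_Schwarz_integral[OF F(1)[of k] F(1)[of l]] by (simp add: P_def F power2_eq_square)
      then show ?thesis using energy_nonneg by (rule power2_le_imp_le)
    qed
    show "cmod (Q k l) = cmod (Q l k)" for k l
    proof -
      have "Q l k = cnj (Q k l)"
        unfolding Q_def Bochner_Integration.integral_cnj[symmetric] by (simp add: mult.commute)
      then show ?thesis by simp
    qed
    show "(\<Sum>l\<in>S - {k}. cmod (Q k l)) \<le> \<rho>" if "k \<in> S" for k
      using \<rho>[OF that] by (simp add: Qs)
  qed (rule energy_nonneg)
  show thesis by (rule that[OF 1 r0 2])
qed

section \<open>Trigonometric polynomials concentrated at the origin\<close>

lemma wave_int:
  assumes "m \<in> \<int>"
  shows "wave m = 1"
proof -
  have "wave m = exp ((2 * m * pi) * \<i>)"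
    by (simp add: wave_def mult_ac)
  also have "\<dots> = 1"
    using assms by (rule exp_integer_2pi)
  finally show ?thesis .
qed

lemma integral_wave_unit_interval:
  assumes m: "m \<in> \<int>"
  shows "(LINT s|lborel. indicator {-1/2..<1/2} s *\<^sub>R wave (m * s)) = of_bool (m = 0)"
proof -
  have "(LINT s|lborel. indicator {-1/2..<1/2} s *\<^sub>R wave (m * s)) =
      (LINT s|lborel. indicator {-1/2..1/2} s *\<^sub>R wave (m * s))"
  proof (rule integral_cong_AE)
    show "AE s in lborel. indicator {-1/2..<1/2} s *\<^sub>R wave (m * s) = indicator {-1/2..1/2} s *\<^sub>R wave (m * s)"
      using AE_lborel_singleton[of "1/2::real"] by eventually_elim (auto simp: indicator_def)
  qed measurable
  also have "\<dots> = of_bool (m = 0)"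
  proof (cases "m = 0")
    case True
    then show ?thesis by (simp add: scaleR_conv_of_real)
  next
    case False
    let ?F = "\<lambda>s. wave (m * s) / (2 * of_real pi * \<i> * of_real m)"
    have "(LINT s|lborel. indicator {-1/2..1/2} s *\<^sub>R wave (m * s)) = ?F (1/2) - ?F (-1/2)"
    proof (rule integral_FTC_Icc)
      fix s :: real
      have "((\<lambda>x. exp (2 * of_real pi * \<i> * of_real m * x) / (2 * of_real pi * \<i> * of_real m)) has_field_derivative
         exp (2 * of_real pi * \<i> * of_real m * of_real s)) (at (of_real s))"
        using False by (auto intro!: derivative_eq_intros)
      then have "((\<lambda>x. exp (2 * of_real pi * \<i> * of_real m * of_real x) / (2 * of_real pi * \<i> * of_real m))
          has_vector_derivative exp (2 * of_real pi * \<i> * of_real m * of_real s)) (at s within {-1/2..1/2})"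
        by (rule has_vector_derivative_real_field)
      then show "(?F has_vector_derivative wave (m * s)) (at s within {-1/2..1/2})"
        by (simp only: wave_def of_real_mult mult.assoc)
    qed (auto intro!: continuous_intros)
    also have "wave (m * (1/2)) = wave (m * (-1/2)) * wave m"
      unfolding wave_add[symmetric] by (simp add: field_simps)
    finally show ?thesis using False wave_int[OF m] by simp
  qed
  finally show ?thesis .
qed

lemma integrable_wave_unit_interval:
  "integrable lborel (\<lambda>s. indicator {-1/2..<1/2::real} s *\<^sub>R wave (m * s))"
proof (rule Bochner_Integration.integrable_bound)
  show "integrable lborel (\<lambda>s. indicator {-1/2..<1/2::real} s :: real)" by simp
qed (auto simp: indicator_def)

lemma indicator_unit_cube:
  "indicator unit_cube (w :: real ^ 'n::finite) = (\<Prod>i\<in>UNIV. indicator {-1/2..<1/2} (w $ i) :: real)"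
  by (auto simp: unit_cube_def indicator_def prod_zero_iff)

lemma integral_wave_unit_cube:
  fixes k :: "real ^ 'n::finite"
  assumes k: "k \<in> int_vecs"
  shows "(LINT w|lborel. indicator unit_cube w *\<^sub>R wave (k \<bullet> w)) = of_bool (k = 0)"
proof -
  have e: "indicator unit_cube w *\<^sub>R wave (k \<bullet> w) =
    (\<Prod>b\<in>Basis. indicator {-1/2..<1/2} (w \<bullet> b) *\<^sub>R wave ((k \<bullet> b) * (w \<bullet> b)))" for w :: "real ^ 'n"
  proof -
    have "wave (k \<bullet> w) = (\<Prod>i\<in>UNIV. wave (k $ i * w $ i))"
      by (simp add: inner_vec_def wave_sum)
    then show ?thesis
      by (simp add: indicator_unit_cube prod_Basis_vec inner_axis scaleR_conv_of_real prod.distrib)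
  qed
  have "(LINT w|lborel. indicator unit_cube w *\<^sub>R wave (k \<bullet> w)) =
     (\<Prod>b\<in>Basis. (LINT s|lborel. indicator {-1/2..<1/2} s *\<^sub>R wave ((k \<bullet> b) * s)))"
    unfolding e by (rule integral_lborel_prod) (rule integrable_wave_unit_interval)
  also have "\<dots> = (\<Prod>i\<in>UNIV. of_bool (k $ i = 0))"
  proof -
    have "(LINT s|lborel. indicator {-1/2..<1/2} s *\<^sub>R wave (k $ i * s)) = of_bool (k $ i = 0)" for i
      by (rule integral_wave_unit_interval) (use k in \<open>simp add: int_vecs_def\<close>)
    then show ?thesis
      by (simp only: prod_Basis_vec inner_axis inner_real_def mult_1_right)
  qed
  also have "\<dots> = of_bool (k = 0)"
    by (auto simp: vec_eq_iff prod_zero_iff of_bool_def)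
  finally show ?thesis .
qed

lemma emeasure_unit_cube: "emeasure lborel (unit_cube :: (real ^ 'n::finite) set) \<le> 1"
proof -
  have "(unit_cube :: (real ^ 'n) set) \<subseteq> cbox (\<chi> i. -1/2) (\<chi> i. 1/2)"
    by (simp add: unit_cube_def mem_box_cart subset_eq less_imp_le)
  then have "emeasure lborel (unit_cube :: (real ^ 'n) set) \<le> emeasure lborel (cbox (\<chi> i. -1/2) (\<chi> i. 1/2) :: (real ^ 'n) set)"
    by (intro emeasure_mono) auto
  also have "\<dots> = 1"
  proof (subst emeasure_lborel_cbox)
    show "(\<chi> i. - 1 / 2) \<bullet> b \<le> (\<chi> i. 1 / 2) \<bullet> b" if "b \<in> Basis" for b :: "real ^ 'n"
      using that by (auto simp: Basis_real_vec inner_axis)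
  qed (simp add: prod_Basis_vec inner_axis)
  finally show ?thesis .
qed

abbreviation trig_poly :: "(real ^ 'n) set \<Rightarrow> (real ^ 'n \<Rightarrow> complex) \<Rightarrow> real ^ 'n::finite \<Rightarrow> complex" where
  "trig_poly S a w \<equiv> \<Sum>k\<in>S. a k * wave (k \<bullet> w)"

abbreviation "trig_mass S a A \<equiv> (\<integral>\<^sup>+w. sq_mod (trig_poly S a w) * indicator A w \<partial>lborel)"

lemma Parseval_unit_cube:
  fixes S :: "(real ^ 'n::finite) set"
  assumes S: "finite S" "S \<subseteq> int_vecs"
  shows "trig_mass S a unit_cube =
    ennreal (coeff_energy S a)"
proof -
  define F where "F k w = of_real (indicator unit_cube w) * wave (k \<bullet> w)" for k w :: "real ^ 'n"
  have F: "sq_integrable (F k)" for k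
  proof (rule sq_integrableI)
    have "(\<integral>\<^sup>+w. sq_mod (F k w) \<partial>lborel) = (\<integral>\<^sup>+w. indicator unit_cube (w :: real ^ 'n) \<partial>lborel)"
      by (intro nn_integral_cong) (auto simp: F_def indicator_def)
    then show "(\<integral>\<^sup>+w. sq_mod (F k w) \<partial>lborel) < \<infinity>"
      using emeasure_unit_cube[where 'n = 'n] by (auto simp: less_top intro: le_less_trans)
  qed (unfold F_def, measurable)
  have FF: "(LINT w|lborel. F k w * cnj (F l w)) = of_bool (k = l)" if "k \<in> S" "l \<in> S" for k l
  proof -
    have "F k w * cnj (F l w) = indicator unit_cube w *\<^sub>R wave ((k - l) \<bullet> w)" for w
    proof -
      have "wave ((k - l) \<bullet> w) = wave (k \<bullet> w) * wave (- (l \<bullet> w))"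
        unfolding wave_add[symmetric] by (simp add: inner_diff_left)
      then show ?thesis by (auto simp: F_def indicator_def)
    qed
    moreover have "k \<in> int_vecs" "l \<in> int_vecs" using that S by auto
    then have "k - l \<in> int_vecs" by (auto simp: int_vecs_def intro: Ints_diff)
    ultimately show ?thesis by (simp add: integral_wave_unit_cube)
  qed
  have "complex_of_real (energy (\<lambda>w. \<Sum>k\<in>S. a k * F k w)) = (\<Sum>k\<in>S. \<Sum>l\<in>S. a k * cnj (a l) * of_bool (k = l))"
    by (subst energy_sum[OF F S(1)]) (simp add: FF)
  also have "\<dots> = (\<Sum>k\<in>S. \<Sum>l\<in>S. if l = k then a k * cnj (a k) else 0)"
    by (intro sum.cong refl) auto
  also have "\<dots> = (\<Sum>k\<in>S. a k * cnj (a k))"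
    using S(1) by simp
  also have "\<dots> = complex_of_real (coeff_energy S a)"
    by (simp only: complex_norm_square of_real_sum)
  finally have e: "energy (\<lambda>w. \<Sum>k\<in>S. a k * F k w) = coeff_energy S a"
    by (simp only: of_real_eq_iff)
  have "trig_mass S a unit_cube =
     (\<integral>\<^sup>+w. sq_mod (\<Sum>k\<in>S. a k * F k w) \<partial>lborel)"
    by (intro nn_integral_cong) (auto simp: F_def indicator_def)
  also have "\<dots> = ennreal (coeff_energy S a)"
    unfolding e[symmetric] by (intro nn_integral_energy sq_integrable_sum sq_integrable_cmult F)
  finally show ?thesis .
qed

lemma norm_1_plus_wave_sq: "(cmod (1 + wave s))\<^sup>2 = 2 + 2 * cos (2 * pi * s)"
proof -
  have "wave s = cis (2 * pi * s)"
    by (simp add: wave_def cis_conv_exp mult_ac)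
  then have "(cmod (1 + wave s))\<^sup>2 = (1 + cos (2 * pi * s))\<^sup>2 + (sin (2 * pi * s))\<^sup>2"
    by (simp add: cmod_power2)
  also have "\<dots> = 1 + 2 * cos (2 * pi * s) + ((cos (2 * pi * s))\<^sup>2 + (sin (2 * pi * s))\<^sup>2)"
    by (simp add: power2_sum)
  finally show ?thesis by simp
qed

lemma norm_1_plus_wave_sq_less:
  assumes "s \<noteq> 0" "\<bar>s\<bar> \<le> 1/2"
  shows "(cmod (1 + wave s))\<^sup>2 < 4"
proof -
  have "cos (2 * pi * \<bar>s\<bar>) < cos 0"
    using assms by (intro cos_monotone_0_pi) (auto simp: mult_le_cancel_left_pos)
  moreover have "cos (2 * pi * \<bar>s\<bar>) = cos (2 * pi * s)"
    by (cases "s \<ge> 0") auto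
  ultimately show ?thesis by (simp add: norm_1_plus_wave_sq)
qed

lemma norm_1_plus_wave_sq_le: "(cmod (1 + wave s))\<^sup>2 \<le> 4"
  using cos_le_one[of "2 * pi * s"] unfolding norm_1_plus_wave_sq by linarith

text \<open>
  The modulus of \<open>1 + wave s\<close> attains its maximum \<open>2\<close> exactly at the integers, so high powers of the
  product concentrate at the integer vectors.
\<close>

definition bump :: "real ^ 'n::finite \<Rightarrow> complex" where
  "bump w = (\<Prod>i\<in>UNIV. 1 + wave (w $ i))"

lemma bump_power_trig_polynomial:
  obtains S a where "finite S" "S \<subseteq> (int_vecs :: (real ^ 'n::finite) set)"
    "\<And>w. bump w ^ N = (trig_poly S a w)"
proof -
  define P where "P = (UNIV :: 'n set) \<rightarrow>\<^sub>E {..N}"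
  define \<kappa> :: "('n \<Rightarrow> nat) \<Rightarrow> real ^ 'n" where "\<kappa> p = (\<chi> i. real (p i))" for p
  \<comment> \<open>The frequencies are vectors of reals; \<open>nat \<lfloor>k $ i\<rfloor>\<close> recovers the exponent in the binomial theorem.\<close>
  define a :: "real ^ 'n \<Rightarrow> complex" where "a k = (\<Prod>i\<in>UNIV. of_nat (N choose nat \<lfloor>k $ i\<rfloor>))" for k
  have inj: "inj_on \<kappa> P" by (auto simp: inj_on_def \<kappa>_def vec_eq_iff)
  show thesis
  proof
    show "finite (\<kappa> ` P)" unfolding P_def by (intro finite_imageI finite_PiE) auto
    show "\<kappa> ` P \<subseteq> int_vecs" by (auto simp: \<kappa>_def int_vecs_def)
    fix w :: "real ^ 'n"
    have pw: "wave s ^ j = wave (real j * s)" for s j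
      by (induction j) (auto simp: wave_add[symmetric] algebra_simps)
    have "bump w ^ N = (\<Prod>i\<in>UNIV. (wave (w $ i) + 1) ^ N)"
      by (simp add: bump_def prod_power_distrib add.commute)
    also have "\<dots> = (\<Prod>i\<in>UNIV. \<Sum>j\<le>N. of_nat (N choose j) * wave (real j * w $ i))"
      by (simp add: binomial_ring pw)
    also have "\<dots> = (\<Sum>p\<in>P. \<Prod>i\<in>UNIV. of_nat (N choose p i) * wave (real (p i) * w $ i))"
      unfolding P_def by (rule prod_sum_PiE) auto
    also have "\<dots> = (\<Sum>p\<in>P. a (\<kappa> p) * wave (\<kappa> p \<bullet> w))"
      by (simp add: a_def \<kappa>_def inner_vec_def wave_sum prod.distrib)
    also have "\<dots> = (\<Sum>k\<in>\<kappa> ` P. a k * wave (k \<bullet> w))"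
      using inj by (simp add: sum.reindex)
    finally show "bump w ^ N = (\<Sum>k\<in>\<kappa> ` P. a k * wave (k \<bullet> w))" .
  qed
qed

lemma continuous_on_bump: "continuous_on A (bump :: real ^ 'n::finite \<Rightarrow> complex)"
  unfolding bump_def by (intro continuous_intros)

text \<open>
  The closed cube without an open ball around the origin is compact and contains no integer vector.
\<close>

lemma norm_bump_away:
  assumes d: "d > 0"
  obtains m where "0 \<le> m" "m < 4 ^ CARD('n)"
    "\<And>w :: real ^ 'n::finite. w \<in> unit_cube \<Longrightarrow> d \<le> norm w \<Longrightarrow> (cmod (bump w))\<^sup>2 \<le> m"
proof -
  define K where "K = cbox (\<chi> i. -1/2) (\<chi> i. 1/2) \<inter> - ball (0 :: real ^ 'n) d"
  have K: "compact K" unfolding K_def by (intro compact_Int_closed) auto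
  have less: "(cmod (bump w))\<^sup>2 < 4 ^ CARD('n)" if "w \<in> K" for w
  proof -
    have "w \<noteq> 0" using that d by (auto simp: K_def)
    then obtain j where j: "w $ j \<noteq> 0" by (auto simp: vec_eq_iff)
    have half: "\<bar>w $ i\<bar> \<le> 1/2" for i
    proof -
      have "- 1 / 2 \<le> w $ i" "w $ i \<le> 1 / 2" using that by (simp_all add: K_def mem_box_cart)
      then show ?thesis by linarith
    qed
    have "(cmod (bump w))\<^sup>2 = (\<Prod>i\<in>UNIV. (cmod (1 + wave (w $ i)))\<^sup>2)"
      by (simp add: bump_def prod_norm[symmetric] prod_power_distrib)
    also have "\<dots> = (cmod (1 + wave (w $ j)))\<^sup>2 * (\<Prod>i\<in>UNIV - {j}. (cmod (1 + wave (w $ i)))\<^sup>2)"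
      by (rule prod.remove) auto
    also have "\<dots> \<le> (cmod (1 + wave (w $ j)))\<^sup>2 * 4 ^ card (UNIV - {j})"
      unfolding prod_constant[symmetric]
      by (intro mult_left_mono prod_mono) (auto simp: norm_1_plus_wave_sq_le)
    also have "\<dots> < 4 * 4 ^ card (UNIV - {j})"
      by (intro mult_strict_right_mono norm_1_plus_wave_sq_less j half) auto
    also have "\<dots> = 4 ^ CARD('n)"
      by (simp add: card_Diff_singleton power_Suc[symmetric] del: power_Suc)
    finally show ?thesis .
  qed
  have sub: "w \<in> K" if "w \<in> unit_cube" "d \<le> norm w" for w
    using that by (simp add: K_def unit_cube_def mem_box_cart less_imp_le)
  show thesis
  proof (cases "K = {}")
    case True
    then show ?thesis using that[of 0] sub by auto
  next
    case False
    have "continuous_on K (\<lambda>w. (cmod (bump w))\<^sup>2)"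
      by (intro continuous_intros continuous_on_bump)
    then obtain x where "x \<in> K" "\<And>w. w \<in> K \<Longrightarrow> (cmod (bump w))\<^sup>2 \<le> (cmod (bump x))\<^sup>2"
      using continuous_attains_sup[OF K False] by blast
    then show ?thesis using that[of "(cmod (bump x))\<^sup>2"] less sub by auto
  qed
qed

lemma bump_measurable [measurable]: "bump \<in> borel_measurable borel"
  by (intro borel_measurable_continuous_onI continuous_on_bump)

lemma bump_power_lower:
  assumes r: "0 \<le> r" "r < 4 ^ CARD('n::finite)"
  obtains v where "v > 0"
    "\<And>N. ennreal (v * r ^ N) \<le> (\<integral>\<^sup>+w. sq_mod (bump (w :: real ^ 'n) ^ N) * indicator unit_cube w \<partial>lborel)"
proof -
  have "isCont (\<lambda>w :: real ^ 'n. (cmod (bump w))\<^sup>2) 0"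
    using continuous_on_bump[of "UNIV :: (real ^ 'n) set"]
    by (intro continuous_intros) (simp add: continuous_on_eq_continuous_at)
  moreover have "r < (cmod (bump (0 :: real ^ 'n)))\<^sup>2"
    using r(2) by (simp add: bump_def norm_power power_mult[symmetric] power2_eq_square power_mult_distrib[symmetric])
  ultimately have "\<forall>\<^sub>F w in at 0. r < (cmod (bump (w :: real ^ 'n)))\<^sup>2"
    by (intro order_tendstoD) (auto simp: continuous_at)
  then obtain d where d: "d > 0" "\<And>w :: real ^ 'n. w \<noteq> 0 \<Longrightarrow> dist w 0 < d \<Longrightarrow> r < (cmod (bump w))\<^sup>2"
    by (auto simp: eventually_at)
  define U where "U = ball (0 :: real ^ 'n) (min d (1/2))"
  have U: "r \<le> (cmod (bump w))\<^sup>2" "w \<in> unit_cube" if "w \<in> U" for w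
  proof -
    show "r \<le> (cmod (bump w))\<^sup>2"
      using d(2)[of w] that \<open>r < (cmod (bump (0 :: real ^ 'n)))\<^sup>2\<close>
      by (cases "w = 0") (auto simp: U_def dist_commute)
    have "- 1 / 2 \<le> w $ i \<and> w $ i < 1 / 2" for i
    proof -
      have "\<bar>w $ i\<bar> < 1/2" using component_le_norm_cart[of w i] that by (auto simp: U_def)
      then show ?thesis by linarith
    qed
    then show "w \<in> unit_cube" by (simp add: unit_cube_def)
  qed
  have fin: "emeasure lborel U < \<infinity>" unfolding U_def by (rule emeasure_lborel_ball_finite)
  have pos: "0 < measure lborel U"
    using d content_ball_pos[of "min d (1/2)" "0 :: real ^ 'n"] by (simp add: U_def)
  show thesis
  proof
    show "0 < measure lborel U" by (rule pos)
    fix N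
    have "ennreal (measure lborel U * r ^ N) = ennreal (r ^ N) * emeasure lborel U"
      using fin r by (simp add: emeasure_eq_ennreal_measure less_top ennreal_mult mult.commute)
    also have "\<dots> = (\<integral>\<^sup>+w. ennreal (r ^ N) * indicator U w \<partial>lborel)"
      by (rule nn_integral_cmult_indicator[symmetric]) (simp add: U_def)
    also have "\<dots> \<le> (\<integral>\<^sup>+w. sq_mod (bump (w :: real ^ 'n) ^ N) * indicator unit_cube w \<partial>lborel)"
    proof (rule nn_integral_mono)
      fix w :: "real ^ 'n"
      have "r ^ N \<le> (cmod (bump w ^ N))\<^sup>2" if "w \<in> U"
        using power_mono[OF U(1)[OF that] r(1), of N] by (simp add: norm_power power_mult[symmetric] mult.commute)
      then show "ennreal (r ^ N) * indicator U w \<le> sq_mod (bump w ^ N) * indicator unit_cube w"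
        using U(2)[of w] by (auto simp: indicator_def intro: ennreal_leI)
    qed
    finally show "ennreal (measure lborel U * r ^ N) \<le> (\<integral>\<^sup>+w. sq_mod (bump (w :: real ^ 'n) ^ N) * indicator unit_cube w \<partial>lborel)" .
  qed
qed

text \<open>
  Take a high power of the bump.  Outside of the ball its squared modulus is at most \<open>m ^ N\<close>, while on
  a neighbourhood of the origin it is at least \<open>r ^ N\<close> for some \<open>r > m\<close>, and \<open>(m / r) ^ N\<close> tends to
  \<open>0\<close>.
\<close>

lemma concentrated_trig_polynomial:
  assumes d: "d > 0" and \<eta>: "\<eta> > 0"
  obtains S a where "finite S" "S \<subseteq> (int_vecs :: (real ^ 'n::finite) set)" "0 < coeff_energy S a"
    "trig_mass S a (unit_cube - ball 0 d)
       \<le> ennreal (\<eta> * coeff_energy S a)"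
proof -
  obtain m where m: "0 \<le> m" "m < 4 ^ CARD('n)"
    and away: "\<And>w :: real ^ 'n. w \<in> unit_cube \<Longrightarrow> d \<le> norm w \<Longrightarrow> (cmod (bump w))\<^sup>2 \<le> m"
    by (rule norm_bump_away[OF d, where 'n = 'n]) (rule that)
  obtain r where r: "m < r" "r < 4 ^ CARD('n)" using m(2) dense by metis
  have r0: "0 < r" using m r by linarith
  obtain v where v: "v > 0"
    "\<And>N. ennreal (v * r ^ N) \<le> (\<integral>\<^sup>+w. sq_mod (bump (w :: real ^ 'n) ^ N) * indicator unit_cube w \<partial>lborel)"
    by (rule bump_power_lower[OF less_imp_le[OF r0] r(2)]) (rule that)
  have "(\<lambda>N. (m / r) ^ N) \<longlonglongrightarrow> 0"
    using m r r0 by (intro LIMSEQ_realpow_zero) auto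
  then have "\<forall>\<^sub>F N in sequentially. (m / r) ^ N < \<eta> * v"
    using \<eta> v by (intro order_tendstoD) auto
  then obtain N where N: "(m / r) ^ N < \<eta> * v" by (auto simp: eventually_sequentially)
  obtain S a where S: "finite S" "S \<subseteq> (int_vecs :: (real ^ 'n) set)"
    and T: "\<And>w. bump w ^ N = (trig_poly S a w)"
    by (rule bump_power_trig_polynomial) (rule that)
  let ?s = "coeff_energy S a"
  have "ennreal (v * r ^ N) \<le> ennreal ?s"
    using v(2)[of N] unfolding T Parseval_unit_cube[OF S] .
  then have s: "v * r ^ N \<le> ?s"
    by (simp add: sum_nonneg)
  show thesis
  proof (rule that[OF S])
    have "0 < v * r ^ N" using v r0 by simp
    with s show "0 < ?s" by linarith
    have "(\<integral>\<^sup>+w. sq_mod (bump (w :: real ^ 'n) ^ N) * indicator (unit_cube - ball 0 d) w \<partial>lborel) \<le>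
      (\<integral>\<^sup>+w. ennreal (m ^ N) * indicator unit_cube (w :: real ^ 'n) \<partial>lborel)"
    proof (rule nn_integral_mono)
      fix w :: "real ^ 'n"
      have "(cmod (bump w ^ N))\<^sup>2 \<le> m ^ N" if "w \<in> unit_cube - ball 0 d"
        using power_mono[of "(cmod (bump w))\<^sup>2" m N] away[of w] that
        by (simp add: norm_power power_mult[symmetric] mult.commute)
      then show "sq_mod (bump w ^ N) * indicator (unit_cube - ball 0 d) w \<le> ennreal (m ^ N) * indicator unit_cube w"
        by (auto simp: indicator_def intro: ennreal_leI)
    qed
    also have "\<dots> = ennreal (m ^ N) * emeasure lborel (unit_cube :: (real ^ 'n) set)"
      by (rule nn_integral_cmult_indicator) simp
    also have "\<dots> \<le> ennreal (m ^ N) * 1"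
      by (intro mult_left_mono emeasure_unit_cube) auto
    also have "\<dots> \<le> ennreal (\<eta> * ?s)"
    proof -
      have "m ^ N \<le> \<eta> * v * r ^ N"
        using N r0 by (simp add: power_divide field_simps)
      also have "\<dots> \<le> \<eta> * ?s"
        using mult_left_mono[OF s, of \<eta>] \<eta> by (simp add: mult.assoc)
      finally show ?thesis by (simp add: ennreal_leI)
    qed
    finally show "trig_mass S a (unit_cube - ball 0 d)
       \<le> ennreal (\<eta> * ?s)"
      unfolding T .
  qed
qed

section \<open>Energy of the lattice coefficients\<close>

lemma finite_sums_bounded_count_space:
  fixes \<phi> :: "'i \<Rightarrow> real"
  assumes nn: "\<And>i. i \<in> I \<Longrightarrow> 0 \<le> \<phi> i"
    and fin: "\<And>F. finite F \<Longrightarrow> F \<subseteq> I \<Longrightarrow> sum \<phi> F \<le> b"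
  shows "\<phi> summable_on I" "infsum \<phi> I \<le> b"
    "(\<integral>\<^sup>+i. ennreal (\<phi> i) \<partial>count_space I) = ennreal (infsum \<phi> I)"
proof -
  show s: "\<phi> summable_on I"
    using assms by (intro nonneg_bdd_above_summable_on bdd_aboveI2[where M = b]) auto
  then show "infsum \<phi> I \<le> b" using fin by (rule infsum_le_finite_sums)
  have "(\<lambda>i. norm (\<phi> i)) summable_on I"
    using s nn by (auto cong: summable_on_cong)
  then have a: "Infinite_Set_Sum.abs_summable_on \<phi> I"
    by (simp only: abs_summable_equivalent)
  show "(\<integral>\<^sup>+i. ennreal (\<phi> i) \<partial>count_space I) = ennreal (infsum \<phi> I)"
    using nn_integral_conv_infsetsum[OF a] nn infsetsum_infsum[OF a] by simp
qed

lemma sum_le_nn_integral_count_space: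
  fixes \<phi> :: "'i \<Rightarrow> ennreal"
  assumes "finite F" "F \<subseteq> I"
  shows "(\<Sum>i\<in>F. \<phi> i) \<le> (\<integral>\<^sup>+i. \<phi> i \<partial>count_space I)"
proof -
  have "(\<Sum>i\<in>F. \<phi> i) = (\<integral>\<^sup>+i. \<phi> i \<partial>count_space F)"
    using assms by (simp add: nn_integral_count_space_finite)
  also have "\<dots> = (\<integral>\<^sup>+i. \<phi> i * indicator F i \<partial>count_space UNIV)"
    by (rule nn_integral_count_space_indicator) (simp add: NO_MATCH_def)
  also have "\<dots> \<le> (\<integral>\<^sup>+i. \<phi> i * indicator I i \<partial>count_space UNIV)"
    using assms by (intro nn_integral_mono) (auto simp: indicator_def)
  also have "\<dots> = (\<integral>\<^sup>+i. \<phi> i \<partial>count_space I)"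
    by (rule nn_integral_count_space_indicator[symmetric]) (simp add: NO_MATCH_def)
  finally show ?thesis .
qed

lemma stft_measurable:
  fixes f g :: "real ^ 'd::finite \<Rightarrow> complex"
  assumes [measurable]: "f \<in> borel_measurable borel" "g \<in> borel_measurable borel"
  shows "stft g f \<in> borel_measurable borel"
  unfolding stft_lborel[OF assms, abs_def] by measurable

lemma pos_add: "pos (a + b) = pos a + pos b" and freq_add: "freq (a + b) = freq a + freq b"
  and pos_minus: "pos (- a) = - pos a" and freq_minus: "freq (- a) = - freq a"
  by (simp_all add: pos_def freq_def vec_eq_iff)

text \<open>
  Continuity in the sampling point is thereby reduced to strong continuity of the shifts of the signal.
  The two sides differ by a phase before taking absolute values.
\<close>

lemma stft_covariance:
  fixes f g :: "real ^ 'd::finite \<Rightarrow> complex"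
  assumes [measurable]: "f \<in> borel_measurable borel" "g \<in> borel_measurable borel"
  shows "cmod (stft g f (u + y)) = cmod (stft g (tf_shift (- y) f) u)"
proof -
  let ?c = "wave (- ((freq u + freq y) \<bullet> pos y))"
  have "stft g f (u + y) = (LINT t|lborel. f t * (wave (- ((freq u + freq y) \<bullet> t)) * cnj (g (t - (pos u + pos y)))))"
    by (subst stft_lborel) (auto simp: pos_add freq_add)
  also have "\<dots> = (LINT t|lborel. f (t + pos y) * (wave (- ((freq u + freq y) \<bullet> (t + pos y))) * cnj (g (t + pos y - (pos u + pos y)))))"
    by (rule integral_lborel_translate[symmetric]) measurable
  also have "\<dots> = (LINT t|lborel. ?c * (tf_shift (- y) f t * (wave (- (freq u \<bullet> t)) * cnj (g (t - pos u)))))"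
  proof (intro Bochner_Integration.integral_cong refl)
    fix t
    have "wave (- ((freq u + freq y) \<bullet> (t + pos y))) = ?c * (wave (freq (- y) \<bullet> t) * wave (- (freq u \<bullet> t)))"
      unfolding wave_add[symmetric] by (simp add: inner_add_left inner_add_right freq_minus algebra_simps)
    then show "f (t + pos y) * (wave (- ((freq u + freq y) \<bullet> (t + pos y))) * cnj (g (t + pos y - (pos u + pos y)))) =
      ?c * (tf_shift (- y) f t * (wave (- (freq u \<bullet> t)) * cnj (g (t - pos u))))"
      by (simp add: tf_shift_wave pos_minus mult_ac)
  qed
  also have "\<dots> = ?c * (LINT t|lborel. tf_shift (- y) f t * (wave (- (freq u \<bullet> t)) * cnj (g (t - pos u))))"
    by simp
  also have "(LINT t|lborel. tf_shift (- y) f t * (wave (- (freq u \<bullet> t)) * cnj (g (t - pos u)))) = stft g (tf_shift (- y) f) u"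
    by (rule stft_lborel[symmetric]) measurable
  finally show ?thesis by (simp add: norm_mult)
qed

text \<open>
  The frame sum of \<open>f\<close>, as an extended real: it can be integrated over shifts of \<open>f\<close> before it is known
  to be finite.
\<close>

definition lattice_energy ::
  "real ^ ('d::finite + 'd) ^ ('d + 'd) \<Rightarrow> (real ^ 'd \<Rightarrow> complex) \<Rightarrow> (real ^ 'd \<Rightarrow> complex) \<Rightarrow> ennreal" where
  "lattice_energy L g f = (\<integral>\<^sup>+\<kappa>. sq_mod (stft g f (L *v \<kappa>)) \<partial>count_space int_vecs)"

abbreviation shift_energy ::
  "real ^ ('d::finite + 'd) ^ ('d + 'd) \<Rightarrow> (real ^ 'd \<Rightarrow> complex) \<Rightarrow> (real ^ 'd \<Rightarrow> complex) \<Rightarrow> real ^ ('d + 'd) \<Rightarrow> ennreal" where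
  "shift_energy L g f w \<equiv> lattice_energy L g (tf_shift (- (L *v w)) f)"

abbreviation "mean_shift_energy L g f S a \<equiv>
  ennreal \<bar>det L\<bar> * (\<integral>\<^sup>+w. sq_mod (trig_poly S a w) * shift_energy L g f w * indicator unit_cube w \<partial>lborel)"

definition dual_vec :: "real ^ 'n ^ 'n \<Rightarrow> real ^ 'n \<Rightarrow> real ^ 'n::finite" where
  "dual_vec L k = transpose (matrix_inv L) *v k"

lemma matrix_inv_mult:
  assumes "invertible A"
  shows "matrix_inv A ** A = mat 1"
  using someI_ex[OF assms[unfolded invertible_def]] by (simp add: matrix_inv_def)

lemma inner_dual_vec:
  assumes "invertible L"
  shows "dual_vec L k \<bullet> (L *v w) = k \<bullet> w"
proof -
  have "dual_vec L k \<bullet> (L *v w) = (k v* matrix_inv L) \<bullet> (L *v w)"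
    by (simp add: dual_vec_def)
  also have "\<dots> = k \<bullet> (matrix_inv L *v (L *v w))"
    by (rule dot_lmul_matrix)
  also have "\<dots> = k \<bullet> w"
    using assms by (simp add: matrix_vector_mul_assoc matrix_inv_mult)
  finally show ?thesis .
qed

lemma dual_vec_diff: "dual_vec L k - dual_vec L l = dual_vec L (k - l)"
  by (simp add: dual_vec_def matrix_vector_mult_diff_distrib)

text \<open>
  Fold phase space onto one cell of the lattice.  The trigonometric polynomial takes the same values in
  all cells, and the values of the squared transform add up to the frame sum of a shifted signal.
\<close>

lemma stft_periodization:
  fixes f g :: "real ^ 'd::finite \<Rightarrow> complex"
  assumes fm[measurable]: "f \<in> borel_measurable borel" and gm[measurable]: "g \<in> borel_measurable borel"
    and L: "invertible L" and S: "S \<subseteq> int_vecs"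
  shows "(\<integral>\<^sup>+z. sq_mod ((\<Sum>k\<in>S. a k * wave (dual_vec L k \<bullet> z)) * stft g f z) \<partial>lborel) =
    mean_shift_energy L g f S a"
proof -
  note [measurable] = stft_measurable[OF fm gm]
  let ?T = "\<lambda>w. trig_poly S a w"
  have periodic: "?T (w + \<kappa>) = ?T w" if "\<kappa> \<in> int_vecs" for w \<kappa>
  proof (rule sum.cong)
    fix k assume "k \<in> S"
    then have "k \<bullet> \<kappa> \<in> \<int>"
      using that S by (auto simp: inner_vec_def int_vecs_def intro!: Ints_sum Ints_mult)
    then show "a k * wave (k \<bullet> (w + \<kappa>)) = a k * wave (k \<bullet> w)"
      by (simp add: inner_add_right wave_add wave_int)
  qed simp
  have "(\<integral>\<^sup>+z. sq_mod ((\<Sum>k\<in>S. a k * wave (dual_vec L k \<bullet> z)) * stft g f z) \<partial>lborel) =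
     ennreal \<bar>det L\<bar> * (\<integral>\<^sup>+w. sq_mod ((\<Sum>k\<in>S. a k * wave (dual_vec L k \<bullet> (L *v w))) * stft g f (L *v w)) \<partial>lborel)"
    using L by (intro nn_integral_lborel_linear) (auto simp: invertible_det_nz)
  also have "(\<integral>\<^sup>+w. sq_mod ((\<Sum>k\<in>S. a k * wave (dual_vec L k \<bullet> (L *v w))) * stft g f (L *v w)) \<partial>lborel) =
     (\<integral>\<^sup>+w. sq_mod (?T w * stft g f (L *v w)) \<partial>lborel)"
    by (simp only: inner_dual_vec[OF L])
  also have "\<dots> = (\<integral>\<^sup>+w. (\<integral>\<^sup>+\<kappa>. sq_mod (?T (w + \<kappa>) * stft g f (L *v (w + \<kappa>))) \<partial>count_space int_vecs) * indicator unit_cube w \<partial>lborel)"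
    by (rule nn_integral_lborel_periodize) measurable
  also have "\<dots> = (\<integral>\<^sup>+w. sq_mod (?T w) * shift_energy L g f w * indicator unit_cube w \<partial>lborel)"
  proof (intro nn_integral_cong arg_cong2[where f = "(*)"] refl)
    fix w
    have "(\<integral>\<^sup>+\<kappa>. sq_mod (?T (w + \<kappa>) * stft g f (L *v (w + \<kappa>))) \<partial>count_space int_vecs) =
      (\<integral>\<^sup>+\<kappa>. sq_mod (?T w) * sq_mod (stft g (tf_shift (- (L *v w)) f) (L *v \<kappa>)) \<partial>count_space int_vecs)"
    proof (rule nn_integral_cong)
      fix \<kappa> :: "real ^ ('d + 'd)" assume "\<kappa> \<in> space (count_space int_vecs)"
      then have k: "\<kappa> \<in> int_vecs" by simp
      have "cmod (stft g f (L *v (w + \<kappa>))) = cmod (stft g (tf_shift (- (L *v w)) f) (L *v \<kappa>))"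
        using stft_covariance[OF fm gm, of "L *v \<kappa>" "L *v w"] by (simp add: matrix_vector_right_distrib add.commute)
      then show "sq_mod (?T (w + \<kappa>) * stft g f (L *v (w + \<kappa>))) =
         sq_mod (?T w) * sq_mod (stft g (tf_shift (- (L *v w)) f) (L *v \<kappa>))"
        by (simp only: periodic[OF k] norm_mult power_mult_distrib ennreal_mult zero_le_power2)
    qed
    also have "\<dots> = sq_mod (?T w) * shift_energy L g f w"
      unfolding lattice_energy_def by (rule nn_integral_cmult) simp
    finally show "(\<integral>\<^sup>+\<kappa>. sq_mod (?T (w + \<kappa>) * stft g f (L *v (w + \<kappa>))) \<partial>count_space int_vecs) =
      sq_mod (?T w) * shift_energy L g f w" .
  qed
  finally show ?thesis .
qed

text \<open>
  Fold the integral of \<open>stft_quadratic_bound\<close> for the frequencies \<open>L\<^sup>-\<^sup>T k\<close>.  Differences of distinct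
  frequencies are nonzero points of the same lattice, so every row sum is a partial sum of the series
  that \<open>\<rho>\<close> bounds.
\<close>

lemma weighted_lattice_energy:
  fixes f g :: "real ^ 'd::finite \<Rightarrow> complex"
  assumes f: "sq_integrable f" and g: "sq_integrable g" and L: "invertible L"
    and \<rho>: "\<And>F. finite F \<Longrightarrow> F \<subseteq> int_vecs - {0} \<Longrightarrow> (\<Sum>\<kappa>\<in>F. cmod (stft g g (symp_J *v dual_vec L \<kappa>))) \<le> \<rho>"
    and S: "finite S" "S \<subseteq> int_vecs"
  obtains r where
    "mean_shift_energy L g f S a = ennreal r"
    "0 \<le> r"
    "energy f * (energy g - \<rho>) * coeff_energy S a \<le> r"
    "r \<le> energy f * (energy g + \<rho>) * coeff_energy S a"
proof -
  have bound: "(\<Sum>l\<in>S - {k}. cmod (stft g g (symp_J *v (dual_vec L k - dual_vec L l)))) \<le> \<rho>" if k: "k \<in> S" for k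
  proof -
    have "(\<Sum>l\<in>S - {k}. cmod (stft g g (symp_J *v (dual_vec L k - dual_vec L l)))) =
      (\<Sum>\<kappa>\<in>(\<lambda>l. k - l) ` (S - {k}). cmod (stft g g (symp_J *v dual_vec L \<kappa>)))"
      by (subst sum.reindex) (auto simp: dual_vec_diff inj_on_def)
    also have "\<dots> \<le> \<rho>"
    proof (rule \<rho>)
      have "k - l \<in> int_vecs" if "l \<in> S" for l
        using that k S(2) by (auto simp: int_vecs_def subset_eq intro: Ints_diff)
      then show "(\<lambda>l. k - l) ` (S - {k}) \<subseteq> int_vecs - {0}" by auto
    qed (use S in auto)
    finally show ?thesis .
  qed
  obtain r where r: "(\<integral>\<^sup>+z. sq_mod ((\<Sum>k\<in>S. a k * wave (dual_vec L k \<bullet> z)) * stft g f z) \<partial>lborel) = ennreal r"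
    "0 \<le> r" "\<bar>r - energy f * energy g * coeff_energy S a\<bar> \<le> energy f * \<rho> * coeff_energy S a"
    by (rule stft_quadratic_bound[OF f g S(1), of "dual_vec L" \<rho> a, OF bound]) (assumption | rule that)+
  show thesis
  proof (rule that[of r])
    show "mean_shift_energy L g f S a = ennreal r"
      using stft_periodization[OF sq_integrable_measurable[OF f] sq_integrable_measurable[OF g] L S(2), of a] r(1) by simp
  qed (use r in \<open>auto simp: algebra_simps abs_le_iff\<close>)
qed

lemma concentrated_trig_polynomial_split:
  assumes d: "d > 0" and \<eta>: "\<eta> > 0"
  obtains S a x y where "finite S" "S \<subseteq> (int_vecs :: (real ^ 'n::finite) set)"
    "trig_mass S a (unit_cube \<inter> ball 0 d) = ennreal x"
    "trig_mass S a (unit_cube - ball 0 d) = ennreal y"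
    "0 \<le> x" "0 \<le> y" "x + y = coeff_energy S a" "0 < x + y" "y \<le> \<eta> * (x + y)"
proof -
  obtain S a where S: "finite S" "S \<subseteq> (int_vecs :: (real ^ 'n::finite) set)" and s: "0 < coeff_energy S a"
    and far: "trig_mass S a (unit_cube - ball 0 d)
       \<le> ennreal (\<eta> * coeff_energy S a)"
    by (rule concentrated_trig_polynomial[OF d \<eta>]) (rule that)
  let ?T = "\<lambda>w. sq_mod (trig_poly S a w)"
  let ?X = "\<integral>\<^sup>+w. ?T w * indicator (unit_cube \<inter> ball 0 d) w \<partial>lborel"
  let ?Y = "\<integral>\<^sup>+w. ?T w * indicator (unit_cube - ball 0 d) w \<partial>lborel"
  have [measurable]: "ball (0 :: real ^ 'n) d \<in> sets borel" by simp
  have "?X + ?Y = (\<integral>\<^sup>+w. ?T w * indicator (unit_cube \<inter> ball 0 d) w + ?T w * indicator (unit_cube - ball 0 d) w \<partial>lborel)"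
    by (rule nn_integral_add[symmetric]) measurable
  also have "\<dots> = (\<integral>\<^sup>+w. ?T w * indicator unit_cube w \<partial>lborel)"
    by (intro nn_integral_cong) (auto simp: indicator_def)
  also have "\<dots> = ennreal (coeff_energy S a)"
    by (rule Parseval_unit_cube[OF S])
  finally have XY: "?X + ?Y = ennreal (coeff_energy S a)" .
  then have "?X + ?Y \<noteq> top" by (simp only: ennreal_neq_top not_False_eq_True)
  then have fin: "?X < top" "?Y < top"
    by (simp_all only: ennreal_add_eq_top de_Morgan_disj less_top)
  define x where "x = enn2real ?X"
  define y where "y = enn2real ?Y"
  have x: "?X = ennreal x" "0 \<le> x" and y: "?Y = ennreal y" "0 \<le> y"
    unfolding x_def y_def by (rule ennreal_enn2real[OF fin(1), symmetric] ennreal_enn2real[OF fin(2), symmetric] enn2real_nonneg)+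
  have xy: "x + y = coeff_energy S a"
    using XY x y s by (simp flip: ennreal_plus)
  have "y \<le> \<eta> * (x + y)"
    using far \<eta> s unfolding y(1) xy[symmetric] by simp
  then show thesis
    using that[OF S x(1) y(1) x(2) y(2) xy] s xy by simp
qed

lemma stft_diff:
  assumes f: "sq_integrable f" and h: "sq_integrable h" and g: "sq_integrable g"
  shows "stft g (\<lambda>t. f t - h t) z = stft g f z - stft g h z"
proof -
  note [measurable] = sq_integrable_measurable[OF f] sq_integrable_measurable[OF h] sq_integrable_measurable[OF g]
  have "integrable lborel (\<lambda>t. f t * cnj (tf_shift z g t))" "integrable lborel (\<lambda>t. h t * cnj (tf_shift z g t))"
    by (intro sq_integrable_mult_integrable sq_integrable_cnj sq_integrable_tf_shift f g h)+
  then show ?thesis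
    unfolding stft_def by (simp add: inner_L2_lborel left_diff_distrib)
qed

lemma norm_stft_sq_le:
  assumes f: "sq_integrable f" and g: "sq_integrable g"
  shows "(cmod (stft g f z))\<^sup>2 \<le> energy f * energy g"
proof -
  note [measurable] = sq_integrable_measurable[OF f] sq_integrable_measurable[OF g]
  show ?thesis
    using Cauchy_Schwarz_integral[OF f sq_integrable_tf_shift(1)[OF g, of z]]
    by (simp add: stft_def inner_L2_lborel sq_integrable_tf_shift(2)[OF g])
qed

lemma energy_lattice_shift_tendsto_0:
  fixes f :: "real ^ 'd::finite \<Rightarrow> complex"
  assumes f: "sq_integrable f"
  shows "((\<lambda>w. energy (\<lambda>t. tf_shift (- (L *v w)) f t - f t)) \<longlongrightarrow> 0) (at 0)"
proof -
  have "((\<lambda>w. - (L *v w)) \<longlongrightarrow> - (L *v 0)) (at 0)"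
    by (intro tendsto_minus linear_lim_0[THEN tendsto_eq_rhs]) (auto simp: matrix_vector_mul_linear linear_linear)
  then have "((\<lambda>w. - (L *v w)) \<longlongrightarrow> 0) (at 0)" by simp
  from isCont_tendsto_compose[OF isCont_energy_tf_shift_diff[OF f] this]
  show ?thesis by (simp add: tf_shift_wave)
qed

lemma stft_shift_tendsto:
  fixes f g :: "real ^ 'd::finite \<Rightarrow> complex"
  assumes f: "sq_integrable f" and g: "sq_integrable g"
  shows "((\<lambda>w. stft g (tf_shift (- (L *v w)) f) z) \<longlongrightarrow> stft g f z) (at 0)"
proof -
  let ?D = "\<lambda>w. energy (\<lambda>t. tf_shift (- (L *v w)) f t - f t)"
  have lim: "((\<lambda>w. sqrt (?D w * energy g)) \<longlongrightarrow> 0) (at 0)"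
    using energy_lattice_shift_tendsto_0[OF f, of L] by (auto intro!: tendsto_eq_intros)
  have "norm (stft g (tf_shift (- (L *v w)) f) z - stft g f z) \<le> sqrt (?D w * energy g)" for w
    using norm_stft_sq_le[OF sq_integrable_diff(1)[OF sq_integrable_tf_shift(1)[OF f] f] g, of "- (L *v w)" z]
    unfolding stft_diff[OF sq_integrable_tf_shift(1)[OF f] f g] by (rule real_le_rsqrt)
  then have "((\<lambda>w. stft g (tf_shift (- (L *v w)) f) z - stft g f z) \<longlongrightarrow> 0) (at 0)"
    by (intro Lim_null_comparison[OF always_eventually lim]) auto
  then show ?thesis by (simp add: LIM_zero_iff)
qed

text \<open>
  If a partial sum exceeded the bound, then by continuity so would the partial sums for all small
  shifts of \<open>f\<close>.  A weight concentrated on these shifts contradicts the bound on average.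
\<close>

lemma lattice_energy_finite_sum_le:
  fixes f g :: "real ^ 'd::finite \<Rightarrow> complex"
  assumes f: "sq_integrable f" and g: "sq_integrable g" and L: "invertible L"
    and \<rho>: "\<And>F. finite F \<Longrightarrow> F \<subseteq> int_vecs - {0} \<Longrightarrow> (\<Sum>\<kappa>\<in>F. cmod (stft g g (symp_J *v dual_vec L \<kappa>))) \<le> \<rho>"
    and F: "finite F" "F \<subseteq> int_vecs"
  shows "(\<Sum>\<kappa>\<in>F. (cmod (stft g f (L *v \<kappa>)))\<^sup>2) \<le> (energy g + \<rho>) / \<bar>det L\<bar> * energy f"
proof (rule ccontr)
  define b where "b = (energy g + \<rho>) / \<bar>det L\<bar> * energy f"
  let ?s = "\<lambda>f. \<Sum>\<kappa>\<in>F. (cmod (stft g f (L *v \<kappa>)))\<^sup>2"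
  assume "\<not> ?s f \<le> (energy g + \<rho>) / \<bar>det L\<bar> * energy f"
  then have less: "b < ?s f" by (simp add: b_def)
  have \<rho>0: "\<rho> \<ge> 0" using \<rho>[of "{}"] by simp
  have det: "\<bar>det L\<bar> > 0" using L by (simp add: invertible_det_nz)
  have b0: "b \<ge> 0" unfolding b_def using \<rho>0 energy_nonneg by (intro mult_nonneg_nonneg divide_nonneg_nonneg) (auto intro: add_nonneg_nonneg)
  define c where "c = (?s f + b) / 2"
  have c: "b < c" "c < ?s f" "0 < c" using less b0 by (auto simp: c_def)
  have "((\<lambda>w. ?s (tf_shift (- (L *v w)) f)) \<longlongrightarrow> ?s f) (at 0)"
    by (intro tendsto_intros stft_shift_tendsto f g)
  then have "\<forall>\<^sub>F w in at 0. c < ?s (tf_shift (- (L *v w)) f)"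
    using c(2) by (rule order_tendstoD)
  then obtain d where d: "d > 0" "\<And>w. w \<noteq> 0 \<Longrightarrow> dist w 0 < d \<Longrightarrow> c < ?s (tf_shift (- (L *v w)) f)"
    by (auto simp: eventually_at)
  have near: "ennreal c \<le> shift_energy L g f w" if "norm w < d" for w
  proof -
    have "tf_shift (- (L *v 0)) f = f" by (rule ext) (simp add: tf_shift_wave)
    then have "c \<le> ?s (tf_shift (- (L *v w)) f)"
      using d(2)[of w] that c(2) by (cases "w = 0") auto
    then have "ennreal c \<le> (\<Sum>\<kappa>\<in>F. sq_mod (stft g (tf_shift (- (L *v w)) f) (L *v \<kappa>)))"
      by (simp add: sum_ennreal ennreal_leI)
    also have "\<dots> \<le> shift_energy L g f w"
      unfolding lattice_energy_def by (rule sum_le_nn_integral_count_space[OF F])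
    finally show ?thesis .
  qed
  have [measurable]: "ball (0 :: real ^ ('d + 'd)) d \<in> sets borel" by simp
  \<comment> \<open>Then \<open>c (1 - \<eta>) = (c + b) / 2\<close> still exceeds \<open>b\<close>.\<close>
  define \<eta> where "\<eta> = (c - b) / (2 * c)"
  have \<eta>: "\<eta> > 0" using c by (simp add: \<eta>_def)
  obtain S a x y where S: "finite S" "S \<subseteq> (int_vecs :: (real ^ ('d + 'd)) set)"
    and x: "trig_mass S a (unit_cube \<inter> ball 0 d) = ennreal x"
    and xy: "0 \<le> x" "0 \<le> y" "x + y = coeff_energy S a" "0 < x + y" "y \<le> \<eta> * (x + y)"
    by (rule concentrated_trig_polynomial_split[OF d(1) \<eta>]) (rule that)
  let ?T = "\<lambda>w. sq_mod (trig_poly S a w)"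
  obtain r where r: "mean_shift_energy L g f S a = ennreal r"
    "0 \<le> r" "energy f * (energy g - \<rho>) * coeff_energy S a \<le> r"
    "r \<le> energy f * (energy g + \<rho>) * coeff_energy S a"
    by (rule weighted_lattice_energy[OF f g L \<rho> S]) (assumption | rule that)+
  have "ennreal (\<bar>det L\<bar> * (c * x)) = ennreal \<bar>det L\<bar> * (ennreal c * (\<integral>\<^sup>+w. ?T w * indicator (unit_cube \<inter> ball 0 d) w \<partial>lborel))"
    unfolding x using c xy by (simp add: ennreal_mult)
  also have "\<dots> = ennreal \<bar>det L\<bar> * (\<integral>\<^sup>+w. ennreal c * (?T w * indicator (unit_cube \<inter> ball 0 d) w) \<partial>lborel)"
    by (subst nn_integral_cmult) auto
  also have "\<dots> \<le> mean_shift_energy L g f S a"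
  proof (intro mult_left_mono nn_integral_mono)
    fix w
    show "ennreal c * (?T w * indicator (unit_cube \<inter> ball 0 d) w) \<le>
      ?T w * shift_energy L g f w * indicator unit_cube w"
    proof (cases "w \<in> unit_cube \<inter> ball 0 d")
      case True
      then have "?T w * ennreal c \<le> ?T w * shift_energy L g f w"
        by (intro mult_left_mono near) auto
      with True show ?thesis by (simp add: mult.commute)
    qed simp
  qed simp
  also have "\<dots> = ennreal r" by (rule r)
  finally have "\<bar>det L\<bar> * (c * x) \<le> r" using r(2) by simp
  also have "r \<le> \<bar>det L\<bar> * (b * (x + y))"
  proof -
    have "\<bar>det L\<bar> * (b * (x + y)) = energy f * (energy g + \<rho>) * (x + y)"
      using det by (simp add: b_def)
    then show ?thesis using r(4) by (simp only: xy(3))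
  qed
  finally have "c * x \<le> b * (x + y)" using det by simp
  moreover have "c * ((x + y) - \<eta> * (x + y)) \<le> c * x"
    using xy(5) c(3) by (intro mult_left_mono) auto
  moreover have "c * ((x + y) - \<eta> * (x + y)) = (c + b) / 2 * (x + y)"
    using c(3) by (simp add: \<eta>_def field_simps)
  ultimately have "(c + b) / 2 * (x + y) \<le> b * (x + y)" by linarith
  then have "(c + b) / 2 \<le> b" using xy(4) by (simp add: mult_le_cancel_right)
  then show False using c(1) by simp
qed

lemma lattice_energy_le:
  fixes f g :: "real ^ 'd::finite \<Rightarrow> complex"
  assumes f: "sq_integrable f" and g: "sq_integrable g" and L: "invertible L"
    and \<rho>: "\<And>F. finite F \<Longrightarrow> F \<subseteq> int_vecs - {0} \<Longrightarrow> (\<Sum>\<kappa>\<in>F. cmod (stft g g (symp_J *v dual_vec L \<kappa>))) \<le> \<rho>"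
  shows "(\<lambda>\<kappa>. (cmod (stft g f (L *v \<kappa>)))\<^sup>2) summable_on int_vecs"
    "(\<Sum>\<^sub>\<infinity>\<kappa>\<in>int_vecs. (cmod (stft g f (L *v \<kappa>)))\<^sup>2) \<le> (energy g + \<rho>) / \<bar>det L\<bar> * energy f"
    "lattice_energy L g f = ennreal (\<Sum>\<^sub>\<infinity>\<kappa>\<in>int_vecs. (cmod (stft g f (L *v \<kappa>)))\<^sup>2)"
proof -
  have nn: "0 \<le> (cmod (stft g f (L *v \<kappa>)))\<^sup>2" for \<kappa> by simp
  have fin: "(\<Sum>\<kappa>\<in>F. (cmod (stft g f (L *v \<kappa>)))\<^sup>2) \<le> (energy g + \<rho>) / \<bar>det L\<bar> * energy f"
    if "finite F" "F \<subseteq> int_vecs" for F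
    by (rule lattice_energy_finite_sum_le[OF f g L \<rho> that])
  note bounded = finite_sums_bounded_count_space[of int_vecs "\<lambda>\<kappa>. (cmod (stft g f (L *v \<kappa>)))\<^sup>2", OF nn fin]
  show "(\<lambda>\<kappa>. (cmod (stft g f (L *v \<kappa>)))\<^sup>2) summable_on int_vecs"
    by (rule bounded(1))
  show "(\<Sum>\<^sub>\<infinity>\<kappa>\<in>int_vecs. (cmod (stft g f (L *v \<kappa>)))\<^sup>2) \<le> (energy g + \<rho>) / \<bar>det L\<bar> * energy f"
    by (rule bounded(2))
  show "lattice_energy L g f = ennreal (\<Sum>\<^sub>\<infinity>\<kappa>\<in>int_vecs. (cmod (stft g f (L *v \<kappa>)))\<^sup>2)"
    unfolding lattice_energy_def by (rule bounded(3))
qed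

text \<open>
  Small \<open>\<theta>\<close> keeps the factor in front of \<open>b\<close> close to \<open>1\<close>; the large factor falls on a difference that
  can be made small.
\<close>

lemma norm_sq_le_eps:
  fixes a b :: complex
  assumes "\<theta> > 0"
  shows "(cmod a)\<^sup>2 \<le> (1 + \<theta>) * (cmod b)\<^sup>2 + (1 + 1 / \<theta>) * (cmod (a - b))\<^sup>2"
proof -
  have "cmod a \<le> cmod b + cmod (a - b)"
    using norm_triangle_ineq[of b "a - b"] by simp
  then have "(cmod a)\<^sup>2 \<le> (cmod b + cmod (a - b))\<^sup>2"
    by (intro power_mono) auto
  also have "\<dots> \<le> (1 + \<theta>) * (cmod b)\<^sup>2 + (1 + 1 / \<theta>) * (cmod (a - b))\<^sup>2"
  proof -
    have "2 * (cmod b * cmod (a - b)) \<le> \<theta> * (cmod b)\<^sup>2 + 1 / \<theta> * (cmod (a - b))\<^sup>2"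
      using sum_squares_bound[of "sqrt \<theta> * cmod b" "cmod (a - b) / sqrt \<theta>"] assms
      by (simp add: power_mult_distrib power_divide)
    then show ?thesis by (simp add: power2_sum algebra_simps)
  qed
  finally show ?thesis .
qed

lemma lattice_energy_diff:
  fixes f g h :: "real ^ 'd::finite \<Rightarrow> complex"
  assumes f: "sq_integrable f" and h: "sq_integrable h" and g: "sq_integrable g" and \<theta>: "\<theta> > 0"
  shows "lattice_energy L g h \<le> ennreal (1 + \<theta>) * lattice_energy L g f + ennreal (1 + 1 / \<theta>) * lattice_energy L g (\<lambda>t. h t - f t)"
proof -
  have "lattice_energy L g h \<le> (\<integral>\<^sup>+\<kappa>. ennreal (1 + \<theta>) * sq_mod (stft g f (L *v \<kappa>)) +
     ennreal (1 + 1 / \<theta>) * sq_mod (stft g (\<lambda>t. h t - f t) (L *v \<kappa>)) \<partial>count_space int_vecs)"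
    unfolding lattice_energy_def
  proof (rule nn_integral_mono)
    fix \<kappa> :: "real ^ ('d + 'd)"
    let ?u = "(cmod (stft g f (L *v \<kappa>)))\<^sup>2" and ?v = "(cmod (stft g (\<lambda>t. h t - f t) (L *v \<kappa>)))\<^sup>2"
    have "(cmod (stft g h (L *v \<kappa>)))\<^sup>2 \<le> (1 + \<theta>) * ?u + (1 + 1 / \<theta>) * ?v"
      unfolding stft_diff[OF h f g] by (rule norm_sq_le_eps[OF \<theta>])
    then have "sq_mod (stft g h (L *v \<kappa>)) \<le> ennreal ((1 + \<theta>) * ?u + (1 + 1 / \<theta>) * ?v)"
      by (rule ennreal_leI)
    also have "\<dots> = ennreal (1 + \<theta>) * ennreal ?u + ennreal (1 + 1 / \<theta>) * ennreal ?v"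
      using \<theta> by (simp add: ennreal_plus ennreal_mult)
    finally show "sq_mod (stft g h (L *v \<kappa>)) \<le> ennreal (1 + \<theta>) * ennreal ?u + ennreal (1 + 1 / \<theta>) * ennreal ?v" .
  qed
  also have "\<dots> = ennreal (1 + \<theta>) * lattice_energy L g f + ennreal (1 + 1 / \<theta>) * lattice_energy L g (\<lambda>t. h t - f t)"
    unfolding lattice_energy_def by (simp add: nn_integral_add nn_integral_cmult)
  finally show ?thesis .
qed

lemma ennreal_sum_of_products:
  "0 \<le> a \<Longrightarrow> 0 \<le> b \<Longrightarrow> 0 \<le> c \<Longrightarrow> 0 \<le> d \<Longrightarrow>
    ennreal a * ennreal b + ennreal c * ennreal d = ennreal (a * b + c * d)"
  by (simp add: ennreal_plus ennreal_mult)

text \<open>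
  The upper bound, applied to the difference of \<open>f\<close> and a small shift of it, shows that the frame sums
  of small shifts hardly exceed that of \<open>f\<close>.  If the latter were too small, then a weight concentrated
  on small shifts would contradict the bound on average; the far shifts, where only the upper
  bound is available, carry little mass.
\<close>

lemma lattice_energy_ge:
  fixes f g :: "real ^ 'd::finite \<Rightarrow> complex"
  assumes f: "sq_integrable f" and g: "sq_integrable g" and L: "invertible L"
    and \<rho>: "\<And>F. finite F \<Longrightarrow> F \<subseteq> int_vecs - {0} \<Longrightarrow> (\<Sum>\<kappa>\<in>F. cmod (stft g g (symp_J *v dual_vec L \<kappa>))) \<le> \<rho>"
  shows "(energy g - \<rho>) / \<bar>det L\<bar> * energy f \<le> (\<Sum>\<^sub>\<infinity>\<kappa>\<in>int_vecs. (cmod (stft g f (L *v \<kappa>)))\<^sup>2)"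
proof (rule ccontr)
  define M where "M = (\<Sum>\<^sub>\<infinity>\<kappa>\<in>int_vecs. (cmod (stft g f (L *v \<kappa>)))\<^sup>2)"
  define a0 where "a0 = (energy g - \<rho>) / \<bar>det L\<bar> * energy f"
  define B where "B = (energy g + \<rho>) / \<bar>det L\<bar>"
  assume "\<not> (energy g - \<rho>) / \<bar>det L\<bar> * energy f \<le> (\<Sum>\<^sub>\<infinity>\<kappa>\<in>int_vecs. (cmod (stft g f (L *v \<kappa>)))\<^sup>2)"
  then have less: "M < a0" by (simp add: M_def a0_def)
  have \<rho>0: "\<rho> \<ge> 0" using \<rho>[of "{}"] by simp
  have det: "\<bar>det L\<bar> > 0" using L by (simp add: invertible_det_nz)
  have B0: "B \<ge> 0" unfolding B_def using \<rho>0 energy_nonneg[of g] by simp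
  have M0: "M \<ge> 0" unfolding M_def by (intro infsum_nonneg) simp
  have upper: "lattice_energy L g h \<le> ennreal (B * energy h)" if "sq_integrable h" for h
    using lattice_energy_le[OF that g L \<rho>] by (simp add: B_def ennreal_leI)
  have Mf: "lattice_energy L g f = ennreal M"
    unfolding M_def by (rule lattice_energy_le[OF f g L \<rho>])
  \<comment> \<open>The factor \<open>1 + \<theta>\<close>, the shift of \<open>f\<close> and the far mass each cost at most \<open>e\<close>, and \<open>M + 3 e < a0\<close>.\<close>
  define e where "e = (a0 - M) / 4"
  define \<theta> where "\<theta> = e / (M + 1)"
  have e: "e > 0" using less by (simp add: e_def)
  have \<theta>: "\<theta> > 0" "\<theta> * M \<le> e" using e M0 by (auto simp: \<theta>_def field_simps add_nonneg_pos)
  define C where "C = (1 + 1 / \<theta>) * B"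
  let ?D = "\<lambda>w. energy (\<lambda>t. tf_shift (- (L *v w)) f t - f t)"
  have "((\<lambda>w. C * ?D w) \<longlongrightarrow> 0) (at 0)"
    using energy_lattice_shift_tendsto_0[OF f, of L] by (auto intro!: tendsto_eq_intros)
  then have "\<forall>\<^sub>F w in at 0. C * ?D w < e"
    using e by (rule order_tendstoD)
  then obtain d where d: "d > 0" "\<And>w. w \<noteq> 0 \<Longrightarrow> dist w 0 < d \<Longrightarrow> C * ?D w < e"
    by (auto simp: eventually_at)
  have near: "shift_energy L g f w \<le> ennreal (M + 2 * e)" if "norm w < d" for w
  proof -
    note s = sq_integrable_tf_shift(1)[OF f, of "- (L *v w)"]
    have De: "C * ?D w \<le> e"
      using d(2)[of w] that e by (cases "w = 0") (auto simp: tf_shift_wave)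
    have "shift_energy L g f w \<le>
       ennreal (1 + \<theta>) * lattice_energy L g f + ennreal (1 + 1 / \<theta>) * lattice_energy L g (\<lambda>t. tf_shift (- (L *v w)) f t - f t)"
      by (rule lattice_energy_diff[OF f s g \<theta>(1)])
    also have "\<dots> \<le> ennreal (1 + \<theta>) * ennreal M + ennreal (1 + 1 / \<theta>) * ennreal (B * ?D w)"
      unfolding Mf by (intro add_left_mono mult_left_mono upper sq_integrable_diff s f) simp
    also have "\<dots> = ennreal ((1 + \<theta>) * M + (1 + 1 / \<theta>) * (B * ?D w))"
      using \<theta> M0 B0 energy_nonneg by (intro ennreal_sum_of_products mult_nonneg_nonneg) auto
    also have "\<dots> \<le> ennreal (M + 2 * e)"
      using \<theta>(2) De by (intro ennreal_leI) (simp add: C_def algebra_simps)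
    finally show ?thesis .
  qed
  have far: "shift_energy L g f w \<le> ennreal (B * energy f)" for w
    using upper[OF sq_integrable_tf_shift(1)[OF f]] by (simp add: sq_integrable_tf_shift(2)[OF f])
  have b0: "B * energy f \<ge> 0" by (intro mult_nonneg_nonneg B0 energy_nonneg)
  have [measurable]: "ball (0 :: real ^ ('d + 'd)) d \<in> sets borel" by simp
  define \<eta> where "\<eta> = e / (B * energy f + 1)"
  have "K * (e / (K + 1)) \<le> e" if "K \<ge> 0" for K
    using that e by (simp add: divide_simps)
  from this[OF b0] have \<eta>: "\<eta> > 0" "B * energy f * \<eta> \<le> e"
    using e b0 unfolding \<eta>_def by (auto intro!: divide_pos_pos add_nonneg_pos)
  obtain S a x y where S: "finite S" "S \<subseteq> (int_vecs :: (real ^ ('d + 'd)) set)"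
    and x: "trig_mass S a (unit_cube \<inter> ball 0 d) = ennreal x"
    and y: "trig_mass S a (unit_cube - ball 0 d) = ennreal y"
    and xy: "0 \<le> x" "0 \<le> y" "x + y = coeff_energy S a" "0 < x + y" "y \<le> \<eta> * (x + y)"
    by (rule concentrated_trig_polynomial_split[OF d(1) \<eta>(1)]) (rule that)
  let ?T = "\<lambda>w. sq_mod (trig_poly S a w)"
  obtain r where r: "mean_shift_energy L g f S a = ennreal r"
    "0 \<le> r" "energy f * (energy g - \<rho>) * coeff_energy S a \<le> r"
    "r \<le> energy f * (energy g + \<rho>) * coeff_energy S a"
    by (rule weighted_lattice_energy[OF f g L \<rho> S]) (assumption | rule that)+
  have "ennreal r \<le> ennreal \<bar>det L\<bar> * (\<integral>\<^sup>+w. ennreal (M + 2 * e) * (?T w * indicator (unit_cube \<inter> ball 0 d) w) +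
       ennreal (B * energy f) * (?T w * indicator (unit_cube - ball 0 d) w) \<partial>lborel)"
    unfolding r(1)[symmetric]
  proof (intro mult_left_mono nn_integral_mono)
    fix w
    show "?T w * shift_energy L g f w * indicator unit_cube w \<le>
      ennreal (M + 2 * e) * (?T w * indicator (unit_cube \<inter> ball 0 d) w) +
       ennreal (B * energy f) * (?T w * indicator (unit_cube - ball 0 d) w)"
    proof (cases "w \<in> unit_cube \<inter> ball 0 d")
      case True
      then have "?T w * shift_energy L g f w \<le> ?T w * ennreal (M + 2 * e)"
        by (intro mult_left_mono near) auto
      with True show ?thesis by (simp add: mult.commute)
    next
      case False
      have "?T w * shift_energy L g f w \<le> ?T w * ennreal (B * energy f)"
        by (intro mult_left_mono far) auto
      with False show ?thesis by (auto simp: mult.commute indicator_def)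
    qed
  qed simp
  also have "\<dots> = ennreal \<bar>det L\<bar> * (ennreal (M + 2 * e) * ennreal x + ennreal (B * energy f) * ennreal y)"
    unfolding x[symmetric] y[symmetric] by (subst nn_integral_add) (auto simp: nn_integral_cmult)
  also have "\<dots> = ennreal (\<bar>det L\<bar> * ((M + 2 * e) * x + (B * energy f) * y))"
    using M0 e xy b0 by (simp add: ennreal_plus ennreal_mult)
  finally have "r \<le> \<bar>det L\<bar> * ((M + 2 * e) * x + (B * energy f) * y)"
    using M0 e xy b0 by simp
  moreover have "\<bar>det L\<bar> * (a0 * (x + y)) \<le> r"
  proof -
    have "\<bar>det L\<bar> * (a0 * (x + y)) = energy f * (energy g - \<rho>) * (x + y)"
      using det by (simp add: a0_def)
    then show ?thesis using r(3) by (simp only: xy(3))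
  qed
  ultimately have "\<bar>det L\<bar> * (a0 * (x + y)) \<le> \<bar>det L\<bar> * ((M + 2 * e) * x + (B * energy f) * y)"
    by linarith
  then have "a0 * (x + y) \<le> (M + 2 * e) * x + (B * energy f) * y"
    using det by simp
  also have "\<dots> \<le> (M + 2 * e) * (x + y) + (B * energy f) * (\<eta> * (x + y))"
    using xy M0 e b0 by (intro add_mono mult_left_mono) auto
  also have "\<dots> \<le> (M + 2 * e) * (x + y) + e * (x + y)"
    using mult_right_mono[OF \<eta>(2), of "x + y"] xy(4) by (simp add: mult.assoc)
  also have "\<dots> = (M + 3 * e) * (x + y)" by (simp add: algebra_simps)
  finally have "a0 \<le> M + 3 * e" using xy(4) by (simp add: mult_le_cancel_right)
  moreover have "a0 = M + 4 * e" by (simp add: e_def field_simps)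
  ultimately show False using e by simp
qed

section \<open>Borel representatives of Lebesgue measurable functions\<close>

lemma lebesgue_translation_measurable [measurable]:
  fixes a :: "'a::euclidean_space"
  shows "(\<lambda>t. t - a) \<in> lebesgue \<rightarrow>\<^sub>M lebesgue"
proof -
  have "(\<lambda>t. - a + (\<Sum>j\<in>Basis. (1 * (t \<bullet> j)) *\<^sub>R j)) \<in> lebesgue \<rightarrow>\<^sub>M lebesgue"
    by (rule lebesgue_affine_measurable) simp
  then show ?thesis by (simp add: euclidean_representation)
qed

lemma AE_lebesgue_translate:
  fixes a :: "'a::euclidean_space"
  assumes "AE t in lebesgue. P t"
  shows "AE t in lebesgue. P (t - a)"
proof -
  have "AE t in lborel. P t" using assms by (simp only: AE_completion_iff)
  then obtain N where N: "N \<in> null_sets lborel" "{t. \<not> P t} \<subseteq> N"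
    by (auto simp: eventually_ae_filter)
  have "{t. t - a \<in> N} \<in> null_sets lborel" by (rule null_sets_translation[OF N(1)])
  moreover have "{t. \<not> P (t - a)} \<subseteq> {t. t - a \<in> N}" using N(2) by auto
  ultimately have "AE t in lborel. P (t - a)" by (auto simp: eventually_ae_filter)
  then show ?thesis by (simp only: AE_completion_iff)
qed

lemma ex_borel_version:
  fixes f :: "'a::euclidean_space \<Rightarrow> complex"
  assumes f: "f \<in> borel_measurable lebesgue"
  obtains f' where "f' \<in> borel_measurable borel" "AE t in lebesgue. f t = f' t"
proof -
  have "(\<lambda>t. Re (f t)) \<in> borel_measurable lebesgue" "(\<lambda>t. Im (f t)) \<in> borel_measurable lebesgue"
    using f by measurable
  then obtain a b where [measurable]: "a \<in> borel_measurable lborel" "b \<in> borel_measurable lborel"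
    and ab: "AE t in lborel. Re (f t) = a t" "AE t in lborel. Im (f t) = b t"
    using completion_ex_borel_measurable_real by metis
  show thesis
  proof
    show "(\<lambda>t. complex_of_real (a t) + \<i> * complex_of_real (b t)) \<in> borel_measurable borel"
      using \<open>a \<in> _\<close> \<open>b \<in> _\<close> by simp
    have "AE t in lborel. f t = complex_of_real (a t) + \<i> * complex_of_real (b t)"
      using ab by eventually_elim (auto simp: complex_eq_iff)
    then show "AE t in lebesgue. f t = complex_of_real (a t) + \<i> * complex_of_real (b t)"
      by (simp add: AE_completion_iff)
  qed
qed

lemma borel_imp_lebesgue_measurable: "f \<in> borel_measurable borel \<Longrightarrow> f \<in> borel_measurable lebesgue"
  by (simp add: borel_measurable_if_lebesgue_on measurable_completion)

lemma tf_shift_lebesgue_measurable: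
  assumes g: "g \<in> borel_measurable lebesgue"
  shows "tf_shift z g \<in> borel_measurable lebesgue"
proof -
  have "(\<lambda>t. g (t - pos z)) \<in> borel_measurable lebesgue"
    using lebesgue_translation_measurable g by (rule measurable_compose)
  moreover have "(\<lambda>t. wave (freq z \<bullet> t)) \<in> borel_measurable lebesgue"
    by (rule borel_imp_lebesgue_measurable) measurable
  ultimately show ?thesis
    unfolding tf_shift_wave[abs_def] by (intro borel_measurable_times)
qed

lemma L2_version:
  assumes f: "f \<in> borel_measurable lebesgue" "integrable lebesgue (\<lambda>t. (cmod (f t))\<^sup>2)"
    and f': "f' \<in> borel_measurable borel" and eq: "AE t in lebesgue. f t = f' t"
  shows "sq_integrable f'" "energy f' = (LINT t|lebesgue. (cmod (f t))\<^sup>2)"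
proof -
  note [measurable] = f' borel_imp_lebesgue_measurable[OF f'] f(1)
  have eq2: "AE t in lebesgue. (cmod (f t))\<^sup>2 = (cmod (f' t))\<^sup>2"
    using eq by eventually_elim simp
  have m: "(\<lambda>t. (cmod (f t))\<^sup>2) \<in> borel_measurable lebesgue" "(\<lambda>t. (cmod (f' t))\<^sup>2) \<in> borel_measurable lebesgue"
    by measurable
  have m': "(\<lambda>t. (cmod (f' t))\<^sup>2) \<in> borel_measurable lborel" by measurable
  have "integrable lebesgue (\<lambda>t. (cmod (f' t))\<^sup>2)"
    using f(2) integrable_cong_AE[OF m eq2] by simp
  then show "sq_integrable f'"
    using f' integrable_completion[OF m'] by (simp add: sq_integrable_def)
  show "energy f' = (LINT t|lebesgue. (cmod (f t))\<^sup>2)"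
    unfolding energy_def integral_completion[OF m', symmetric] by (rule integral_cong_AE[OF m eq2, symmetric])
qed

lemma inner_L2_cong:
  assumes [measurable]: "f \<in> borel_measurable lebesgue" "h \<in> borel_measurable lebesgue"
      "f' \<in> borel_measurable lebesgue" "h' \<in> borel_measurable lebesgue"
    and "AE t in lebesgue. f t = f' t" "AE t in lebesgue. h t = h' t"
  shows "inner_L2 f h = inner_L2 f' h'"
  unfolding inner_L2_def
proof (rule integral_cong_AE)
  show "AE t in lebesgue. f t * cnj (h t) = f' t * cnj (h' t)"
    using assms(5,6) by eventually_elim simp
  show "(\<lambda>t. f t * cnj (h t)) \<in> borel_measurable lebesgue" "(\<lambda>t. f' t * cnj (h' t)) \<in> borel_measurable lebesgue"
    by (intro borel_measurable_times measurable_compose[OF _ cnj_measurable] assms)+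
qed

lemma stft_cong:
  assumes f: "f \<in> borel_measurable lebesgue" "f' \<in> borel_measurable borel" "AE t in lebesgue. f t = f' t"
    and g: "g \<in> borel_measurable lebesgue" "g' \<in> borel_measurable borel" "AE t in lebesgue. g t = g' t"
  shows "stft g f z = stft g' f' z"
  unfolding stft_def
proof (rule inner_L2_cong)
  show "AE t in lebesgue. tf_shift z g t = tf_shift z g' t"
    using AE_lebesgue_translate[OF g(3), of "pos z"] by eventually_elim (simp add: tf_shift_wave)
qed (intro f g tf_shift_lebesgue_measurable borel_imp_lebesgue_measurable)+

lemma tf_shift_in_L2:
  assumes g: "g \<in> borel_measurable lebesgue" "g' \<in> borel_measurable borel" "AE t in lebesgue. g t = g' t"
    and g': "sq_integrable g'"
  shows "tf_shift z g \<in> L2"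
proof -
  have m: "tf_shift z g \<in> borel_measurable lebesgue" "tf_shift z g' \<in> borel_measurable lebesgue"
    by (intro g tf_shift_lebesgue_measurable borel_imp_lebesgue_measurable)+
  have "AE t in lebesgue. (cmod (tf_shift z g' t))\<^sup>2 = (cmod (tf_shift z g t))\<^sup>2"
    using AE_lebesgue_translate[OF g(3), of "pos z"] by eventually_elim (simp add: tf_shift_wave)
  moreover have "integrable lebesgue (\<lambda>t. (cmod (tf_shift z g' t))\<^sup>2)"
  proof -
    note [measurable] = g(2)
    have "integrable lborel (\<lambda>t. (cmod (tf_shift z g' t))\<^sup>2)"
      using sq_integrable_tf_shift(1)[OF g', of z] by (simp add: sq_integrable_def)
    then show ?thesis by (subst integrable_completion) measurable
  qed
  moreover have "(\<lambda>t. (cmod (tf_shift z g t))\<^sup>2) \<in> borel_measurable lebesgue" "(\<lambda>t. (cmod (tf_shift z g' t))\<^sup>2) \<in> borel_measurable lebesgue"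
    using m by measurable
  ultimately have "integrable lebesgue (\<lambda>t. (cmod (tf_shift z g t))\<^sup>2)"
    using integrable_cong_AE by blast
  then show ?thesis using m by (simp add: L2_def)
qed

lemma weight_ge_1: "s \<ge> 0 \<Longrightarrow> 1 \<le> weight s z"
  by (simp add: weight_def ge_one_powr_ge_zero)

section \<open>Frame bounds for Gabor systems\<close>

theorem corollary4p2:
  fixes s :: real
    and L :: "real ^ ('d::finite + 'd) ^ ('d + 'd)"
    and g :: "real ^ 'd \<Rightarrow> complex"
  assumes "s \<ge> 0"
    and "invertible L"
    and "integrable lebesgue g"
    and "\<not> (AE t in lebesgue. g t = 0)"
    and "integrable lebesgue (fourier g)"
    and "adj_term s L g summable_on (int_vecs - {0})"
    and "(\<Sum>\<^sub>\<infinity>\<kappa>\<in>int_vecs - {0}. adj_term s L g \<kappa>) < (norm_L2 g)\<^sup>2"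
  shows "frame_with_bounds L2 inner_L2 int_vecs (\<lambda>\<kappa>. tf_shift (L *v \<kappa>) g)
           ((2 * (norm_L2 g)\<^sup>2 - sigma_Lg s L g) / \<bar>det L\<bar>)
           (sigma_Lg s L g / \<bar>det L\<bar>)
       \<and> sigma_Lg s L g / \<bar>det L\<bar> < 2 / \<bar>det L\<bar> * (norm_L2 g)\<^sup>2"
proof -
  define \<rho> where "\<rho> = (\<Sum>\<^sub>\<infinity>\<kappa>\<in>int_vecs - {0}. adj_term s L g \<kappa>)"
  have adj: "adj_term s L g \<kappa> = weight s (symp_J *v dual_vec L \<kappa>) * cmod (stft g g (symp_J *v dual_vec L \<kappa>))" for \<kappa>
    unfolding adj_term_def dual_vec_def Let_def matrix_vector_mul_assoc ..
  have adj_ge: "cmod (stft g g (symp_J *v dual_vec L \<kappa>)) \<le> adj_term s L g \<kappa>" for \<kappa>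
    unfolding adj using mult_right_mono[OF weight_ge_1[OF assms(1)] norm_ge_zero] by simp
  then have adj_nn: "0 \<le> adj_term s L g \<kappa>" for \<kappa>
    by (rule order_trans[OF norm_ge_zero])
  have \<rho>0: "0 \<le> \<rho>" unfolding \<rho>_def by (intro infsum_nonneg adj_nn)
  have N: "(norm_L2 g)\<^sup>2 = (LINT t|lebesgue. (cmod (g t))\<^sup>2)"
    by (simp add: norm_L2_def)
  have \<rho>N: "\<rho> < (norm_L2 g)\<^sup>2" using assms(7) by (simp add: \<rho>_def)
  have gm: "g \<in> borel_measurable lebesgue" using assms(3) by (rule borel_measurable_integrable)
  \<comment> \<open>The integral of a non-integrable function is \<open>0\<close>, so a positive \<open>norm_L2 g\<close> puts \<open>g\<close> into \<open>L\<^sup>2\<close>.\<close>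
  have gi: "integrable lebesgue (\<lambda>t. (cmod (g t))\<^sup>2)"
    using \<rho>0 \<rho>N not_integrable_integral_eq unfolding N by fastforce
  obtain g' where g': "g' \<in> borel_measurable borel" "AE t in lebesgue. g t = g' t"
    using ex_borel_version[OF gm] .
  have sg: "sq_integrable g'" and Eg: "energy g' = (norm_L2 g)\<^sup>2"
    using L2_version[OF gm gi g'] N by simp_all
  have gg: "stft g g z = stft g' g' z" for z
    by (rule stft_cong[OF gm g' gm g'])
  have bound: "(\<Sum>\<kappa>\<in>F. cmod (stft g' g' (symp_J *v dual_vec L \<kappa>))) \<le> \<rho>" if "finite F" "F \<subseteq> int_vecs - {0}" for F
  proof -
    have "(\<Sum>\<kappa>\<in>F. cmod (stft g' g' (symp_J *v dual_vec L \<kappa>))) \<le> (\<Sum>\<kappa>\<in>F. adj_term s L g \<kappa>)"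
      using adj_ge by (intro sum_mono) (simp add: gg)
    also have "\<dots> \<le> \<rho>"
      unfolding \<rho>_def using assms(6) that adj_nn by (intro finite_sum_le_infsum) auto
    finally show ?thesis .
  qed
  have det: "\<bar>det L\<bar> > 0" using assms(2) by (simp add: invertible_det_nz)
  have zero: "adj_term s L g 0 = (norm_L2 g)\<^sup>2"
  proof -
    have "stft g' g' 0 = complex_of_real (energy g')"
      using g'(1) by (simp add: stft_lborel energy_inner_self)
    then show ?thesis
      by (simp add: adj dual_vec_def gg weight_def norm_power Eg)
  qed
  have \<sigma>: "sigma_Lg s L g = (norm_L2 g)\<^sup>2 + \<rho>"
  proof -
    have "(0 :: real ^ ('d + 'd)) \<in> int_vecs" by (simp add: int_vecs_def)
    then have "sigma_Lg s L g = infsum (adj_term s L g) (insert 0 (int_vecs - {0}))"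
      by (simp add: sigma_Lg_def insert_absorb)
    also have "\<dots> = adj_term s L g 0 + \<rho>"
      unfolding \<rho>_def by (rule infsum_insert[OF assms(6)]) simp
    finally show ?thesis by (simp add: zero)
  qed
  have A: "(2 * (norm_L2 g)\<^sup>2 - sigma_Lg s L g) / \<bar>det L\<bar> = (energy g' - \<rho>) / \<bar>det L\<bar>"
    and B: "sigma_Lg s L g / \<bar>det L\<bar> = (energy g' + \<rho>) / \<bar>det L\<bar>"
    by (simp_all add: \<sigma> Eg)
  have "frame_with_bounds L2 inner_L2 int_vecs (\<lambda>\<kappa>. tf_shift (L *v \<kappa>) g)
      ((energy g' - \<rho>) / \<bar>det L\<bar>) ((energy g' + \<rho>) / \<bar>det L\<bar>)"
    unfolding frame_with_bounds_def
  proof (intro conjI ballI)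
    show "(\<lambda>\<kappa>. tf_shift (L *v \<kappa>) g) ` int_vecs \<subseteq> L2"
      using tf_shift_in_L2[OF gm g' sg] by auto
    show "0 < (energy g' - \<rho>) / \<bar>det L\<bar>" "0 < (energy g' + \<rho>) / \<bar>det L\<bar>"
      using det \<rho>0 \<rho>N by (simp_all add: Eg)
    fix f :: "real ^ 'd \<Rightarrow> complex" assume "f \<in> L2"
    then have f: "f \<in> borel_measurable lebesgue" "integrable lebesgue (\<lambda>t. (cmod (f t))\<^sup>2)"
      by (simp_all add: L2_def)
    obtain f' where f': "f' \<in> borel_measurable borel" "AE t in lebesgue. f t = f' t"
      using ex_borel_version[OF f(1)] .
    have sf: "sq_integrable f'" and Ef: "energy f' = (LINT t|lebesgue. (cmod (f t))\<^sup>2)"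
      using L2_version[OF f f'] by simp_all
    have "inner_L2 f f = inner_L2 f' f'"
      by (intro inner_L2_cong f f' borel_imp_lebesgue_measurable)
    then have ff: "Re (inner_L2 f f) = energy f'"
      using f'(1) by (simp add: inner_L2_lborel energy_inner_self)
    have fg: "(cmod (inner_L2 f (tf_shift (L *v \<kappa>) g)))\<^sup>2 = (cmod (stft g' f' (L *v \<kappa>)))\<^sup>2" for \<kappa>
      using stft_cong[OF f(1) f' gm g', of "L *v \<kappa>"] by (simp add: stft_def)
    note upper = lattice_energy_le[OF sf sg assms(2) bound]
    note lower = lattice_energy_ge[OF sf sg assms(2) bound]
    show "(\<lambda>\<kappa>. (cmod (inner_L2 f (tf_shift (L *v \<kappa>) g)))\<^sup>2) summable_on int_vecs"
      unfolding fg by (rule upper(1))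
    show "(energy g' - \<rho>) / \<bar>det L\<bar> * Re (inner_L2 f f) \<le> (\<Sum>\<^sub>\<infinity>\<kappa>\<in>int_vecs. (cmod (inner_L2 f (tf_shift (L *v \<kappa>) g)))\<^sup>2)"
      unfolding fg ff by (rule lower)
    show "(\<Sum>\<^sub>\<infinity>\<kappa>\<in>int_vecs. (cmod (inner_L2 f (tf_shift (L *v \<kappa>) g)))\<^sup>2) \<le> (energy g' + \<rho>) / \<bar>det L\<bar> * Re (inner_L2 f f)"
      unfolding fg ff by (rule upper(2))
  qed simp
  moreover have "sigma_Lg s L g / \<bar>det L\<bar> < 2 / \<bar>det L\<bar> * (norm_L2 g)\<^sup>2"
    unfolding \<sigma> using det \<rho>N by (simp add: divide_simps)
  ultimately show ?thesis unfolding A B by blast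
qed

end
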